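(* Let $\mu$ be an arbitrary measure. If $Y$ is a Banach space with the Radon-Nikodým property and such that the pair $(\ell_1,Y)$ has the Bishop-Phelps-Bollobás property, then the pair $(L_1(\mu),Y)$ has the Bishop-Phelps-Bollobás property. In particular, $(L_1(\mu),L_q(\nu))$ has the Bishop-Phelps-Bollobás property for all $1<q<\infty$ and all arbitrary measures $\nu$.
   Context: Banach spaces are over a fixed scalar field $\mathbb{K}=\mathbb{R}$ or $\mathbb{C}$. $S_X$ is the unit sphere of $X$; $\mathcal{L}(X,Y)$ is the space of bounded linear operators from $X$ to $Y$ with the operator norm. A pair $(X,Y)$ of Banach spaces has the Bishop-Phelps-Bollobás property (BPBp) if for every $0<\varepsilon<1$ there is $\eta(\varepsilon)>0$ such that for every $T\in\mathcal{L}(X,Y)$ with $\|T\|=1$ and every $x_0\in S_X$ with $\|T(x_0)\|>1-\eta(\varepsilon)$, there exist $y_0\in S_X$ and $S\in\mathcal{L}(X,Y)$ with $\|S\|=1$, $\|Sy_0\|=1$, $\|y_0-x_0\|<\varepsilon$ and $\|S-T\|<\varepsilon$. *)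

theory Defs
  imports "HOL-Analysis.Analysis" "HOL-Algebra.Module"
begin

text \<open>
  The spaces \<open>L\<^sub>p(\<mu>)\<close> depend on the term \<open>\<mu>\<close> and the scalars may be real or complex, so Banach
  spaces are carrier-based: a module record of HOL-Algebra together with a norm. The fields
  \<open>mult\<close> and \<open>one\<close>, which \<open>module\<close> inherits from \<open>ring\<close>, play no role.
\<close>

record ('k, 'v) nspace = "('k, 'v) module" +
  vnorm :: "'v \<Rightarrow> real"

definition scalars :: "'k::field ring" where
  "scalars = \<lparr>carrier = UNIV, mult = (*), one = 1, zero = 0, add = (+)\<rparr>"

locale normed_space =
  fixes X :: "('k::real_normed_field, 'v, 'm) nspace_scheme" (structure)
  assumes vector_space: "module scalars X"
    and vnorm_nonneg: "x \<in> carrier X \<Longrightarrow> 0 \<le> vnorm X x"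
    and vnorm_eq_0_iff: "x \<in> carrier X \<Longrightarrow> vnorm X x = 0 \<longleftrightarrow> x = \<zero>"
    and vnorm_smult: "x \<in> carrier X \<Longrightarrow> vnorm X (c \<odot>\<^bsub>X\<^esub> x) = norm c * vnorm X x"
    and vnorm_triangle: "x \<in> carrier X \<Longrightarrow> y \<in> carrier X \<Longrightarrow> vnorm X (x \<oplus> y) \<le> vnorm X x + vnorm X y"

locale banach_space = normed_space +
  assumes complete: "Metric_space.mcomplete (carrier X) (\<lambda>x y. vnorm X (x \<ominus> y))"


section \<open>Bounded linear operators and the Bishop-Phelps-Bollobas property\<close>

text \<open>
  Operators are HOL functions of which only the values on the carrier of the domain matter.
\<close>

definition bounded_op ::
  "('k::real_normed_field, 'v, 'm) nspace_scheme \<Rightarrow> ('k, 'w, 'n) nspace_scheme \<Rightarrow> ('v \<Rightarrow> 'w) \<Rightarrow> bool"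
where
  "bounded_op X Y T \<longleftrightarrow>
     T \<in> carrier X \<rightarrow> carrier Y \<and>
     (\<forall>x\<in>carrier X. \<forall>y\<in>carrier X. T (x \<oplus>\<^bsub>X\<^esub> y) = T x \<oplus>\<^bsub>Y\<^esub> T y) \<and>
     (\<forall>c. \<forall>x\<in>carrier X. T (c \<odot>\<^bsub>X\<^esub> x) = c \<odot>\<^bsub>Y\<^esub> T x) \<and>
     (\<exists>C. \<forall>x\<in>carrier X. vnorm Y (T x) \<le> C * vnorm X x)"

definition op_norm ::
  "('k::real_normed_field, 'v, 'm) nspace_scheme \<Rightarrow> ('k, 'w, 'n) nspace_scheme \<Rightarrow> ('v \<Rightarrow> 'w) \<Rightarrow> real"
where
  "op_norm X Y T = (SUP x\<in>{x \<in> carrier X. vnorm X x \<le> 1}. vnorm Y (T x))"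

definition unit_sphere :: "('k::real_normed_field, 'v, 'm) nspace_scheme \<Rightarrow> 'v set" where
  "unit_sphere X = {x \<in> carrier X. vnorm X x = 1}"

definition BPBp ::
  "('k::real_normed_field, 'v, 'm) nspace_scheme \<Rightarrow> ('k, 'w, 'n) nspace_scheme \<Rightarrow> bool"
where
  "BPBp X Y \<longleftrightarrow>
     (\<forall>\<epsilon>. 0 < \<epsilon> \<and> \<epsilon> < 1 \<longrightarrow>
       (\<exists>\<eta>>0. \<forall>T x\<^sub>0.
          bounded_op X Y T \<and> op_norm X Y T = 1 \<and> x\<^sub>0 \<in> unit_sphere X \<and> vnorm Y (T x\<^sub>0) > 1 - \<eta> \<longrightarrow>
          (\<exists>y\<^sub>0 S. y\<^sub>0 \<in> unit_sphere X \<and> bounded_op X Y S \<and> op_norm X Y S = 1 \<and>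
             vnorm Y (S y\<^sub>0) = 1 \<and> vnorm X (y\<^sub>0 \<ominus>\<^bsub>X\<^esub> x\<^sub>0) < \<epsilon> \<and>
             op_norm X Y (\<lambda>x. S x \<ominus>\<^bsub>Y\<^esub> T x) < \<epsilon>)))"


section \<open>The spaces \<open>\<ell>\<^sub>1\<close> and \<open>L\<^sub>p(\<mu>)\<close>\<close>

definition l1 :: "('k::real_normed_field, nat \<Rightarrow> 'k) nspace" where
  "l1 = \<lparr>carrier = {x. summable (\<lambda>n. norm (x n))}, mult = undefined, one = undefined,
         zero = (\<lambda>n. 0), add = (\<lambda>x y n. x n + y n), smult = (\<lambda>c x n. c * x n),
         vnorm = (\<lambda>x. \<Sum>n. norm (x n))\<rparr>"

definition Lp_functions :: "real \<Rightarrow> 'a measure \<Rightarrow> ('a \<Rightarrow> 'k::real_normed_field) set" where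
  "Lp_functions p M = {f \<in> borel_measurable M. integrable M (\<lambda>x. norm (f x) powr p)}"

definition Lp_rel :: "real \<Rightarrow> 'a measure \<Rightarrow> (('a \<Rightarrow> 'k::real_normed_field) \<times> ('a \<Rightarrow> 'k)) set" where
  "Lp_rel p M = {(f, g). f \<in> Lp_functions p M \<and> g \<in> Lp_functions p M \<and> (AE x in M. f x = g x)}"

text \<open>
  Elements of \<open>L\<^sub>p(M)\<close> are classes of functions modulo equality almost everywhere; the operations
  and the norm are computed on representatives.
\<close>

definition Lp :: "real \<Rightarrow> 'a measure \<Rightarrow> ('k::real_normed_field, ('a \<Rightarrow> 'k) set) nspace" where
  "Lp p M = \<lparr>carrier = Lp_functions p M // Lp_rel p M, mult = undefined, one = undefined,
     zero = Lp_rel p M `` {\<lambda>x. 0},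
     add = (\<lambda>F G. \<Union>f\<in>F. \<Union>g\<in>G. Lp_rel p M `` {\<lambda>x. f x + g x}),
     smult = (\<lambda>c F. \<Union>f\<in>F. Lp_rel p M `` {\<lambda>x. c * f x}),
     vnorm = (\<lambda>F. the_elem ((\<lambda>f. (LINT x|M. norm (f x) powr p) powr (1 / p)) ` F))\<rparr>"


section \<open>The Radon-Nikodym property\<close>

text \<open>
  The Bochner integral of HOL-Analysis requires a second countable type class, so it is set up
  here, over finite measures, for functions with values in a carrier-based space.
\<close>

definition simple_fun :: "('k::real_normed_field, 'v, 'm) nspace_scheme \<Rightarrow> 's measure \<Rightarrow> ('s \<Rightarrow> 'v) \<Rightarrow> bool"
where
  "simple_fun Y M s \<longleftrightarrow> simple_function M s \<and> s \<in> space M \<rightarrow> carrier Y"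

definition simple_int ::
  "('k::real_normed_field, 'v, 'm) nspace_scheme \<Rightarrow> 's measure \<Rightarrow> 's set \<Rightarrow> ('s \<Rightarrow> 'v) \<Rightarrow> 'v"
where
  "simple_int Y M E s =
     (\<Oplus>\<^bsub>Y\<^esub>v\<in>s ` space M. of_real (measure M {x \<in> E. s x = v}) \<odot>\<^bsub>Y\<^esub> v)"

definition strongly_measurable ::
  "('k::real_normed_field, 'v, 'm) nspace_scheme \<Rightarrow> 's measure \<Rightarrow> ('s \<Rightarrow> 'v) \<Rightarrow> bool"
where
  "strongly_measurable Y M g \<longleftrightarrow>
     g \<in> space M \<rightarrow> carrier Y \<and>
     (\<exists>s. (\<forall>i. simple_fun Y M (s i)) \<and>
          (AE x in M. (\<lambda>i. vnorm Y (s i x \<ominus>\<^bsub>Y\<^esub> g x)) \<longlonglongrightarrow> 0))"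

definition has_bochner_int ::
  "('k::real_normed_field, 'v, 'm) nspace_scheme \<Rightarrow> 's measure \<Rightarrow> 's set \<Rightarrow> ('s \<Rightarrow> 'v) \<Rightarrow> 'v \<Rightarrow> bool"
where
  "has_bochner_int Y M E g y \<longleftrightarrow>
     strongly_measurable Y M g \<and> y \<in> carrier Y \<and>
     (\<exists>s. (\<forall>i. simple_fun Y M (s i)) \<and>
          (\<lambda>i. \<integral>\<^sup>+x. ennreal (vnorm Y (s i x \<ominus>\<^bsub>Y\<^esub> g x)) \<partial>M) \<longlonglongrightarrow> 0 \<and>
          (\<lambda>i. vnorm Y (simple_int Y M E (s i) \<ominus>\<^bsub>Y\<^esub> y)) \<longlonglongrightarrow> 0)"

definition vector_measure ::
  "('k::real_normed_field, 'v, 'm) nspace_scheme \<Rightarrow> 's measure \<Rightarrow> ('s set \<Rightarrow> 'v) \<Rightarrow> bool"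
where
  "vector_measure Y M G \<longleftrightarrow>
     G \<in> sets M \<rightarrow> carrier Y \<and>
     (\<forall>A::nat \<Rightarrow> 's set. range A \<subseteq> sets M \<longrightarrow> disjoint_family A \<longrightarrow>
        (\<lambda>n. vnorm Y ((\<Oplus>\<^bsub>Y\<^esub>i\<in>{..<n}. G (A i)) \<ominus>\<^bsub>Y\<^esub> G (\<Union>i. A i))) \<longlonglongrightarrow> 0)"

definition bounded_variation ::
  "('k::real_normed_field, 'v, 'm) nspace_scheme \<Rightarrow> 's measure \<Rightarrow> ('s set \<Rightarrow> 'v) \<Rightarrow> bool"
where
  "bounded_variation Y M G \<longleftrightarrow>
     (\<exists>C. \<forall>P. finite P \<and> P \<subseteq> sets M \<and> partition_on (space M) P \<longrightarrow> (\<Sum>E\<in>P. vnorm Y (G E)) \<le> C)"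

definition measure_continuous ::
  "('k::real_normed_field, 'v, 'm) nspace_scheme \<Rightarrow> 's measure \<Rightarrow> ('s set \<Rightarrow> 'v) \<Rightarrow> bool"
where
  "measure_continuous Y M G \<longleftrightarrow>
     (\<forall>\<epsilon>>0. \<exists>\<delta>>0. \<forall>E\<in>sets M. measure M E < \<delta> \<longrightarrow> vnorm Y (G E) < \<epsilon>)"

text \<open>
  The Radon-Nikodym property asks for Bochner integrable densities over every finite measure space.
  HOL cannot quantify over types inside a formula, so the type \<open>'s\<close> of points is a parameter,
  while \<open>space M\<close> and its \<open>\<sigma>\<close>-algebra stay arbitrary. Densities over the Lebesgue unit interval
  already give densities over every finite measure space (a classical theorem),
  so whenever \<open>real\<close> embeds into \<open>'s\<close>, \<open>RNP TYPE('s) Y\<close> does not depend on the choice of \<open>'s\<close>.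
  With \<open>'s = 'a + real\<close> it covers all finite measures on sets of points of type \<open>'a\<close> literally.
\<close>

definition RNP :: "'s itself \<Rightarrow> ('k::real_normed_field, 'v, 'm) nspace_scheme \<Rightarrow> bool" where
  "RNP _ Y \<longleftrightarrow>
     (\<forall>(M::'s measure) G.
        finite_measure M \<and> vector_measure Y M G \<and> bounded_variation Y M G \<and> measure_continuous Y M G \<longrightarrow>
        (\<exists>g. \<forall>E\<in>sets M. has_bochner_int Y M E g (G E)))"

end

theory Submission
  imports Defs
begin

text \<open>
  Let \<open>T : L\<^sub>1(\<mu>) \<rightarrow> Y\<close> be an operator of norm one whose norm is almost attained at \<open>f\<^sub>0\<close>. It is modified
  on the functions supported where \<open>f\<^sub>0 \<noteq> 0\<close>, and is left alone on the other summand of \<open>L\<^sub>1(\<mu>)\<close>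
  (\<open>L1_operator_glue\<close>). Multiplication by a unimodular function is an isometry of \<open>L\<^sub>1(\<mu>)\<close>, so \<open>f\<^sub>0\<close>
  may be replaced by a nonnegative function \<open>h\<close> of integral one (\<open>BPBp_L1I\<close>). Then \<open>T\<close> is governed by
  the vector measure \<open>E \<mapsto> T(h 1\<^sub>E)\<close>, which is dominated by the probability measure \<open>h \<mu>\<close>. As this
  measure is finite whatever \<open>\<mu>\<close> is, \<open>\<mu>\<close> may be arbitrary.

  If \<open>Y\<close> has the Radon-Nikodym property, this vector measure has a density, and the density is
  essentially separably valued. Hence there is a countable partition on each cell of which \<open>T\<close> is up to a
  small error \<open>f \<mapsto> (\<integral>f) v\<close> for a fixed vector \<open>v\<close> (\<open>RNP_almost_constant_on_partition\<close>). Up to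
  this error \<open>T\<close> factors through the conditional expectation with respect to the partition, that is,
  through \<open>\<ell>\<^sub>1\<close>. The conditional expectation fixes \<open>h\<close>, so the operator on \<open>\<ell>\<^sub>1\<close> almost attains its norm,
  and a pair that the property of \<open>(\<ell>\<^sub>1, Y)\<close> provides can be carried back (\<open>BPBp_L1_RNP\<close>).

  For \<open>Y = L\<^sub>q(\<nu>)\<close> with \<open>1 < q < \<infinity>\<close> uniform convexity (\<open>uniformly_convex_Lp\<close>) takes the place of both
  hypotheses on \<open>Y\<close>. Put \<open>y = T h\<close>. A set \<open>E\<close> whose average \<open>T(h 1\<^sub>E) / \<integral>\<^sub>E h\<close> is far from \<open>y\<close> has an
  average whose midpoint with \<open>y\<close> is short, while the means of these midpoints give back \<open>y\<close>, which has
  almost maximal norm. So disjoint sets of this kind have little total mass, and after they are exhausted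
  \<open>T\<close> is close to \<open>f \<mapsto> (\<integral>f) y\<close> on what is left (\<open>BPBp_L1_uniformly_convex\<close>).

  To avoid computations with classes of functions, the property is first restated with contractions in
  place of operators of norm one (\<open>BPBpI\<close>, \<open>BPBpD\<close>), and operators on \<open>L\<^sub>1(\<mu>)\<close> are then treated as maps
  on integrable functions (\<open>L1_operator\<close>).
\<close>

section \<open>Carrier-based normed spaces\<close>

lemma scalars_simps [simp]:
  "carrier scalars = UNIV" "\<zero>\<^bsub>scalars\<^esub> = 0" "\<one>\<^bsub>scalars\<^esub> = 1"
  "a \<oplus>\<^bsub>scalars\<^esub> b = a + b" "a \<otimes>\<^bsub>scalars\<^esub> b = a * b"
  by (auto simp: scalars_def)

lemma cring_scalars: "cring (scalars :: 'k::field ring)"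
proof (rule cringI)
  show "abelian_group (scalars :: 'k ring)"
    by (rule abelian_groupI) (auto simp: intro: exI[of _ "- _"] left_minus)
  show "Group.comm_monoid (scalars :: 'k ring)"
    by (rule comm_monoidI) (auto simp: mult_ac)
qed (auto simp: distrib_right)

lemma scalars_a_inv [simp]: "\<ominus>\<^bsub>scalars\<^esub> (a::'k::field) = - a"
proof -
  interpret cring "scalars :: 'k ring" by (rule cring_scalars)
  show ?thesis by (rule minus_equality) auto
qed

text \<open>
  Additive inverses are obtained as multiples by \<open>-1\<close>. This spares the concrete spaces a computation of
  \<open>\<ominus>\<close>, which in a record is defined by a description.
\<close>

lemma normed_spaceI:
  fixes X :: "('k::real_normed_field, 'v, 'm) nspace_scheme" (structure)
  assumes "\<And>x y. x \<in> carrier X \<Longrightarrow> y \<in> carrier X \<Longrightarrow> x \<oplus> y \<in> carrier X"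
    and "\<zero> \<in> carrier X"
    and "\<And>a x. x \<in> carrier X \<Longrightarrow> a \<odot> x \<in> carrier X"
    and "\<And>x y z. x \<in> carrier X \<Longrightarrow> y \<in> carrier X \<Longrightarrow> z \<in> carrier X \<Longrightarrow> (x \<oplus> y) \<oplus> z = x \<oplus> (y \<oplus> z)"
    and "\<And>x y. x \<in> carrier X \<Longrightarrow> y \<in> carrier X \<Longrightarrow> x \<oplus> y = y \<oplus> x"
    and "\<And>x. x \<in> carrier X \<Longrightarrow> \<zero> \<oplus> x = x"
    and zero: "\<And>x. x \<in> carrier X \<Longrightarrow> (- 1) \<odot> x \<oplus> x = \<zero>"
    and "\<And>a b x. x \<in> carrier X \<Longrightarrow> (a + b) \<odot> x = a \<odot> x \<oplus> b \<odot> x"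
    and "\<And>a x y. x \<in> carrier X \<Longrightarrow> y \<in> carrier X \<Longrightarrow> a \<odot> (x \<oplus> y) = a \<odot> x \<oplus> a \<odot> y"
    and "\<And>a b x. x \<in> carrier X \<Longrightarrow> (a * b) \<odot> x = a \<odot> (b \<odot> x)"
    and "\<And>x. x \<in> carrier X \<Longrightarrow> 1 \<odot> x = x"
    and "\<And>x. x \<in> carrier X \<Longrightarrow> 0 \<le> vnorm X x"
    and "\<And>x. x \<in> carrier X \<Longrightarrow> vnorm X x = 0 \<longleftrightarrow> x = \<zero>"
    and "\<And>x c. x \<in> carrier X \<Longrightarrow> vnorm X (c \<odot> x) = norm c * vnorm X x"
    and "\<And>x y. x \<in> carrier X \<Longrightarrow> y \<in> carrier X \<Longrightarrow> vnorm X (x \<oplus> y) \<le> vnorm X x + vnorm X y"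
  shows "normed_space X"
proof (rule normed_space.intro)
  show "module scalars X"
  proof (rule moduleI)
    show "abelian_group X"
    proof (rule abelian_groupI)
      fix x assume "x \<in> carrier X"
      then show "\<exists>y\<in>carrier X. y \<oplus> x = \<zero>"
        using zero assms(3) by blast
    qed (use assms in auto)
  qed (simp_all add: assms cring_scalars)
qed (use assms in auto)

context normed_space
begin

sublocale module scalars X
  by (rule vector_space)

lemma smult_mem [simp, intro]: "x \<in> carrier X \<Longrightarrow> c \<odot>\<^bsub>X\<^esub> x \<in> carrier X"
  by simp

lemma smult_add_left: "x \<in> carrier X \<Longrightarrow> (a + b) \<odot>\<^bsub>X\<^esub> x = a \<odot>\<^bsub>X\<^esub> x \<oplus> b \<odot>\<^bsub>X\<^esub> x"
  using smult_l_distr[of a b x] by simp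

lemma smult_add_right:
  "x \<in> carrier X \<Longrightarrow> y \<in> carrier X \<Longrightarrow> a \<odot>\<^bsub>X\<^esub> (x \<oplus> y) = a \<odot>\<^bsub>X\<^esub> x \<oplus> a \<odot>\<^bsub>X\<^esub> y"
  using smult_r_distr[of a x y] by simp

lemma smult_smult: "x \<in> carrier X \<Longrightarrow> a \<odot>\<^bsub>X\<^esub> (b \<odot>\<^bsub>X\<^esub> x) = (a * b) \<odot>\<^bsub>X\<^esub> x"
  using smult_assoc1[of a b x] by simp

lemma smult_1 [simp]: "x \<in> carrier X \<Longrightarrow> 1 \<odot>\<^bsub>X\<^esub> x = x"
  using smult_one[of x] by simp

lemma smult_0 [simp]: "x \<in> carrier X \<Longrightarrow> 0 \<odot>\<^bsub>X\<^esub> x = \<zero>"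
  using smult_l_null[of x] by simp

lemma uminus_eq_smult: "x \<in> carrier X \<Longrightarrow> \<ominus> x = (- 1) \<odot>\<^bsub>X\<^esub> x"
  using smult_l_minus[of 1 x] by simp

lemma diff_eq: "x \<in> carrier X \<Longrightarrow> y \<in> carrier X \<Longrightarrow> x \<ominus> y = x \<oplus> (- 1) \<odot>\<^bsub>X\<^esub> y"
  by (simp add: minus_eq uminus_eq_smult)

lemma vnorm_zero [simp]: "vnorm X \<zero> = 0"
  using vnorm_eq_0_iff by simp

lemma vnorm_minus: "x \<in> carrier X \<Longrightarrow> vnorm X (\<ominus> x) = vnorm X x"
  by (simp add: uminus_eq_smult vnorm_smult)

lemma diff_self [simp]: "x \<in> carrier X \<Longrightarrow> x \<ominus> x = \<zero>"
  by (simp add: minus_eq r_neg)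

lemma diff_add_cancel: "x \<in> carrier X \<Longrightarrow> y \<in> carrier X \<Longrightarrow> (x \<ominus> y) \<oplus> y = x"
  by (simp add: minus_eq a_assoc l_neg)

lemma diff_eq_zero_iff: "x \<in> carrier X \<Longrightarrow> y \<in> carrier X \<Longrightarrow> x \<ominus> y = \<zero> \<longleftrightarrow> x = y"
  by (metis diff_add_cancel l_zero diff_self)

lemma add_diff_add:
  "a \<in> carrier X \<Longrightarrow> b \<in> carrier X \<Longrightarrow> c \<in> carrier X \<Longrightarrow> d \<in> carrier X \<Longrightarrow>
    (a \<oplus> b) \<ominus> (c \<oplus> d) = (a \<ominus> c) \<oplus> (b \<ominus> d)"
  by (simp add: minus_eq minus_add a_ac)

lemma smult_diff:
  "x \<in> carrier X \<Longrightarrow> y \<in> carrier X \<Longrightarrow> a \<odot>\<^bsub>X\<^esub> (x \<ominus> y) = a \<odot>\<^bsub>X\<^esub> x \<ominus> a \<odot>\<^bsub>X\<^esub> y"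
  by (simp add: diff_eq smult_add_right smult_smult)

lemma smult_diff_left: "x \<in> carrier X \<Longrightarrow> (a - b) \<odot>\<^bsub>X\<^esub> x = a \<odot>\<^bsub>X\<^esub> x \<ominus> b \<odot>\<^bsub>X\<^esub> x"
  using smult_add_left[of x a "- b"] by (simp add: diff_eq smult_smult)

lemma diff_trans:
  assumes "x \<in> carrier X" "y \<in> carrier X" "z \<in> carrier X"
  shows "(x \<ominus> y) \<oplus> (y \<ominus> z) = x \<ominus> z"
  using assms by (simp add: minus_eq a_assoc r_neg1)

lemma vnorm_diff_commute: "x \<in> carrier X \<Longrightarrow> y \<in> carrier X \<Longrightarrow> vnorm X (x \<ominus> y) = vnorm X (y \<ominus> x)"
  using vnorm_minus[of "x \<ominus> y"] by (simp add: minus_eq minus_add a_comm)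

lemma vnorm_diff_triangle:
  assumes "x \<in> carrier X" "y \<in> carrier X" "z \<in> carrier X"
  shows "vnorm X (x \<ominus> z) \<le> vnorm X (x \<ominus> y) + vnorm X (y \<ominus> z)"
  using vnorm_triangle[of "x \<ominus> y" "y \<ominus> z"] diff_trans[of x y z] assms by simp

lemma vnorm_triangle_sub:
  assumes "x \<in> carrier X" "y \<in> carrier X"
  shows "vnorm X x \<le> vnorm X y + vnorm X (x \<ominus> y)"
  using vnorm_triangle[of "x \<ominus> y" y] diff_add_cancel[of x y] assms by simp

lemma vnorm_diff_le:
  assumes "x \<in> carrier X" "y \<in> carrier X"
  shows "vnorm X (x \<ominus> y) \<le> vnorm X x + vnorm X y"
  using vnorm_triangle[of x "\<ominus> y"] assms by (simp add: minus_eq vnorm_minus)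

end

definition contraction ::
  "('k::real_normed_field, 'v, 'm) nspace_scheme \<Rightarrow> ('k, 'w, 'n) nspace_scheme \<Rightarrow> ('v \<Rightarrow> 'w) \<Rightarrow> bool"
where
  "contraction X Y T \<longleftrightarrow>
     (\<forall>x\<in>carrier X. T x \<in> carrier Y) \<and>
     (\<forall>x\<in>carrier X. \<forall>y\<in>carrier X. T (x \<oplus>\<^bsub>X\<^esub> y) = T x \<oplus>\<^bsub>Y\<^esub> T y) \<and>
     (\<forall>c. \<forall>x\<in>carrier X. T (c \<odot>\<^bsub>X\<^esub> x) = c \<odot>\<^bsub>Y\<^esub> T x) \<and>
     (\<forall>x\<in>carrier X. vnorm Y (T x) \<le> vnorm X x)"

lemma op_norm_upper:
  assumes X: "normed_space X" and T: "bounded_op X Y T" and x: "x \<in> carrier X" and Y: "normed_space Y"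
  shows "vnorm Y (T x) \<le> op_norm X Y T * vnorm X x"
proof -
  interpret X: normed_space X by fact
  interpret Y: normed_space Y by fact
  obtain C where C: "\<And>x. x \<in> carrier X \<Longrightarrow> vnorm Y (T x) \<le> C * vnorm X x"
    using T unfolding bounded_op_def by blast
  have Tc: "T x \<in> carrier Y" "\<And>c. T (c \<odot>\<^bsub>X\<^esub> x) = c \<odot>\<^bsub>Y\<^esub> T x"
    using T x by (auto simp: bounded_op_def)
  have bdd: "bdd_above ((\<lambda>x. vnorm Y (T x)) ` {x \<in> carrier X. vnorm X x \<le> 1})"
  proof (rule bdd_aboveI2)
    fix x assume "x \<in> {x \<in> carrier X. vnorm X x \<le> 1}"
    then show "vnorm Y (T x) \<le> \<bar>C\<bar>"
      using C[of x] X.vnorm_nonneg[of x] mult_mono[of C "\<bar>C\<bar>" "vnorm X x" 1] by force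
  qed
  show ?thesis
  proof (cases "vnorm X x = 0")
    case True
    then show ?thesis using C[OF x] by simp
  next
    case False
    then have pos: "vnorm X x > 0" using X.vnorm_nonneg[OF x] by simp
    let ?c = "of_real (1 / vnorm X x)"
    have "vnorm X (?c \<odot>\<^bsub>X\<^esub> x) \<le> 1"
      using x pos by (simp add: X.vnorm_smult norm_divide)
    then have "vnorm Y (T (?c \<odot>\<^bsub>X\<^esub> x)) \<le> op_norm X Y T"
      unfolding op_norm_def using x by (intro cSUP_upper bdd) auto
    then show ?thesis
      using pos by (simp add: Tc Y.vnorm_smult norm_divide pos_divide_le_eq)
  qed
qed

lemma op_norm_least:
  assumes X: "normed_space X" and "0 \<le> C"
    and "\<And>x. x \<in> carrier X \<Longrightarrow> vnorm Y (T x) \<le> C * vnorm X x"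
  shows "op_norm X Y T \<le> C"
proof -
  interpret X: normed_space X by fact
  show ?thesis unfolding op_norm_def
  proof (rule cSUP_least)
    show "{x \<in> carrier X. vnorm X x \<le> 1} \<noteq> {}"
      using X.zero_closed X.vnorm_zero by force
    fix x assume "x \<in> {x \<in> carrier X. vnorm X x \<le> 1}"
    then show "vnorm Y (T x) \<le> C"
      using assms(3)[of x] mult_left_mono[of "vnorm X x" 1 C] assms(2) by auto
  qed
qed

lemma bounded_op_of_contraction:
  assumes "contraction X Y T"
  shows "bounded_op X Y T"
  using assms unfolding contraction_def bounded_op_def by (auto intro!: exI[of _ 1])

lemma op_norm_contraction_eq_1:
  assumes X: "normed_space X" and Y: "normed_space Y" and T: "contraction X Y T"
    and x: "x \<in> unit_sphere X" "vnorm Y (T x) = 1"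
  shows "op_norm X Y T = 1"
proof (rule antisym)
  show "op_norm X Y T \<le> 1"
    using T by (intro op_norm_least[OF X]) (auto simp: contraction_def)
  show "1 \<le> op_norm X Y T"
    using op_norm_upper[OF X bounded_op_of_contraction[OF T] _ Y, of x] x
    by (simp add: unit_sphere_def)
qed

lemma contraction_of_bounded_op:
  assumes X: "normed_space X" and Y: "normed_space Y"
    and T: "bounded_op X Y T" and "op_norm X Y T = 1"
  shows "contraction X Y T"
  using op_norm_upper[OF X T _ Y] T assms(4) by (auto simp: contraction_def bounded_op_def)

text \<open>
  The bound on \<open>S - T\<close> is asked for pointwise and in weak form; the strict bound on the operator norm
  results from the assumption at \<open>\<epsilon> / 2\<close>.
\<close>

lemma BPBpI:
  fixes X :: "('k::real_normed_field, 'v, 'm) nspace_scheme"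
  assumes X: "normed_space X" and Y: "normed_space Y"
    and "\<And>\<epsilon>. 0 < \<epsilon> \<Longrightarrow> \<epsilon> < 1 \<Longrightarrow> \<exists>\<eta>>0. \<forall>T x\<^sub>0. contraction X Y T \<and> x\<^sub>0 \<in> unit_sphere X \<and>
        vnorm Y (T x\<^sub>0) > 1 - \<eta> \<longrightarrow>
        (\<exists>y\<^sub>0 S. y\<^sub>0 \<in> unit_sphere X \<and> contraction X Y S \<and> vnorm Y (S y\<^sub>0) = 1 \<and>
           vnorm X (y\<^sub>0 \<ominus>\<^bsub>X\<^esub> x\<^sub>0) < \<epsilon> \<and> (\<forall>x\<in>carrier X. vnorm Y (S x \<ominus>\<^bsub>Y\<^esub> T x) \<le> \<epsilon> * vnorm X x))"
  shows "BPBp X Y"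
  unfolding BPBp_def
proof (intro allI impI)
  fix \<epsilon> :: real assume \<epsilon>: "0 < \<epsilon> \<and> \<epsilon> < 1"
  then obtain \<eta> where \<eta>: "\<eta> > 0" and *: "\<And>T x\<^sub>0. contraction X Y T \<and> x\<^sub>0 \<in> unit_sphere X \<and>
        vnorm Y (T x\<^sub>0) > 1 - \<eta> \<Longrightarrow>
        (\<exists>y\<^sub>0 S. y\<^sub>0 \<in> unit_sphere X \<and> contraction X Y S \<and> vnorm Y (S y\<^sub>0) = 1 \<and>
           vnorm X (y\<^sub>0 \<ominus>\<^bsub>X\<^esub> x\<^sub>0) < \<epsilon> / 2 \<and> (\<forall>x\<in>carrier X. vnorm Y (S x \<ominus>\<^bsub>Y\<^esub> T x) \<le> \<epsilon> / 2 * vnorm X x))"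
    using assms(3)[of "\<epsilon> / 2"] by auto
  show "\<exists>\<eta>>0. \<forall>T x\<^sub>0.
          bounded_op X Y T \<and> op_norm X Y T = 1 \<and> x\<^sub>0 \<in> unit_sphere X \<and> vnorm Y (T x\<^sub>0) > 1 - \<eta> \<longrightarrow>
          (\<exists>y\<^sub>0 S. y\<^sub>0 \<in> unit_sphere X \<and> bounded_op X Y S \<and> op_norm X Y S = 1 \<and>
             vnorm Y (S y\<^sub>0) = 1 \<and> vnorm X (y\<^sub>0 \<ominus>\<^bsub>X\<^esub> x\<^sub>0) < \<epsilon> \<and>
             op_norm X Y (\<lambda>x. S x \<ominus>\<^bsub>Y\<^esub> T x) < \<epsilon>)"
  proof (intro exI[of _ \<eta>] conjI \<eta> allI impI; elim conjE)
    fix T x\<^sub>0 assume "bounded_op X Y T" "op_norm X Y T = 1" "x\<^sub>0 \<in> unit_sphere X" "vnorm Y (T x\<^sub>0) > 1 - \<eta>"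
    then obtain y\<^sub>0 S where S: "y\<^sub>0 \<in> unit_sphere X" "contraction X Y S" "vnorm Y (S y\<^sub>0) = 1"
      "vnorm X (y\<^sub>0 \<ominus>\<^bsub>X\<^esub> x\<^sub>0) < \<epsilon> / 2" "\<And>x. x \<in> carrier X \<Longrightarrow> vnorm Y (S x \<ominus>\<^bsub>Y\<^esub> T x) \<le> \<epsilon> / 2 * vnorm X x"
      using *[of T x\<^sub>0] contraction_of_bounded_op[OF X Y] by blast
    have "op_norm X Y (\<lambda>x. S x \<ominus>\<^bsub>Y\<^esub> T x) \<le> \<epsilon> / 2"
      using S(5) \<epsilon> by (intro op_norm_least[OF X]) auto
    then show "\<exists>y\<^sub>0 S. y\<^sub>0 \<in> unit_sphere X \<and> bounded_op X Y S \<and> op_norm X Y S = 1 \<and>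
             vnorm Y (S y\<^sub>0) = 1 \<and> vnorm X (y\<^sub>0 \<ominus>\<^bsub>X\<^esub> x\<^sub>0) < \<epsilon> \<and>
             op_norm X Y (\<lambda>x. S x \<ominus>\<^bsub>Y\<^esub> T x) < \<epsilon>"
      using S \<epsilon> bounded_op_of_contraction[OF S(2)] op_norm_contraction_eq_1[OF X Y S(2,1,3)]
      by (intro exI[of _ y\<^sub>0] exI[of _ S]) auto
  qed
qed

text \<open>
  Operators of norm less than one are admitted in the hypothesis: if \<open>\<parallel>U\<parallel> > 1 - \<eta>\<close>, then \<open>U\<close> is
  \<open>\<eta>\<close>-close to its normalisation, to which the property applies.
\<close>

lemma BPBpD:
  fixes X :: "('k::real_normed_field, 'v, 'm) nspace_scheme"
  assumes X: "normed_space X" and Y: "normed_space Y" and B: "BPBp X Y"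
    and \<epsilon>: "0 < \<epsilon>" "\<epsilon> < 1"
  obtains \<eta> where "\<eta> > 0"
    "\<And>U x\<^sub>0. contraction X Y U \<Longrightarrow> x\<^sub>0 \<in> unit_sphere X \<Longrightarrow> vnorm Y (U x\<^sub>0) > 1 - \<eta> \<Longrightarrow>
        \<exists>z V. z \<in> unit_sphere X \<and> contraction X Y V \<and> vnorm Y (V z) = 1 \<and>
           vnorm X (z \<ominus>\<^bsub>X\<^esub> x\<^sub>0) < \<epsilon> \<and> (\<forall>x\<in>carrier X. vnorm Y (V x \<ominus>\<^bsub>Y\<^esub> U x) \<le> \<epsilon> * vnorm X x)"
proof -
  interpret X: normed_space X by fact
  interpret Y: normed_space Y by fact
  obtain \<eta> where \<eta>: "\<eta> > 0" and *: "\<And>T x\<^sub>0.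
          bounded_op X Y T \<Longrightarrow> op_norm X Y T = 1 \<Longrightarrow> x\<^sub>0 \<in> unit_sphere X \<Longrightarrow> vnorm Y (T x\<^sub>0) > 1 - \<eta> \<Longrightarrow>
          (\<exists>y\<^sub>0 S. y\<^sub>0 \<in> unit_sphere X \<and> bounded_op X Y S \<and> op_norm X Y S = 1 \<and>
             vnorm Y (S y\<^sub>0) = 1 \<and> vnorm X (y\<^sub>0 \<ominus>\<^bsub>X\<^esub> x\<^sub>0) < \<epsilon> / 2 \<and>
             op_norm X Y (\<lambda>x. S x \<ominus>\<^bsub>Y\<^esub> T x) < \<epsilon> / 2)"
    using B \<epsilon> unfolding BPBp_def by (auto dest!: spec[of _ "\<epsilon> / 2"])
  show thesis
  proof (rule that[of "min \<eta> (\<epsilon> / 2)"])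
    show "min \<eta> (\<epsilon> / 2) > 0" using \<eta> \<epsilon> by simp
    fix U x\<^sub>0 assume U: "contraction X Y U" and x0: "x\<^sub>0 \<in> unit_sphere X"
      and big: "vnorm Y (U x\<^sub>0) > 1 - min \<eta> (\<epsilon> / 2)"
    define u where "u = op_norm X Y U"
    note Ub = bounded_op_of_contraction[OF U]
    have x0': "x\<^sub>0 \<in> carrier X" "vnorm X x\<^sub>0 = 1" using x0 by (auto simp: unit_sphere_def)
    have ux: "vnorm Y (U x\<^sub>0) \<le> u"
      using op_norm_upper[OF X Ub x0'(1) Y] x0' by (simp add: u_def)
    have u: "1 - \<epsilon> / 2 < u" "u \<le> 1" "0 < u"
      using ux big \<epsilon> op_norm_least[OF X, of 1 Y U] U by (auto simp: u_def contraction_def)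
    define c where "c = (of_real (1 / u) :: 'k)"
    define T where "T = (\<lambda>x. c \<odot>\<^bsub>Y\<^esub> U x)"
    have Uc: "\<And>x. x \<in> carrier X \<Longrightarrow> U x \<in> carrier Y" using U by (auto simp: contraction_def)
    have nT: "vnorm Y (T x) = vnorm Y (U x) / u" if "x \<in> carrier X" for x
      using u that by (simp add: T_def c_def Uc Y.vnorm_smult norm_divide)
    have Tcon: "contraction X Y T"
      unfolding contraction_def
    proof (intro conjI ballI allI)
      fix x assume x: "x \<in> carrier X"
      show "vnorm Y (T x) \<le> vnorm X x"
        using op_norm_upper[OF X Ub x Y] u by (simp add: nT x u_def[symmetric] field_simps)
    qed (use U in \<open>auto simp: T_def contraction_def Y.smult_add_right Y.smult_smult mult.commute\<close>)
    note Tb = bounded_op_of_contraction[OF Tcon]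
    have "op_norm X Y T = 1"
    proof (rule antisym)
      show "op_norm X Y T \<le> 1"
        using Tcon by (intro op_norm_least[OF X]) (auto simp: contraction_def)
      have "u \<le> op_norm X Y T * u"
      proof -
        have *: "vnorm Y (U x) \<le> op_norm X Y T * u * vnorm X x" if "x \<in> carrier X" for x
          using op_norm_upper[OF X Tb that Y] u by (simp add: nT that field_simps)
        have "0 \<le> op_norm X Y T * u"
          using *[OF x0'(1)] x0' Y.vnorm_nonneg[OF Uc[OF x0'(1)]] by simp
        with * show ?thesis unfolding u_def by (intro op_norm_least[OF X]) auto
      qed
      then show "1 \<le> op_norm X Y T" using u by simp
    qed
    moreover have "vnorm Y (T x\<^sub>0) > 1 - \<eta>"
    proof -
      have "vnorm Y (U x\<^sub>0) \<le> vnorm Y (U x\<^sub>0) / u"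
        using u Y.vnorm_nonneg[OF Uc[OF x0'(1)]] mult_left_mono[of u 1 "vnorm Y (U x\<^sub>0)"]
        by (simp add: field_simps)
      then show ?thesis using big nT[OF x0'(1)] by simp
    qed
    ultimately obtain z V where V: "z \<in> unit_sphere X" "bounded_op X Y V" "op_norm X Y V = 1"
             "vnorm Y (V z) = 1" "vnorm X (z \<ominus>\<^bsub>X\<^esub> x\<^sub>0) < \<epsilon> / 2"
             "op_norm X Y (\<lambda>x. V x \<ominus>\<^bsub>Y\<^esub> T x) < \<epsilon> / 2"
      using *[OF Tb _ x0] by blast
    note Vc = contraction_of_bounded_op[OF X Y V(2,3)]
    have diff: "bounded_op X Y (\<lambda>x. V x \<ominus>\<^bsub>Y\<^esub> T x)"
      unfolding bounded_op_def
    proof (intro conjI ballI allI exI[of _ 2])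
      fix x assume "x \<in> carrier X"
      then show "vnorm Y (V x \<ominus>\<^bsub>Y\<^esub> T x) \<le> 2 * vnorm X x"
        using Y.vnorm_diff_le[of "V x" "T x"] Vc Tcon by (force simp: contraction_def)
    qed (use Vc Tcon in \<open>auto simp: contraction_def Y.add_diff_add Y.smult_diff\<close>)
    have "vnorm Y (V x \<ominus>\<^bsub>Y\<^esub> U x) \<le> \<epsilon> * vnorm X x" if x: "x \<in> carrier X" for x
    proof -
      have mem: "V x \<in> carrier Y" "T x \<in> carrier Y" "U x \<in> carrier Y"
        using Vc Tcon U x by (auto simp: contraction_def)
      have "op_norm X Y (\<lambda>x. V x \<ominus>\<^bsub>Y\<^esub> T x) * vnorm X x \<le> \<epsilon> / 2 * vnorm X x"
        using V(6) X.vnorm_nonneg[OF x] by (intro mult_right_mono) auto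
      then have 1: "vnorm Y (V x \<ominus>\<^bsub>Y\<^esub> T x) \<le> \<epsilon> / 2 * vnorm X x"
        using op_norm_upper[OF X diff x Y] by linarith
      have "T x \<ominus>\<^bsub>Y\<^esub> U x = (c - 1) \<odot>\<^bsub>Y\<^esub> U x"
        using mem by (simp add: T_def Y.smult_diff_left)
      then have "vnorm Y (T x \<ominus>\<^bsub>Y\<^esub> U x) = norm (c - 1) * vnorm Y (U x)"
        using mem by (simp add: Y.vnorm_smult)
      also have "norm (c - 1) = 1 / u - 1"
      proof -
        have "c - 1 = of_real (1 / u - 1)" by (simp add: c_def)
        then show ?thesis using u by (simp only: norm_of_real) auto
      qed
      also have "(1 / u - 1) * vnorm Y (U x) \<le> (1 / u - 1) * (u * vnorm X x)"
        using u op_norm_upper[OF X Ub x Y] by (intro mult_left_mono) (auto simp: u_def[symmetric])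
      also have "\<dots> = (1 - u) * vnorm X x" using u by (simp add: field_simps)
      also have "\<dots> \<le> \<epsilon> / 2 * vnorm X x"
        using u X.vnorm_nonneg[OF x] by (intro mult_right_mono) auto
      finally show ?thesis using 1 Y.vnorm_diff_triangle[of "V x" "T x" "U x"] mem by (simp add: field_simps)
    qed
    then show "\<exists>z V. z \<in> unit_sphere X \<and> contraction X Y V \<and> vnorm Y (V z) = 1 \<and>
           vnorm X (z \<ominus>\<^bsub>X\<^esub> x\<^sub>0) < \<epsilon> \<and> (\<forall>x\<in>carrier X. vnorm Y (V x \<ominus>\<^bsub>Y\<^esub> U x) \<le> \<epsilon> * vnorm X x)"
      using V Vc \<epsilon> by (intro exI[of _ z] exI[of _ V]) auto
  qed
qed

section \<open>The spaces \<open>\<ell>\<^sub>1\<close> and \<open>L\<^sub>p(\<mu>)\<close> as normed spaces\<close>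

lemma l1_simps:
  "carrier l1 = {x :: nat \<Rightarrow> 'k::real_normed_field. summable (\<lambda>n. norm (x n))}"
  "\<zero>\<^bsub>l1\<^esub> = (\<lambda>n. 0 :: 'k)" "x \<oplus>\<^bsub>l1\<^esub> y = (\<lambda>n. x n + y n :: 'k)"
  "c \<odot>\<^bsub>l1\<^esub> x = (\<lambda>n. c * x n :: 'k)" "vnorm l1 x = (\<Sum>n. norm (x n :: 'k))"
  by (simp_all add: l1_def)

lemma normed_space_l1: "normed_space (l1 :: ('k::real_normed_field, nat \<Rightarrow> 'k) nspace)"
proof (rule normed_spaceI)
  fix x y :: "nat \<Rightarrow> 'k" assume "x \<in> carrier l1" "y \<in> carrier l1"
  then have s: "summable (\<lambda>n. norm (x n))" "summable (\<lambda>n. norm (y n))" by (auto simp: l1_simps)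
  have sum: "summable (\<lambda>n. norm (x n + y n))"
    by (rule summable_comparison_test'[OF summable_add[OF s], of 0]) (simp add: norm_triangle_ineq)
  then show "x \<oplus>\<^bsub>l1\<^esub> y \<in> carrier l1" by (simp add: l1_simps)
  show "vnorm l1 (x \<oplus>\<^bsub>l1\<^esub> y) \<le> vnorm l1 x + vnorm l1 y"
    unfolding l1_simps suminf_add[OF s]
    by (rule suminf_le[OF _ sum summable_add[OF s]]) (simp add: norm_triangle_ineq)
next
  show "\<zero>\<^bsub>l1\<^esub> \<in> carrier (l1 :: ('k, nat \<Rightarrow> 'k) nspace)" by (simp add: l1_simps)
next
  fix x y z :: "nat \<Rightarrow> 'k" and a b :: 'k assume "x \<in> carrier l1"
  then have s: "summable (\<lambda>n. norm (x n))" by (simp add: l1_simps)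
  show "a \<odot>\<^bsub>l1\<^esub> x \<in> carrier l1" "vnorm l1 (a \<odot>\<^bsub>l1\<^esub> x) = norm a * vnorm l1 x"
    using s by (simp_all add: l1_simps norm_mult summable_mult suminf_mult)
  show "0 \<le> vnorm l1 x" "vnorm l1 x = 0 \<longleftrightarrow> x = \<zero>\<^bsub>l1\<^esub>"
    using s by (simp_all add: l1_simps suminf_nonneg suminf_eq_zero_iff fun_eq_iff)
qed (simp_all add: l1_simps ring_distribs add_ac mult.assoc)

lemma l1_diff:
  fixes x y :: "nat \<Rightarrow> 'k::real_normed_field"
  assumes "x \<in> carrier l1" "y \<in> carrier l1"
  shows "x \<ominus>\<^bsub>l1\<^esub> y = (\<lambda>n. x n - y n)"
proof -
  interpret normed_space "l1 :: ('k, nat \<Rightarrow> 'k) nspace" by (rule normed_space_l1)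
  show ?thesis using assms by (simp add: diff_eq) (simp add: l1_simps)
qed

definition Lp_class :: "real \<Rightarrow> 'a measure \<Rightarrow> ('a \<Rightarrow> 'k::real_normed_field) \<Rightarrow> ('a \<Rightarrow> 'k) set" where
  "Lp_class p M f = Lp_rel p M `` {f}"

definition Lp_norm :: "real \<Rightarrow> 'a measure \<Rightarrow> ('a \<Rightarrow> 'k::real_normed_field) \<Rightarrow> real" where
  "Lp_norm p M f = (LINT x|M. norm (f x) powr p) powr (1 / p)"

lemma mem_Lp_class: "g \<in> Lp_class p M f \<longleftrightarrow> f \<in> Lp_functions p M \<and> g \<in> Lp_functions p M \<and> (AE x in M. f x = g x)"
  by (auto simp: Lp_class_def Lp_rel_def)

lemma Lp_class_self: "f \<in> Lp_functions p M \<Longrightarrow> f \<in> Lp_class p M f"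
  by (simp add: mem_Lp_class)

lemma Lp_class_cong:
  assumes "AE x in M. f x = g x" "f \<in> Lp_functions p M" "g \<in> Lp_functions p M"
  shows "Lp_class p M f = Lp_class p M g"
proof -
  have "(AE x in M. f x = h x) \<longleftrightarrow> (AE x in M. g x = h x)" for h
    by (rule eventually_subst) (use assms(1) in \<open>eventually_elim, simp\<close>)
  then show ?thesis using assms by (auto simp: mem_Lp_class)
qed

lemma Lp_class_eq_iff:
  assumes "f \<in> Lp_functions p M" "g \<in> Lp_functions p M"
  shows "Lp_class p M f = Lp_class p M g \<longleftrightarrow> (AE x in M. f x = g x)"
  using Lp_class_cong[of f g M p] Lp_class_self[of g p M] assms
  by (metis mem_Lp_class)

lemma Lp_norm_cong:
  assumes "AE x in M. f x = g x" "f \<in> borel_measurable M" "g \<in> borel_measurable M"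
  shows "Lp_norm p M f = Lp_norm p M g"
proof -
  have "(LINT x|M. norm (f x) powr p) = (LINT x|M. norm (g x) powr p)"
    by (rule integral_cong_AE) (use assms in auto)
  then show ?thesis by (simp add: Lp_norm_def)
qed

lemma carrier_Lp: "carrier (Lp p M) = Lp_class p M ` Lp_functions p M"
  by (auto simp: Lp_def quotient_def Lp_class_def)

lemma zero_Lp: "\<zero>\<^bsub>Lp p M\<^esub> = Lp_class p M (\<lambda>x. 0)"
  by (simp add: Lp_def Lp_class_def)

lemma vnorm_Lp:
  assumes "f \<in> Lp_functions p M"
  shows "vnorm (Lp p M) (Lp_class p M f) = Lp_norm p M f"
proof -
  have "(\<lambda>f. (LINT x|M. norm (f x) powr p) powr (1 / p)) ` Lp_class p M f = {Lp_norm p M f}"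
  proof -
    have "Lp_norm p M g = Lp_norm p M f" if "g \<in> Lp_class p M f" for g
      by (rule sym, rule Lp_norm_cong) (use that in \<open>auto simp: mem_Lp_class Lp_functions_def\<close>)
    then show ?thesis
      unfolding Lp_norm_def[symmetric] using Lp_class_self[OF assms] by blast
  qed
  then show ?thesis by (simp add: Lp_def)
qed

text \<open>
  Convexity of the \<open>p\<close>-th power up to the boundary point \<open>0\<close>, where it amounts to \<open>s\<^sup>p \<le> s\<close> for \<open>s \<le> 1\<close>.
\<close>

lemma powr_convex_ineq:
  fixes p :: real
  assumes p: "1 \<le> p" and uv: "0 \<le> u" "0 \<le> v" and st: "0 < s" "0 < t" "s + t = 1"
  shows "(s * u + t * v) powr p \<le> s * u powr p + t * v powr p"
proof -
  have le: "r powr p \<le> r" if "0 < r" "r < 1" for r :: real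
    using powr_mono'[of 1 p r] p that by simp
  consider "u = 0" | "v = 0" | "0 < u" "0 < v" using uv by linarith
  then show ?thesis
  proof cases
    case 1
    then show ?thesis using le[of t] st uv by (simp add: powr_mult mult_right_mono)
  next
    case 2
    then show ?thesis using le[of s] st uv by (simp add: powr_mult mult_right_mono)
  next
    case 3
    then show ?thesis
      using convex_onD[OF powr_convex[OF p], of t u v] st by (simp add: eq_diff_eq[symmetric])
  qed
qed

context
  fixes p :: real and M :: "'a measure"
  assumes p: "1 \<le> p"
begin

lemma Lp_functions_add:
  fixes f g :: "'a \<Rightarrow> 'k::{real_normed_field, second_countable_topology}"
  assumes "f \<in> Lp_functions p M" "g \<in> Lp_functions p M"
  shows "(\<lambda>x. f x + g x) \<in> Lp_functions p M"
proof -
  have [measurable]: "f \<in> borel_measurable M" "g \<in> borel_measurable M"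
    using assms by (auto simp: Lp_functions_def)
  have int: "integrable M (\<lambda>x. 2 powr p * (norm (f x) powr p + norm (g x) powr p))"
    using assms by (auto simp: Lp_functions_def)
  have "integrable M (\<lambda>x. norm (f x + g x) powr p)"
  proof (rule Bochner_Integration.integrable_bound[OF int])
    show "AE x in M. norm (norm (f x + g x) powr p)
        \<le> norm (2 powr p * (norm (f x) powr p + norm (g x) powr p))"
    proof (rule AE_I2)
      fix x
      have "norm (f x + g x) \<le> 2 * max (norm (f x)) (norm (g x))"
        using norm_triangle_ineq[of "f x" "g x"] by simp
      then have "norm (f x + g x) powr p \<le> (2 * max (norm (f x)) (norm (g x))) powr p"
        using p by (intro powr_mono2) auto
      also have "\<dots> = 2 powr p * max (norm (f x)) (norm (g x)) powr p"
        by (simp add: powr_mult)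
      also have "max (norm (f x)) (norm (g x)) powr p \<le> norm (f x) powr p + norm (g x) powr p"
        by (simp add: max_def)
      finally show "norm (norm (f x + g x) powr p)
        \<le> norm (2 powr p * (norm (f x) powr p + norm (g x) powr p))" by simp
    qed
  qed simp
  then show ?thesis by (simp add: Lp_functions_def)
qed

lemma Lp_functions_smult:
  fixes f :: "'a \<Rightarrow> 'k::{real_normed_field, second_countable_topology}"
  assumes "f \<in> Lp_functions p M"
  shows "(\<lambda>x. c * f x) \<in> Lp_functions p M"
  using assms by (auto simp: Lp_functions_def norm_mult powr_mult)

lemma Lp_functions_zero: "(\<lambda>x. 0) \<in> Lp_functions p M"
  by (auto simp: Lp_functions_def)

lemma add_Lp:
  fixes f g :: "'a \<Rightarrow> 'k::{real_normed_field, second_countable_topology}"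
  assumes "f \<in> Lp_functions p M" "g \<in> Lp_functions p M"
  shows "Lp_class p M f \<oplus>\<^bsub>Lp p M\<^esub> Lp_class p M g = Lp_class p M (\<lambda>x. f x + g x)"
proof -
  have "Lp_class p M (\<lambda>x. f' x + g' x) = Lp_class p M (\<lambda>x. f x + g x)"
    if "f' \<in> Lp_class p M f" "g' \<in> Lp_class p M g" for f' g'
  proof (intro Lp_class_cong Lp_functions_add)
    have "AE x in M. f x = f' x" "AE x in M. g x = g' x"
      using that by (auto simp: mem_Lp_class)
    then show "AE x in M. f' x + g' x = f x + g x" by eventually_elim simp
  qed (use that in \<open>auto simp: mem_Lp_class\<close>)
  then have "(\<Union>f'\<in>Lp_class p M f. \<Union>g'\<in>Lp_class p M g. Lp_class p M (\<lambda>x. f' x + g' x)) =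
      Lp_class p M (\<lambda>x. f x + g x)"
    by (intro UN_constant_eq[OF Lp_class_self[OF assms(1)]] UN_constant_eq[OF Lp_class_self[OF assms(2)]] ballI)
  then show ?thesis by (simp add: Lp_def Lp_class_def)
qed

lemma smult_Lp:
  fixes f :: "'a \<Rightarrow> 'k::{real_normed_field, second_countable_topology}"
  assumes "f \<in> Lp_functions p M"
  shows "c \<odot>\<^bsub>Lp p M\<^esub> Lp_class p M f = Lp_class p M (\<lambda>x. c * f x)"
proof -
  have "Lp_class p M (\<lambda>x. c * f' x) = Lp_class p M (\<lambda>x. c * f x)"
    if "f' \<in> Lp_class p M f" for f'
  proof (intro Lp_class_cong Lp_functions_smult)
    have "AE x in M. f x = f' x"
      using that by (auto simp: mem_Lp_class)
    then show "AE x in M. c * f' x = c * f x" by eventually_elim simp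
  qed (use that in \<open>auto simp: mem_Lp_class\<close>)
  then have "(\<Union>f'\<in>Lp_class p M f. Lp_class p M (\<lambda>x. c * f' x)) = Lp_class p M (\<lambda>x. c * f x)"
    using Lp_class_self assms by blast
  then show ?thesis by (simp add: Lp_def Lp_class_def)
qed

lemma Lp_norm_nonneg: "0 \<le> Lp_norm p M f"
  by (simp add: Lp_norm_def)

lemma Lp_norm_powr: "Lp_norm p M f powr p = (LINT x|M. norm (f x) powr p)"
  using p by (simp add: Lp_norm_def powr_powr)

lemma Lp_norm_le_iff: "0 \<le> c \<Longrightarrow> Lp_norm p M f \<le> c \<longleftrightarrow> (LINT x|M. norm (f x) powr p) \<le> c powr p"
  using p powr_mono2[of p "Lp_norm p M f" c] powr_less_mono2[of p c "Lp_norm p M f"] Lp_norm_nonneg[of f]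
  by (force simp: Lp_norm_powr[symmetric] not_le[symmetric])

text \<open>
  Minkowski's inequality: \<open>(f + g) / (a + b)\<close> is a convex combination of \<open>f / a\<close> and \<open>g / b\<close>, and the
  \<open>p\<close>-th power is convex. Taking \<open>a\<close> and \<open>b\<close> slightly larger than the norms of \<open>f\<close> and \<open>g\<close> keeps them
  positive.
\<close>

lemma Lp_norm_triangle:
  fixes f g :: "'a \<Rightarrow> 'k::{real_normed_field, second_countable_topology}"
  assumes fg: "f \<in> Lp_functions p M" "g \<in> Lp_functions p M"
  shows "Lp_norm p M (\<lambda>x. f x + g x) \<le> Lp_norm p M f + Lp_norm p M g"
proof (rule field_le_epsilon)
  fix e :: real assume e: "0 < e"
  define a where "a = Lp_norm p M f + e / 2"
  define b where "b = Lp_norm p M g + e / 2"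
  have ab: "0 < a" "0 < b" using e Lp_norm_nonneg[of f] Lp_norm_nonneg[of g] by (auto simp: a_def b_def)
  have int: "integrable M (\<lambda>x. norm (f x) powr p)" "integrable M (\<lambda>x. norm (g x) powr p)"
    "integrable M (\<lambda>x. norm (f x + g x) powr p)"
    using fg Lp_functions_add[OF fg] by (auto simp: Lp_functions_def)
  define s where "s = a / (a + b)"
  define t where "t = b / (a + b)"
  have st: "0 < s" "0 < t" "s + t = 1" using ab by (auto simp: s_def t_def add_divide_distrib[symmetric])
  have "(LINT x|M. norm (f x + g x) powr p) \<le>
      (LINT x|M. (a + b) powr p * (s * (norm (f x) powr p / a powr p) + t * (norm (g x) powr p / b powr p)))"
  proof (rule integral_mono)
    fix x
    have "norm (f x + g x) \<le> (a + b) * (s * (norm (f x) / a) + t * (norm (g x) / b))"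
      using norm_triangle_ineq[of "f x" "g x"] ab
      by (simp add: s_def t_def add_divide_distrib[symmetric])
    then have "norm (f x + g x) powr p \<le> ((a + b) * (s * (norm (f x) / a) + t * (norm (g x) / b))) powr p"
      using p by (intro powr_mono2) auto
    also have "\<dots> = (a + b) powr p * (s * (norm (f x) / a) + t * (norm (g x) / b)) powr p"
      using ab st by (simp add: powr_mult)
    also have "\<dots> \<le> (a + b) powr p * (s * (norm (f x) / a) powr p + t * (norm (g x) / b) powr p)"
      using ab st p by (intro mult_left_mono powr_convex_ineq) auto
    finally show "norm (f x + g x) powr p \<le>
        (a + b) powr p * (s * (norm (f x) powr p / a powr p) + t * (norm (g x) powr p / b powr p))"
      using ab by (simp add: powr_divide)
  qed (use int in auto)
  also have "\<dots> = (a + b) powr p * (s * (Lp_norm p M f powr p / a powr p) + t * (Lp_norm p M g powr p / b powr p))"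
    using int by (simp add: Lp_norm_powr)
  also have "\<dots> \<le> (a + b) powr p * (s * 1 + t * 1)"
  proof -
    have "Lp_norm p M f powr p \<le> a powr p" "Lp_norm p M g powr p \<le> b powr p"
      using p e Lp_norm_nonneg by (auto simp: a_def b_def intro!: powr_mono2)
    then show ?thesis using ab st by (intro mult_left_mono add_mono) (auto simp: divide_le_eq)
  qed
  finally have "Lp_norm p M (\<lambda>x. f x + g x) \<le> a + b"
    using ab st by (simp add: Lp_norm_le_iff)
  then show "Lp_norm p M (\<lambda>x. f x + g x) \<le> Lp_norm p M f + Lp_norm p M g + e"
    by (simp add: a_def b_def)
qed

lemma Lp_norm_smult:
  fixes f :: "'a \<Rightarrow> 'k::{real_normed_field, second_countable_topology}"
  shows "Lp_norm p M (\<lambda>x. c * f x) = norm c * Lp_norm p M f"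
  using p by (simp add: Lp_norm_def norm_mult powr_mult powr_powr)

lemma Lp_norm_eq_0_iff:
  assumes "f \<in> Lp_functions p M"
  shows "Lp_norm p M f = 0 \<longleftrightarrow> (AE x in M. f x = 0)"
  using assms by (simp add: Lp_norm_def Lp_functions_def integral_nonneg_eq_0_iff_AE)

lemma normed_space_Lp:
  "normed_space (Lp p M :: ('k::{real_normed_field, second_countable_topology}, ('a \<Rightarrow> 'k) set) nspace)"
proof (rule normed_spaceI)
  show "\<zero>\<^bsub>Lp p M\<^esub> \<in> carrier (Lp p M :: ('k, ('a \<Rightarrow> 'k) set) nspace)"
    by (auto simp: Lp_functions_zero zero_Lp carrier_Lp)
next
  fix F G H :: "('a \<Rightarrow> 'k) set" and a b :: 'k
  assume F: "F \<in> carrier (Lp p M)" and G: "G \<in> carrier (Lp p M)" and H: "H \<in> carrier (Lp p M)"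
  from F obtain f where f: "f \<in> Lp_functions p M" "F = Lp_class p M f" by (auto simp: carrier_Lp)
  from G obtain g where g: "g \<in> Lp_functions p M" "G = Lp_class p M g" by (auto simp: carrier_Lp)
  from H obtain h where h: "h \<in> Lp_functions p M" "H = Lp_class p M h" by (auto simp: carrier_Lp)
  note simps = f g h zero_Lp add_Lp smult_Lp vnorm_Lp Lp_functions_add Lp_functions_smult
    Lp_functions_zero Lp_norm_nonneg Lp_norm_smult Lp_norm_triangle
  show "F \<oplus>\<^bsub>Lp p M\<^esub> G \<in> carrier (Lp p M)" "a \<odot>\<^bsub>Lp p M\<^esub> F \<in> carrier (Lp p M)"
    by (auto simp: simps carrier_Lp)
  show "(F \<oplus>\<^bsub>Lp p M\<^esub> G) \<oplus>\<^bsub>Lp p M\<^esub> H = F \<oplus>\<^bsub>Lp p M\<^esub> (G \<oplus>\<^bsub>Lp p M\<^esub> H)"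
    by (simp add: simps add.assoc)
  show "F \<oplus>\<^bsub>Lp p M\<^esub> G = G \<oplus>\<^bsub>Lp p M\<^esub> F" by (simp add: simps add.commute)
  show "\<zero>\<^bsub>Lp p M\<^esub> \<oplus>\<^bsub>Lp p M\<^esub> F = F" by (simp add: simps)
  show "(- 1) \<odot>\<^bsub>Lp p M\<^esub> F \<oplus>\<^bsub>Lp p M\<^esub> F = \<zero>\<^bsub>Lp p M\<^esub>"
    using Lp_functions_smult[OF f(1), of "- 1"] by (simp add: simps)
  show "(a + b) \<odot>\<^bsub>Lp p M\<^esub> F = a \<odot>\<^bsub>Lp p M\<^esub> F \<oplus>\<^bsub>Lp p M\<^esub> b \<odot>\<^bsub>Lp p M\<^esub> F"
    by (simp add: simps distrib_right)
  show "a \<odot>\<^bsub>Lp p M\<^esub> (F \<oplus>\<^bsub>Lp p M\<^esub> G) = a \<odot>\<^bsub>Lp p M\<^esub> F \<oplus>\<^bsub>Lp p M\<^esub> a \<odot>\<^bsub>Lp p M\<^esub> G"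
    by (simp add: simps distrib_left)
  show "(a * b) \<odot>\<^bsub>Lp p M\<^esub> F = a \<odot>\<^bsub>Lp p M\<^esub> (b \<odot>\<^bsub>Lp p M\<^esub> F)"
    by (simp add: simps mult.assoc)
  show "1 \<odot>\<^bsub>Lp p M\<^esub> F = F" "0 \<le> vnorm (Lp p M) F"
    "vnorm (Lp p M) (a \<odot>\<^bsub>Lp p M\<^esub> F) = norm a * vnorm (Lp p M) F"
    "vnorm (Lp p M) (F \<oplus>\<^bsub>Lp p M\<^esub> G) \<le> vnorm (Lp p M) F + vnorm (Lp p M) G"
    by (simp_all add: simps)
  show "vnorm (Lp p M) F = 0 \<longleftrightarrow> F = \<zero>\<^bsub>Lp p M\<^esub>"
    using Lp_class_eq_iff[OF f(1) Lp_functions_zero] Lp_norm_eq_0_iff[OF f(1)] by (simp add: simps)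
qed

lemma diff_Lp:
  fixes f g :: "'a \<Rightarrow> 'k::{real_normed_field, second_countable_topology}"
  assumes "f \<in> Lp_functions p M" "g \<in> Lp_functions p M"
  shows "Lp_class p M f \<ominus>\<^bsub>Lp p M\<^esub> Lp_class p M g = Lp_class p M (\<lambda>x. f x - g x)"
proof -
  interpret normed_space "Lp p M :: ('k, ('a \<Rightarrow> 'k) set) nspace" by (rule normed_space_Lp)
  show ?thesis
    using assms Lp_functions_smult[OF assms(2), of "- 1"]
    by (simp add: diff_eq carrier_Lp smult_Lp add_Lp)
qed

end

section \<open>Bounded operators on integrable functions\<close>

text \<open>
  An operator on \<open>L\<^sub>1(M)\<close> is studied through the map that it induces on integrable functions. The
  bound already makes such a map blind to changes on null sets.
\<close>

locale L1_operator = normed_space Y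
  for Y :: "('k::{real_normed_field, euclidean_space}, 'y, 'n) nspace_scheme" (structure) +
  fixes M :: "'a measure" and K :: real and t :: "('a \<Rightarrow> 'k) \<Rightarrow> 'y"
  assumes K_nonneg: "0 \<le> K"
    and mem [simp]: "integrable M f \<Longrightarrow> t f \<in> carrier Y"
    and add: "integrable M f \<Longrightarrow> integrable M g \<Longrightarrow> t (\<lambda>x. f x + g x) = t f \<oplus> t g"
    and smult: "integrable M f \<Longrightarrow> t (\<lambda>x. c * f x) = c \<odot>\<^bsub>Y\<^esub> t f"
    and bound: "integrable M f \<Longrightarrow> vnorm Y (t f) \<le> K * (LINT x|M. norm (f x))"
begin

lemma diff:
  assumes "integrable M f" "integrable M g"
  shows "t (\<lambda>x. f x - g x) = t f \<ominus> t g"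
  using add[of f "\<lambda>x. - 1 * g x"] smult[of g "- 1"] assms by (simp add: diff_eq)

lemma diff_bound:
  assumes "integrable M f" "integrable M g"
  shows "vnorm Y (t f \<ominus> t g) \<le> K * (LINT x|M. norm (f x - g x))"
  using bound[of "\<lambda>x. f x - g x"] diff[of f g] assms by simp

lemma cong_AE:
  assumes fg: "integrable M f" "integrable M g" and "AE x in M. f x = g x"
  shows "t f = t g"
proof -
  have "(LINT x|M. norm (f x - g x)) = (LINT x|M. 0)"
    by (rule integral_cong_AE) (use assms in auto)
  then have "vnorm Y (t f \<ominus> t g) \<le> 0" using diff_bound[OF fg] by simp
  then have "vnorm Y (t f \<ominus> t g) = 0" using vnorm_nonneg[of "t f \<ominus> t g"] fg by simp
  then show ?thesis using fg by (simp add: vnorm_eq_0_iff diff_eq_zero_iff)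
qed

lemma cong:
  assumes "integrable M f" "integrable M g" and "\<And>x. x \<in> space M \<Longrightarrow> f x = g x"
  shows "t f = t g"
  using assms by (intro cong_AE) auto

lemma zero: "t (\<lambda>x. 0) = \<zero>"
  using smult[of "\<lambda>x. 0" 0] by simp

text \<open>
  The functions on which \<open>t\<close> obeys a norm bound \<open>\<kappa>\<close>, in general better than \<open>K\<close>. They are closed
  under sums with disjoint supports, where the \<open>L\<^sub>1\<close>-norm is additive, and under limits; this is how
  a bound on indicator functions spreads.
\<close>

definition dominated :: "real \<Rightarrow> ('a \<Rightarrow> 'k) \<Rightarrow> bool" where
  "dominated \<kappa> f \<longleftrightarrow> integrable M f \<and> vnorm Y (t f) \<le> \<kappa> * (LINT x|M. norm (f x))"

lemma dominated_zero: "dominated \<kappa> (\<lambda>x. 0)"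
  by (simp add: dominated_def zero)

lemma dominated_smult: "dominated \<kappa> f \<Longrightarrow> dominated \<kappa> (\<lambda>x. c * f x)"
  using mult_left_mono[of "vnorm Y (t f)" "\<kappa> * (LINT x|M. norm (f x))" "norm c"]
  by (auto simp: dominated_def smult vnorm_smult norm_mult mult.left_commute)

lemma dominated_cong:
  assumes "\<And>x. x \<in> space M \<Longrightarrow> f x = g x"
  shows "dominated \<kappa> f \<longleftrightarrow> dominated \<kappa> g"
proof -
  have "integrable M f \<longleftrightarrow> integrable M g"
    by (rule Bochner_Integration.integrable_cong) (use assms in auto)
  moreover have "(LINT x|M. norm (f x)) = (LINT x|M. norm (g x))"
    by (rule Bochner_Integration.integral_cong) (use assms in auto)
  ultimately show ?thesis
    using cong[of f g] assms by (auto simp: dominated_def)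
qed

lemma dominated_add:
  assumes f: "dominated \<kappa> f" and g: "dominated \<kappa> g"
    and disj: "\<And>x. x \<in> space M \<Longrightarrow> f x = 0 \<or> g x = 0"
  shows "dominated \<kappa> (\<lambda>x. f x + g x)"
proof -
  have int: "integrable M f" "integrable M g" using f g by (auto simp: dominated_def)
  have "vnorm Y (t (\<lambda>x. f x + g x)) \<le> vnorm Y (t f) + vnorm Y (t g)"
    using int by (simp add: add vnorm_triangle)
  also have "\<dots> \<le> \<kappa> * ((LINT x|M. norm (f x)) + (LINT x|M. norm (g x)))"
    using f g by (simp add: dominated_def distrib_left)
  also have "(LINT x|M. norm (f x)) + (LINT x|M. norm (g x)) = (LINT x|M. norm (f x) + norm (g x))"
    using int by simp
  also have "\<dots> = (LINT x|M. norm (f x + g x))"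
    by (rule Bochner_Integration.integral_cong) (use disj in force)+
  finally show ?thesis using int by (simp add: dominated_def)
qed

text \<open>
  The factor \<open>2\<close> makes dominated convergence applicable, and it is the one with which simple functions
  approximate a measurable function.
\<close>

lemma dominated_lim:
  assumes dom: "\<And>i. dominated \<kappa> (s i)" and f: "integrable M f"
    and lim: "\<And>x. x \<in> space M \<Longrightarrow> (\<lambda>i. s i x) \<longlonglongrightarrow> f x"
    and le: "\<And>i x. x \<in> space M \<Longrightarrow> norm (s i x) \<le> 2 * norm (f x)"
  shows "dominated \<kappa> f"
proof -
  have s: "integrable M (s i)" for i using dom by (auto simp: dominated_def)
  note [measurable] = borel_measurable_integrable[OF f] borel_measurable_integrable[OF s]
  have "(\<lambda>i. LINT x|M. norm (f x - s i x)) \<longlonglongrightarrow> (LINT x|M. 0)"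
  proof (rule integral_dominated_convergence[where w = "\<lambda>x. 3 * norm (f x)"])
    show "AE x in M. (\<lambda>i. norm (f x - s i x)) \<longlonglongrightarrow> 0"
    proof (rule AE_I2)
      fix x assume "x \<in> space M"
      from tendsto_norm[OF tendsto_diff[OF tendsto_const lim[OF this], of "f x"]]
      show "(\<lambda>i. norm (f x - s i x)) \<longlonglongrightarrow> 0" by simp
    qed
    show "AE x in M. norm (norm (f x - s i x)) \<le> 3 * norm (f x)" for i
    proof (rule AE_I2)
      fix x assume "x \<in> space M"
      then show "norm (norm (f x - s i x)) \<le> 3 * norm (f x)"
        using le[of x i] norm_triangle_ineq4[of "f x" "s i x"] by simp
    qed
  qed (use f in auto)
  then have 1: "(\<lambda>i. K * (LINT x|M. norm (f x - s i x))) \<longlonglongrightarrow> 0"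
    using tendsto_mult_right_zero by fastforce
  have 2: "(\<lambda>i. \<kappa> * (LINT x|M. norm (s i x))) \<longlonglongrightarrow> \<kappa> * (LINT x|M. norm (f x))"
  proof (intro tendsto_mult_left integral_dominated_convergence[where w = "\<lambda>x. 2 * norm (f x)"])
    show "AE x in M. (\<lambda>i. norm (s i x)) \<longlonglongrightarrow> norm (f x)"
      by (intro AE_I2 tendsto_norm lim)
  qed (use f le in auto)
  have "vnorm Y (t f) \<le> \<kappa> * (LINT x|M. norm (s i x)) + K * (LINT x|M. norm (f x - s i x))" for i
    using vnorm_triangle_sub[of "t f" "t (s i)"] diff_bound[OF f s[of i]] dom[of i] f s[of i]
    by (auto simp: dominated_def)
  then have "vnorm Y (t f) \<le> \<kappa> * (LINT x|M. norm (f x)) + 0"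
    by (intro LIMSEQ_le_const[OF tendsto_add[OF 2 1]]) auto
  then show ?thesis using f by (simp add: dominated_def)
qed

lemma dominated_countable_partition:
  fixes k :: "'a \<Rightarrow> nat"
  assumes k [measurable]: "k \<in> measurable M (count_space UNIV)" and f: "integrable M f"
    and dom: "\<And>n. dominated \<kappa> (\<lambda>x. indicator {x. k x = n} x * f x)"
  shows "dominated \<kappa> f"
proof (rule dominated_lim)
  show "dominated \<kappa> (\<lambda>x. indicator {x. k x < n} x * f x)" for n
  proof (induction n)
    case (Suc n)
    have "dominated \<kappa> (\<lambda>x. indicator {x. k x < n} x * f x + indicator {x. k x = n} x * f x)"
      by (rule dominated_add[OF Suc dom]) (auto split: split_indicator)
    also have "(\<lambda>x. indicator {x. k x < n} x * f x + indicator {x. k x = n} x * f x) =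
        (\<lambda>x. indicator {x. k x < Suc n} x * f x)"
      by (auto simp: fun_eq_iff split: split_indicator)
    finally show ?case .
  qed (simp add: dominated_zero)
  show "(\<lambda>n. indicator {x. k x < n} x * f x) \<longlonglongrightarrow> f x" for x
  proof (rule tendsto_eventually)
    show "\<forall>\<^sub>F n in sequentially. indicator {x. k x < n} x * f x = f x"
      using eventually_gt_at_top[of "k x"] by eventually_elim simp
  qed
qed (use f in \<open>auto split: split_indicator\<close>)

lemma dominated_simple_function:
  assumes h: "integrable M h"
    and B: "B \<in> sets M"
    and dom: "\<And>E. E \<in> sets M \<Longrightarrow> E \<subseteq> B \<Longrightarrow> dominated \<kappa> (\<lambda>x. indicator E x * of_real (h x))"
    and F: "simple_function M F"
  shows "dominated \<kappa> (\<lambda>x. indicator B x * F x * of_real (h x))"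
proof -
  have "dominated \<kappa> (\<lambda>x. indicator {x \<in> B. F x \<in> V} x * F x * of_real (h x))" if "finite V" for V
    using that
  proof (induction V rule: finite_induct)
    case empty
    show ?case by (simp add: dominated_zero)
  next
    case (insert v V)
    have sets: "{x \<in> B. F x = v} \<in> sets M"
    proof -
      have "{x \<in> B. F x = v} = B \<inter> (F -` {v} \<inter> space M)"
        using sets.sets_into_space[OF B] by auto
      then show ?thesis using B F by (auto intro: simple_functionD)
    qed
    have "dominated \<kappa> (\<lambda>x. v * (indicator {x \<in> B. F x = v} x * of_real (h x)))"
      by (rule dominated_smult[OF dom]) (use sets in auto)
    from dominated_add[OF insert.IH this]
    have "dominated \<kappa> (\<lambda>x. indicator {x \<in> B. F x \<in> V} x * F x * of_real (h x) +
        v * (indicator {x \<in> B. F x = v} x * of_real (h x)))"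
      using insert.hyps by (auto split: split_indicator)
    also have "(\<lambda>x. indicator {x \<in> B. F x \<in> V} x * F x * of_real (h x) +
        v * (indicator {x \<in> B. F x = v} x * of_real (h x))) =
        (\<lambda>x. indicator {x \<in> B. F x \<in> insert v V} x * F x * of_real (h x))"
      using insert.hyps by (auto simp: fun_eq_iff split: split_indicator)
    finally show ?case .
  qed
  from this[of "F ` space M"] have "dominated \<kappa> (\<lambda>x. indicator {x \<in> B. F x \<in> F ` space M} x * F x * of_real (h x))"
    using F by (simp add: simple_functionD)
  also have "{x \<in> B. F x \<in> F ` space M} = B"
    using sets.sets_into_space[OF B] by auto
  finally show ?thesis .
qed

text \<open>
  The functions \<open>h F\<close> with simple \<open>F\<close> approximate every function that vanishes off \<open>B\<close>,
  because \<open>h\<close> is positive on \<open>B\<close>.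
\<close>

lemma dominated_if_dominated_on_sets:
  assumes h: "integrable M h" and B: "B \<in> sets M" and pos: "\<And>x. x \<in> B \<Longrightarrow> h x > 0"
    and dom: "\<And>E. E \<in> sets M \<Longrightarrow> E \<subseteq> B \<Longrightarrow> dominated \<kappa> (\<lambda>x. indicator E x * of_real (h x))"
    and f: "integrable M f" and supp: "\<And>x. x \<in> space M \<Longrightarrow> x \<notin> B \<Longrightarrow> f x = 0"
  shows "dominated \<kappa> f"
proof -
  note [measurable] = borel_measurable_integrable[OF f] borel_measurable_integrable[OF h]
  define \<phi> where "\<phi> x = f x / of_real (h x)" for x
  have [measurable]: "\<phi> \<in> borel_measurable M" unfolding \<phi>_def by measurable
  obtain F where F: "\<And>i. simple_function M (F i)"
    and lim: "\<And>x. x \<in> space M \<Longrightarrow> (\<lambda>i. F i x) \<longlonglongrightarrow> \<phi> x"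
    and le: "\<And>i x. x \<in> space M \<Longrightarrow> dist (F i x) 0 \<le> 2 * dist (\<phi> x) 0"
    using borel_measurable_implies_sequence_metric[of \<phi> M 0] by (metis \<open>\<phi> \<in> borel_measurable M\<close>)
  have f_eq: "f x = indicator B x * \<phi> x * of_real (h x)" if "x \<in> space M" for x
    using supp[OF that] pos[of x] by (auto simp: \<phi>_def split: split_indicator)
  show ?thesis
  proof (rule dominated_lim[OF dominated_simple_function[OF h B dom F] f])
    fix x i assume x: "x \<in> space M"
    show "(\<lambda>i. indicator B x * F i x * of_real (h x)) \<longlonglongrightarrow> f x"
      unfolding f_eq[OF x] by (intro tendsto_intros lim x)
    show "norm (indicator B x * F i x * of_real (h x)) \<le> 2 * norm (f x)"
      unfolding f_eq[OF x] using le[OF x, of i]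
        mult_right_mono[of "norm (F i x)" "2 * norm (\<phi> x)" "\<bar>h x\<bar>"]
      by (auto simp: norm_mult split: split_indicator)
  qed
qed

lemma L1_operator_multiplier:
  assumes u [measurable]: "u \<in> borel_measurable M" and le: "\<And>x. x \<in> space M \<Longrightarrow> norm (u x) \<le> 1"
  shows "L1_operator Y M K (\<lambda>f. t (\<lambda>x. u x * f x))"
proof -
  have int: "integrable M (\<lambda>x. u x * f x)" if f: "integrable M f" for f :: "'a \<Rightarrow> 'k"
  proof (rule Bochner_Integration.integrable_bound[OF f])
    show "AE x in M. norm (u x * f x) \<le> norm (f x)"
      using le by (auto simp: norm_mult intro!: AE_I2 mult_left_le_one_le)
  qed (use f in measurable)
  show ?thesis
  proof
    fix f g :: "'a \<Rightarrow> 'k" and c :: 'k assume f: "integrable M f" and g: "integrable M g"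
    show "t (\<lambda>x. u x * (f x + g x)) = t (\<lambda>x. u x * f x) \<oplus> t (\<lambda>x. u x * g x)"
      using add[OF int[OF f] int[OF g]] by (simp add: distrib_left)
  next
    fix f :: "'a \<Rightarrow> 'k" and c :: 'k assume f: "integrable M f"
    show "t (\<lambda>x. u x * (c * f x)) = c \<odot>\<^bsub>Y\<^esub> t (\<lambda>x. u x * f x)"
      using smult[OF int[OF f], of c] by (simp add: mult.left_commute)
    have "(LINT x|M. norm (u x * f x)) \<le> (LINT x|M. norm (f x))"
      using int[OF f] f le
      by (intro integral_mono integrable_norm) (auto simp: norm_mult intro!: mult_left_le_one_le)
    then show "vnorm Y (t (\<lambda>x. u x * f x)) \<le> K * (LINT x|M. norm (f x))"
      using bound[OF int[OF f]] mult_left_mono[OF _ K_nonneg] order_trans by blast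
    show "t (\<lambda>x. u x * f x) \<in> carrier Y" using int[OF f] by simp
  qed (rule K_nonneg)
qed

end

lemma L1_operator_diff:
  fixes Y :: "('k::{real_normed_field, euclidean_space}, 'y, 'n) nspace_scheme" and M :: "'a measure"
  assumes "L1_operator Y M K t" "L1_operator Y M L s"
  shows "L1_operator Y M (K + L) (\<lambda>f. t f \<ominus>\<^bsub>Y\<^esub> s f)"
proof -
  interpret t: L1_operator Y M K t by fact
  interpret s: L1_operator Y M L s by fact
  show ?thesis
  proof
    fix f :: "'a \<Rightarrow> 'k" assume f: "integrable M f"
    show "vnorm Y (t f \<ominus>\<^bsub>Y\<^esub> s f) \<le> (K + L) * (LINT x|M. norm (f x))"
      using t.vnorm_diff_le[of "t f" "s f"] t.bound[OF f] s.bound[OF f] f by (simp add: distrib_right)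
  qed (use t.K_nonneg s.K_nonneg in \<open>auto simp: t.add s.add t.smult s.smult t.smult_diff t.add_diff_add\<close>)
qed

lemma Lp_functions_1: "f \<in> Lp_functions 1 M \<longleftrightarrow> integrable M f"
  for f :: "'a \<Rightarrow> 'k::{real_normed_field, euclidean_space}"
  using integrable_norm_iff[of f M] by (auto simp: Lp_functions_def)

lemma vnorm_L1: "integrable M f \<Longrightarrow> vnorm (Lp 1 M) (Lp_class 1 M f) = (LINT x|M. norm (f x))"
  for f :: "'a \<Rightarrow> 'k::{real_normed_field, euclidean_space}"
  by (simp add: vnorm_Lp Lp_functions_1 Lp_norm_def)

lemma L1_operator_of_contraction:
  fixes Y :: "('k::{real_normed_field, euclidean_space}, 'y, 'n) nspace_scheme"
  assumes Y: "normed_space Y" and T: "contraction (Lp 1 M) Y T"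
  shows "L1_operator Y M 1 (\<lambda>f. T (Lp_class 1 M f))"
proof -
  interpret normed_space Y by fact
  have mem: "Lp_class 1 M f \<in> carrier (Lp 1 M)" if "integrable M f" for f :: "'a \<Rightarrow> 'k"
    using that by (auto simp: carrier_Lp Lp_functions_1)
  show ?thesis
  proof
    fix f g :: "'a \<Rightarrow> 'k" assume fg: "integrable M f" "integrable M g"
    show "T (Lp_class 1 M (\<lambda>x. f x + g x)) = T (Lp_class 1 M f) \<oplus>\<^bsub>Y\<^esub> T (Lp_class 1 M g)"
      using T fg mem by (simp add: contraction_def add_Lp[symmetric] Lp_functions_1)
  next
    fix f :: "'a \<Rightarrow> 'k" and c assume f: "integrable M f"
    show "T (Lp_class 1 M (\<lambda>x. c * f x)) = c \<odot>\<^bsub>Y\<^esub> T (Lp_class 1 M f)"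
      using T f mem by (simp add: contraction_def smult_Lp[symmetric] Lp_functions_1)
    show "T (Lp_class 1 M f) \<in> carrier Y" using T mem[OF f] by (simp add: contraction_def)
    show "vnorm Y (T (Lp_class 1 M f)) \<le> 1 * (LINT x|M. norm (f x))"
      using T mem[OF f] vnorm_L1[OF f] by (force simp: contraction_def)
  qed simp
qed

lemma contraction_of_L1_operator:
  fixes Y :: "('k::{real_normed_field, euclidean_space}, 'y, 'n) nspace_scheme"
  assumes "L1_operator Y M 1 s"
  obtains S where "contraction (Lp 1 M) Y S" "\<And>f. integrable M f \<Longrightarrow> S (Lp_class 1 M f) = s f"
proof -
  interpret L1_operator Y M 1 s by fact
  define S where "S F = s (SOME f. f \<in> F)" for F
  have S: "S (Lp_class 1 M f) = s f" if f: "integrable M f" for f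
  proof -
    have "(SOME g. g \<in> Lp_class 1 M f) \<in> Lp_class 1 M f"
      using f Lp_class_self[of f 1 M] by (intro someI[of "\<lambda>g. g \<in> Lp_class 1 M f" f]) (simp add: Lp_functions_1)
    then show ?thesis
      unfolding S_def by (intro cong_AE[symmetric] f) (auto simp: mem_Lp_class Lp_functions_1)
  qed
  have "contraction (Lp 1 M) Y S"
    unfolding contraction_def
  proof (intro conjI ballI allI)
    fix F G :: "('a \<Rightarrow> 'k) set" and c assume "F \<in> carrier (Lp 1 M)"
    then obtain f where f: "integrable M f" "F = Lp_class 1 M f"
      by (auto simp: carrier_Lp Lp_functions_1)
    show "S F \<in> carrier Y" "S (c \<odot>\<^bsub>Lp 1 M\<^esub> F) = c \<odot>\<^bsub>Y\<^esub> S F" "vnorm Y (S F) \<le> vnorm (Lp 1 M) F"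
      using f bound[OF f(1)] by (simp_all add: S smult_Lp Lp_functions_1 vnorm_L1 smult)
    assume "G \<in> carrier (Lp 1 M)"
    then obtain g where g: "integrable M g" "G = Lp_class 1 M g"
      by (auto simp: carrier_Lp Lp_functions_1)
    show "S (F \<oplus>\<^bsub>Lp 1 M\<^esub> G) = S F \<oplus>\<^bsub>Y\<^esub> S G"
      using f g by (simp add: S add_Lp Lp_functions_1 add)
  qed
  then show thesis using that S by blast
qed

text \<open>
  Multiplication by a unimodular function is an isometry of \<open>L\<^sub>1(M)\<close>, so the norm-one function at
  which an operator almost attains its norm may be rotated to be nonnegative.
\<close>

lemma BPBp_L1I:
  fixes Y :: "('k::{real_normed_field, euclidean_space}, 'y, 'n) nspace_scheme" and M :: "'a measure"
  assumes Y: "normed_space Y"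
    and main: "\<And>\<epsilon>. 0 < \<epsilon> \<Longrightarrow> \<epsilon> < 1 \<Longrightarrow> \<exists>\<eta>>0. \<forall>t h.
      L1_operator Y M 1 t \<and> integrable M h \<and> (\<forall>x. 0 \<le> h x) \<and> (LINT x|M. h x) = 1 \<and>
      vnorm Y (t (\<lambda>x. of_real (h x))) > 1 - \<eta> \<longrightarrow>
      (\<exists>s f. L1_operator Y M 1 s \<and> integrable M f \<and> (LINT x|M. norm (f x)) = 1 \<and> vnorm Y (s f) = 1 \<and>
        (LINT x|M. norm (f x - of_real (h x))) < \<epsilon> \<and>
        (\<forall>\<phi>. integrable M \<phi> \<longrightarrow> vnorm Y (s \<phi> \<ominus>\<^bsub>Y\<^esub> t \<phi>) \<le> \<epsilon> * (LINT x|M. norm (\<phi> x))))"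
  shows "BPBp (Lp 1 M) Y"
proof (rule BPBpI[OF normed_space_Lp Y])
  fix \<epsilon> :: real assume \<epsilon>: "0 < \<epsilon>" "\<epsilon> < 1"
  from main[OF this] obtain \<eta> where \<eta>: "\<eta> > 0" and *: "\<forall>t h.
      L1_operator Y M 1 t \<and> integrable M h \<and> (\<forall>x. 0 \<le> h x) \<and> (LINT x|M. h x) = 1 \<and>
      vnorm Y (t (\<lambda>x. of_real (h x))) > 1 - \<eta> \<longrightarrow>
      (\<exists>s f. L1_operator Y M 1 s \<and> integrable M f \<and> (LINT x|M. norm (f x)) = 1 \<and> vnorm Y (s f) = 1 \<and>
        (LINT x|M. norm (f x - of_real (h x))) < \<epsilon> \<and>
        (\<forall>\<phi>. integrable M \<phi> \<longrightarrow> vnorm Y (s \<phi> \<ominus>\<^bsub>Y\<^esub> t \<phi>) \<le> \<epsilon> * (LINT x|M. norm (\<phi> x))))"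
    by (elim exE conjE)
  show "\<exists>\<eta>>0. \<forall>T x\<^sub>0. contraction (Lp 1 M) Y T \<and> x\<^sub>0 \<in> unit_sphere (Lp 1 M) \<and>
        vnorm Y (T x\<^sub>0) > 1 - \<eta> \<longrightarrow>
        (\<exists>y\<^sub>0 S. y\<^sub>0 \<in> unit_sphere (Lp 1 M) \<and> contraction (Lp 1 M) Y S \<and> vnorm Y (S y\<^sub>0) = 1 \<and>
           vnorm (Lp 1 M) (y\<^sub>0 \<ominus>\<^bsub>Lp 1 M\<^esub> x\<^sub>0) < \<epsilon> \<and>
           (\<forall>x\<in>carrier (Lp 1 M). vnorm Y (S x \<ominus>\<^bsub>Y\<^esub> T x) \<le> \<epsilon> * vnorm (Lp 1 M) x))"
  proof (intro exI[of _ \<eta>] conjI \<eta> allI impI; elim conjE)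
    fix T x\<^sub>0 assume T: "contraction (Lp 1 M) Y T" and x0: "x\<^sub>0 \<in> unit_sphere (Lp 1 M)"
      and big: "vnorm Y (T x\<^sub>0) > 1 - \<eta>"
    from x0 obtain f\<^sub>0 where f0: "integrable M f\<^sub>0" "x\<^sub>0 = Lp_class 1 M f\<^sub>0" "(LINT x|M. norm (f\<^sub>0 x)) = 1"
      by (auto simp: unit_sphere_def carrier_Lp Lp_functions_1 vnorm_L1)
    note [measurable] = borel_measurable_integrable[OF f0(1)]
    define u where "u x = (if f\<^sub>0 x = 0 then 1 else f\<^sub>0 x / of_real (norm (f\<^sub>0 x)))" for x
    define v where "v x = 1 / u x" for x
    have meas [measurable]: "u \<in> borel_measurable M" "v \<in> borel_measurable M"
      unfolding u_def v_def by measurable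
    have u: "norm (u x) = 1" "u x * of_real (norm (f\<^sub>0 x)) = f\<^sub>0 x" "u x \<noteq> 0" for x
      by (auto simp: u_def norm_divide)
    have v: "norm (v x) = 1" "u x * (v x * c) = c" "v x * (u x * c) = c" for x c
      using u by (auto simp: v_def norm_divide)
    interpret T: L1_operator Y M 1 "\<lambda>f. T (Lp_class 1 M f)"
      by (rule L1_operator_of_contraction[OF Y T])
    interpret t: L1_operator Y M 1 "\<lambda>f. T (Lp_class 1 M (\<lambda>x. u x * f x))"
      by (rule T.L1_operator_multiplier) (auto simp: u)
    have "\<exists>s f. L1_operator Y M 1 s \<and> integrable M f \<and> (LINT x|M. norm (f x)) = 1 \<and> vnorm Y (s f) = 1 \<and>
        (LINT x|M. norm (f x - of_real (norm (f\<^sub>0 x)))) < \<epsilon> \<and>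
        (\<forall>\<phi>. integrable M \<phi> \<longrightarrow> vnorm Y (s \<phi> \<ominus>\<^bsub>Y\<^esub> T (Lp_class 1 M (\<lambda>x. u x * \<phi> x))) \<le> \<epsilon> * (LINT x|M. norm (\<phi> x)))"
      by (rule *[rule_format]) (use t.L1_operator_axioms f0 big u in auto)
    then obtain s f where s: "L1_operator Y M 1 s" and f: "integrable M f" "(LINT x|M. norm (f x)) = 1"
      "vnorm Y (s f) = 1" "(LINT x|M. norm (f x - of_real (norm (f\<^sub>0 x)))) < \<epsilon>"
      and close: "\<And>\<phi>. integrable M \<phi> \<Longrightarrow>
        vnorm Y (s \<phi> \<ominus>\<^bsub>Y\<^esub> T (Lp_class 1 M (\<lambda>x. u x * \<phi> x))) \<le> \<epsilon> * (LINT x|M. norm (\<phi> x))"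
      by blast
    interpret s: L1_operator Y M 1 s by fact
    have int: "integrable M (\<lambda>x. w x * \<phi> x)"
      if "integrable M \<phi>" "w \<in> borel_measurable M" "\<And>x. norm (w x) = 1" for \<phi> w :: "'a \<Rightarrow> 'k"
      by (rule Bochner_Integration.integrable_bound[OF that(1)])
        (use that in \<open>auto simp: norm_mult borel_measurable_integrable\<close>)
    obtain S where S: "contraction (Lp 1 M) Y S"
      "\<And>\<phi>. integrable M \<phi> \<Longrightarrow> S (Lp_class 1 M \<phi>) = s (\<lambda>x. v x * \<phi> x)"
      using contraction_of_L1_operator[OF s.L1_operator_multiplier[of v]] v by auto
    define y\<^sub>0 where "y\<^sub>0 = Lp_class 1 M (\<lambda>x. u x * f x)"
    have uf: "integrable M (\<lambda>x. u x * f x)" using int[OF f(1)] u by simp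
    have "y\<^sub>0 \<in> unit_sphere (Lp 1 M)"
      using uf f u by (auto simp: unit_sphere_def y\<^sub>0_def carrier_Lp Lp_functions_1 vnorm_L1 norm_mult)
    moreover have "vnorm Y (S y\<^sub>0) = 1"
      using f uf by (simp add: y\<^sub>0_def S v)
    moreover have "vnorm (Lp 1 M) (y\<^sub>0 \<ominus>\<^bsub>Lp 1 M\<^esub> x\<^sub>0) < \<epsilon>"
    proof -
      have "vnorm (Lp 1 M) (y\<^sub>0 \<ominus>\<^bsub>Lp 1 M\<^esub> x\<^sub>0) = (LINT x|M. norm (u x * f x - f\<^sub>0 x))"
        using f0 uf by (simp add: y\<^sub>0_def diff_Lp Lp_functions_1 vnorm_L1)
      also have "\<dots> = (LINT x|M. norm (f x - of_real (norm (f\<^sub>0 x))))"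
      proof -
        have "u x * f x - f\<^sub>0 x = u x * (f x - of_real (norm (f\<^sub>0 x)))" for x
          using u(2)[of x] by (simp add: right_diff_distrib)
        then show ?thesis by (simp add: norm_mult u)
      qed
      finally show ?thesis using f by simp
    qed
    moreover have "vnorm Y (S x \<ominus>\<^bsub>Y\<^esub> T x) \<le> \<epsilon> * vnorm (Lp 1 M) x" if "x \<in> carrier (Lp 1 M)" for x
    proof -
      from that obtain \<phi> where \<phi>: "integrable M \<phi>" "x = Lp_class 1 M \<phi>"
        by (auto simp: carrier_Lp Lp_functions_1)
      show ?thesis
        using close[OF int[OF \<phi>(1), of v]] \<phi> by (simp add: S v vnorm_L1 norm_mult)
    qed
    ultimately show "\<exists>y\<^sub>0 S. y\<^sub>0 \<in> unit_sphere (Lp 1 M) \<and> contraction (Lp 1 M) Y S \<and> vnorm Y (S y\<^sub>0) = 1 \<and>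
           vnorm (Lp 1 M) (y\<^sub>0 \<ominus>\<^bsub>Lp 1 M\<^esub> x\<^sub>0) < \<epsilon> \<and>
           (\<forall>x\<in>carrier (Lp 1 M). vnorm Y (S x \<ominus>\<^bsub>Y\<^esub> T x) \<le> \<epsilon> * vnorm (Lp 1 M) x)"
      using S(1) by blast
  qed
qed simp

lemma integral_indicator_split:
  fixes f :: "'a \<Rightarrow> 'b::{banach, second_countable_topology, real_normed_field}"
  assumes [measurable]: "D \<in> sets M" and f: "integrable M f"
  shows "integrable M (\<lambda>x. indicator D x * f x)" "integrable M (\<lambda>x. indicator (- D) x * f x)"
    "(LINT x|M. f x) = (LINT x|M. indicator D x * f x) + (LINT x|M. indicator (- D) x * f x)"
    "(LINT x|M. norm (f x)) =
      (LINT x|M. norm (indicator D x * f x)) + (LINT x|M. norm (indicator (- D) x * f x))"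
proof -
  have [measurable]: "f \<in> borel_measurable M" using f by (rule borel_measurable_integrable)
  have ind [measurable]: "(indicator (- D) :: 'a \<Rightarrow> 'b) \<in> borel_measurable M"
  proof -
    have "(\<lambda>x. 1 - indicator D x :: 'b) \<in> borel_measurable M" by measurable
    also have "(\<lambda>x. 1 - indicator D x :: 'b) = indicator (- D)"
      by (auto simp: fun_eq_iff split: split_indicator)
    finally show ?thesis .
  qed
  show int: "integrable M (\<lambda>x. indicator D x * f x)" "integrable M (\<lambda>x. indicator (- D) x * f x)"
    by (rule Bochner_Integration.integrable_bound[OF f]; auto split: split_indicator)+
  have "(LINT x|M. f x) = (LINT x|M. indicator D x * f x + indicator (- D) x * f x)"
    by (rule Bochner_Integration.integral_cong) (auto split: split_indicator)
  then show "(LINT x|M. f x) = (LINT x|M. indicator D x * f x) + (LINT x|M. indicator (- D) x * f x)"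
    using int by simp
  have "(LINT x|M. norm (f x)) =
      (LINT x|M. norm (indicator D x * f x) + norm (indicator (- D) x * f x))"
    by (rule Bochner_Integration.integral_cong) (auto split: split_indicator)
  then show "(LINT x|M. norm (f x)) =
      (LINT x|M. norm (indicator D x * f x)) + (LINT x|M. norm (indicator (- D) x * f x))"
    using int by (simp add: Bochner_Integration.integral_add[OF integrable_norm integrable_norm])
qed

lemma L1_operator_integral:
  fixes Y :: "('k::{real_normed_field, euclidean_space}, 'y, 'n) nspace_scheme" and M :: "'a measure"
  assumes "normed_space Y" and w: "w \<in> carrier Y"
  shows "L1_operator Y M (vnorm Y w) (\<lambda>f. (LINT x|M. f x) \<odot>\<^bsub>Y\<^esub> w)"
proof -
  interpret normed_space Y by fact
  show ?thesis
  proof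
    fix f :: "'a \<Rightarrow> 'k" assume "integrable M f"
    show "vnorm Y ((LINT x|M. f x) \<odot>\<^bsub>Y\<^esub> w) \<le> vnorm Y w * (LINT x|M. norm (f x))"
      using integral_norm_bound[of M f] vnorm_nonneg[OF w]
      by (simp add: vnorm_smult[OF w] mult.commute mult_left_mono)
  qed (use w in \<open>auto simp: smult_add_left smult_smult vnorm_nonneg\<close>)
qed

text \<open>
  Since \<open>L\<^sub>1(M)\<close> is the \<open>\<ell>\<^sub>1\<close>-sum of the functions on \<open>D\<close> and those off \<open>D\<close>, contractions may be
  prescribed separately on the two summands.
\<close>

lemma L1_operator_glue:
  fixes Y :: "('k::{real_normed_field, euclidean_space}, 'y, 'n) nspace_scheme" and M :: "'a measure"
  assumes t: "L1_operator Y M 1 t" and p: "L1_operator Y M 1 p" and D: "D \<in> sets M"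
    and s_def: "s = (\<lambda>f. t (\<lambda>x. indicator (- D) x * f x) \<oplus>\<^bsub>Y\<^esub> p (\<lambda>x. indicator D x * f x))"
  shows "L1_operator Y M 1 s"
    and "\<And>f. integrable M f \<Longrightarrow>
      s f \<ominus>\<^bsub>Y\<^esub> t f = p (\<lambda>x. indicator D x * f x) \<ominus>\<^bsub>Y\<^esub> t (\<lambda>x. indicator D x * f x)"
    and "\<And>f. integrable M f \<Longrightarrow> (\<And>x. x \<notin> D \<Longrightarrow> f x = 0) \<Longrightarrow> s f = p f"
proof -
  interpret t: L1_operator Y M 1 t by fact
  interpret p: L1_operator Y M 1 p by fact
  note split = integral_indicator_split[OF D]
  show "L1_operator Y M 1 s"
  proof
    fix f g :: "'a \<Rightarrow> 'k" assume f: "integrable M f" and g: "integrable M g"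
    show "s (\<lambda>x. f x + g x) = s f \<oplus>\<^bsub>Y\<^esub> s g"
      unfolding s_def using t.add[OF split(2)[OF f] split(2)[OF g]] p.add[OF split(1)[OF f] split(1)[OF g]] split[OF f] split[OF g]
      by (simp add: distrib_left t.a_ac)
  next
    fix f :: "'a \<Rightarrow> 'k" and c assume f: "integrable M f"
    show "s (\<lambda>x. c * f x) = c \<odot>\<^bsub>Y\<^esub> s f"
      unfolding s_def using t.smult[OF split(2)[OF f], of c] p.smult[OF split(1)[OF f], of c] split[OF f]
      by (simp add: mult.left_commute t.smult_add_right)
    show "s f \<in> carrier Y" using split[OF f] by (simp add: s_def)
    have "vnorm Y (s f) \<le> vnorm Y (t (\<lambda>x. indicator (- D) x * f x)) + vnorm Y (p (\<lambda>x. indicator D x * f x))"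
      unfolding s_def using split[OF f] by (intro t.vnorm_triangle) auto
    then show "vnorm Y (s f) \<le> 1 * (LINT x|M. norm (f x))"
      using t.bound[OF split(2)[OF f]] p.bound[OF split(1)[OF f]] split(4)[OF f] by linarith
  qed simp
  show "s f \<ominus>\<^bsub>Y\<^esub> t f = p (\<lambda>x. indicator D x * f x) \<ominus>\<^bsub>Y\<^esub> t (\<lambda>x. indicator D x * f x)"
    if f: "integrable M f" for f
  proof -
    have "t f = t (\<lambda>x. indicator (- D) x * f x + indicator D x * f x)"
      by (rule arg_cong[of _ _ t]) (auto simp: fun_eq_iff split: split_indicator)
    also have "\<dots> = t (\<lambda>x. indicator (- D) x * f x) \<oplus>\<^bsub>Y\<^esub> t (\<lambda>x. indicator D x * f x)"
      using split[OF f] by (intro t.add)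
    finally show ?thesis
      using split[OF f] by (simp add: s_def t.add_diff_add)
  qed
  show "s f = p f" if f: "integrable M f" and supp: "\<And>x. x \<notin> D \<Longrightarrow> f x = 0" for f
  proof -
    have "(\<lambda>x. indicator D x * f x) = f" "(\<lambda>x. indicator (- D) x * f x) = (\<lambda>x. 0)"
      using supp by (auto simp: fun_eq_iff split: split_indicator)
    then show ?thesis using f by (simp add: s_def t.zero)
  qed
qed

lemma density_finite_measure:
  fixes h :: "'a \<Rightarrow> real"
  assumes h: "integrable M h" and nn: "\<And>x. 0 \<le> h x"
  shows "finite_measure (density M h)"
    and "E \<in> sets M \<Longrightarrow> measure (density M h) E = (LINT x|M. indicator E x * h x)"
proof -
  have em: "emeasure (density M h) E = ennreal (LINT x|M. indicator E x * h x)" if [measurable]: "E \<in> sets M" for E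
  proof -
    have "emeasure (density M h) E = (\<integral>\<^sup>+x. ennreal (indicator E x * h x) \<partial>M)"
      using h by (subst emeasure_density) (auto intro!: nn_integral_cong split: split_indicator)
    also have "\<dots> = ennreal (LINT x|M. indicator E x * h x)"
      using nn integral_indicator_split(1)[OF that h] by (intro nn_integral_eq_integral) auto
    finally show ?thesis .
  qed
  show "finite_measure (density M h)"
    using em[of "space M"] by (intro finite_measureI) simp
  show "measure (density M h) E = (LINT x|M. indicator E x * h x)" if "E \<in> sets M"
    unfolding measure_def em[OF that] using nn by (intro enn2real_ennreal integral_nonneg) simp
qed

text \<open>
  With a probability density \<open>h\<close>, an operator of norm at most one gives rise to the vector measure
  \<open>E \<mapsto> t(h 1\<^sub>E)\<close>, which is dominated by the scalar measure \<open>E \<mapsto> \<integral>\<^sub>E h\<close>.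
\<close>

locale density_operator = L1_operator Y M 1 t
  for Y :: "('k::{real_normed_field, euclidean_space}, 'y, 'n) nspace_scheme" (structure)
    and M :: "'a measure" and t :: "('a \<Rightarrow> 'k) \<Rightarrow> 'y" +
  fixes h :: "'a \<Rightarrow> real"
  assumes h_integrable: "integrable M h"
    and h_nonneg: "0 \<le> h x"
    and h_mass: "(LINT x|M. h x) = 1"
begin

definition mass :: "'a set \<Rightarrow> real" where
  "mass = measure (density M h)"

definition vmeas :: "'a set \<Rightarrow> 'y" where
  "vmeas E = t (\<lambda>x. indicator E x * of_real (h x))"

sublocale N: finite_measure "density M h"
  using density_finite_measure(1) h_integrable h_nonneg by blast

lemmas mass_eq = density_finite_measure(2)[OF h_integrable h_nonneg, folded mass_def]

lemma mass_nonneg: "0 \<le> mass E"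
  by (simp add: mass_def)

lemma h_indicator:
  assumes E: "E \<in> sets M"
  shows "integrable M (\<lambda>x. indicator E x * of_real (h x) :: 'k)"
    and "(LINT x|M. norm (indicator E x * of_real (h x) :: 'k)) = mass E"
    and "(LINT x|M. indicator E x * of_real (h x) :: 'k) = of_real (mass E)"
proof -
  have *: "indicator E x * of_real (h x) = (of_real (indicator E x * h x) :: 'k)" for x
    by (auto split: split_indicator)
  show "integrable M (\<lambda>x. indicator E x * of_real (h x) :: 'k)"
    "(LINT x|M. norm (indicator E x * of_real (h x) :: 'k)) = mass E"
    "(LINT x|M. indicator E x * of_real (h x) :: 'k) = of_real (mass E)"
    unfolding * using integral_indicator_split(1)[OF E h_integrable] h_nonneg
    by (simp_all add: mass_eq[OF E] norm_of_real integrable_of_real del: of_real_mult)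
qed

lemma mass_space: "mass (space M) = 1"
  using h_mass Bochner_Integration.integral_cong[OF refl, of M "\<lambda>x. indicator (space M) x * h x" h]
  by (simp add: mass_eq)

lemma vmeas:
  assumes "E \<in> sets M"
  shows "vmeas E \<in> carrier Y" "vnorm Y (vmeas E) \<le> mass E"
  using h_indicator[OF assms] bound[OF h_indicator(1)[OF assms]] by (simp_all add: vmeas_def)

lemma vmeas_space: "vmeas (space M) = t (\<lambda>x. of_real (h x))"
  unfolding vmeas_def by (rule cong) (use h_integrable h_indicator[of "space M"] in auto)

lemma vmeas_Un:
  assumes "A \<in> sets M" "B \<in> sets M" "A \<inter> B = {}"
  shows "vmeas (A \<union> B) = vmeas A \<oplus> vmeas B" "mass (A \<union> B) = mass A + mass B"
proof -
  have "indicator (A \<union> B) x * of_real (h x) =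
      (indicator A x * of_real (h x) + indicator B x * of_real (h x) :: 'k)" for x
    using assms by (auto split: split_indicator)
  then show "vmeas (A \<union> B) = vmeas A \<oplus> vmeas B"
    unfolding vmeas_def using h_indicator assms by (simp add: add[symmetric])
  show "mass (A \<union> B) = mass A + mass B"
    unfolding mass_def using assms by (intro N.finite_measure_Union) auto
qed

end

section \<open>Uniformly convex range spaces\<close>

definition uniformly_convex :: "('k::real_normed_field, 'v, 'm) nspace_scheme \<Rightarrow> bool" where
  "uniformly_convex Y \<longleftrightarrow>
     (\<forall>\<epsilon>>0. \<exists>\<delta>>0. \<forall>x\<in>carrier Y. \<forall>y\<in>carrier Y.
        vnorm Y x \<le> 1 \<and> vnorm Y y \<le> 1 \<and> \<epsilon> \<le> vnorm Y (x \<ominus>\<^bsub>Y\<^esub> y) \<longrightarrow> vnorm Y (x \<oplus>\<^bsub>Y\<^esub> y) \<le> 2 * (1 - \<delta>))"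

text \<open>
  The complement of a maximal disjoint family of bad sets contains no bad set. Such a family is
  countable, as its members have positive measure.
\<close>

lemma (in finite_measure) exhaustion:
  assumes bad: "\<And>E. bad E \<Longrightarrow> E \<in> sets M \<and> 0 < measure M E"
    and bound: "\<And>F. finite F \<Longrightarrow> disjoint F \<Longrightarrow> (\<forall>E\<in>F. bad E) \<Longrightarrow> measure M (\<Union>F) \<le> c"
  obtains C where "C \<in> sets M" "measure M (space M - C) \<le> c" "\<And>E. E \<subseteq> C \<Longrightarrow> \<not> bad E"
proof -
  let ?A = "{F. disjoint F \<and> (\<forall>E\<in>F. bad E)}"
  have "\<forall>C\<in>chains ?A. \<Union>C \<in> ?A"
  proof
    fix C assume C: "C \<in> chains ?A"
    then have chain: "\<And>F G. F \<in> C \<Longrightarrow> G \<in> C \<Longrightarrow> F \<subseteq> G \<or> G \<subseteq> F" and sub: "C \<subseteq> ?A"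
      by (auto simp: chains_def chain_subset_def)
    have "disjoint (\<Union>C)"
    proof (rule disjointI)
      fix a b assume "a \<in> \<Union>C" "b \<in> \<Union>C" "a \<noteq> b"
      then obtain F G where "F \<in> C" "a \<in> F" "G \<in> C" "b \<in> G" by blast
      then show "a \<inter> b = {}"
        using chain[of F G] sub \<open>a \<noteq> b\<close> by (auto dest: disjointD)
    qed
    then show "\<Union>C \<in> ?A" using sub by auto
  qed
  from Zorn_Lemma[OF this] obtain F where F: "disjoint F" "\<And>E. E \<in> F \<Longrightarrow> bad E"
    and max: "\<And>G. disjoint G \<Longrightarrow> (\<forall>E\<in>G. bad E) \<Longrightarrow> F \<subseteq> G \<Longrightarrow> G = F"
    by auto
  have sets: "E \<in> sets M" "0 < measure M E" if "E \<in> F" for E using bad F that by auto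
  have fin_le: "measure M (\<Union>G) \<le> c" if "finite G" "G \<subseteq> F" for G
    using that F by (intro bound) (auto simp: disjoint_def)
  have "countable {E \<in> F. measure M E \<noteq> 0}"
  proof (rule abs_summable_countable)
    show "(\<lambda>E. norm (measure M E)) summable_on F"
    proof (rule nonneg_bdd_above_summable_on)
      show "bdd_above (sum (\<lambda>x. norm (measure M x)) ` {G. G \<subseteq> F \<and> finite G})"
      proof (rule bdd_aboveI2)
        fix G assume G: "G \<in> {G. G \<subseteq> F \<and> finite G}"
        have "disjoint_family_on (\<lambda>E. E) G"
          unfolding disjoint_family_on_def using G disjointD[OF F(1)] by blast
        then have "measure M (\<Union>E\<in>G. E) = (\<Sum>E\<in>G. measure M E)"
          using G sets by (intro finite_measure_finite_Union) auto
        then show "(\<Sum>x\<in>G. norm (measure M x)) \<le> c"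
          using fin_le[of G] G by simp
      qed
    qed simp
  qed
  also have "{E \<in> F. measure M E \<noteq> 0} = F" using sets by fastforce
  finally have cF: "countable F" .
  have U: "\<Union>F \<in> sets M" using cF sets by blast
  have "measure M (\<Union>F) \<le> c"
  proof (cases "F = {}")
    case True
    then show ?thesis using fin_le[of "{}"] by simp
  next
    case False
    define A where "A n = \<Union>(from_nat_into F ` {..n})" for n
    have enum: "range (from_nat_into F) = F" using False cF by (rule range_from_nat_into)
    then have inF: "from_nat_into F n \<in> F" for n by auto
    have "(\<lambda>n. measure M (A n)) \<longlonglongrightarrow> measure M (\<Union>n. A n)"
    proof (rule finite_Lim_measure_incseq)
      show "range A \<subseteq> sets M" using sets inF by (auto simp: A_def)
      show "incseq A" unfolding A_def incseq_def by (auto intro: order_trans)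
    qed
    moreover have "(\<Union>n. A n) = \<Union>F"
    proof -
      have "(\<Union>n. A n) = \<Union>(range (from_nat_into F))" by (auto simp: A_def)
      then show ?thesis by (simp only: enum)
    qed
    moreover have "measure M (A n) \<le> c" for n
      unfolding A_def using inF by (intro fin_le) auto
    ultimately show ?thesis by (intro LIMSEQ_le_const2[of "\<lambda>n. measure M (A n)"]) auto
  qed
  moreover have "\<not> bad E" if E: "E \<subseteq> space M - \<Union>F" for E
  proof
    assume b: "bad E"
    have "E \<inter> G = {}" if "G \<in> F" for G using E that by auto
    then have "disjoint (insert E F)"
      using F(1) by (auto simp: disjoint_def)
    then have "insert E F = F" using F b by (intro max) auto
    then have "E \<subseteq> \<Union>F" by auto
    then have "E = {}" using E by auto
    then show False using bad[OF b] by simp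
  qed
  ultimately show thesis
    using U sets.sets_into_space[OF U] by (intro that[of "space M - \<Union>F"]) (auto simp: double_diff)
qed

text \<open>
  Let \<open>h\<close> be a density of mass one and \<open>y = T h\<close> have norm close to one. The averages
  \<open>T(h 1\<^sub>E) / \<mu>(E)\<close>, where \<open>\<mu> = h M\<close>, lie in the unit ball, and \<open>y\<close> is their mean over any
  partition. By uniform convexity, sets whose average is far from \<open>y\<close> cannot carry much mass: each of
  them costs a fixed proportion of its mass in the norm of \<open>2 y\<close>.
  Off an exhausting family of them, \<open>T\<close> is nearly \<open>f \<mapsto> (\<integral>f) y\<close>, and there it is replaced by
  \<open>f \<mapsto> (\<integral>f) y / \<parallel>y\<parallel>\<close>, which attains its norm at every nonnegative function.
\<close>

theorem BPBp_L1_uniformly_convex: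
  fixes Y :: "('k::{real_normed_field, euclidean_space}, 'y, 'n) nspace_scheme" and M :: "'a measure"
  assumes Y: "normed_space Y" and uc: "uniformly_convex Y"
  shows "BPBp (Lp 1 M) Y"
proof (rule BPBp_L1I[OF Y])
  interpret Y: normed_space Y by fact
  fix \<epsilon> :: real assume \<epsilon>: "0 < \<epsilon>" "\<epsilon> < 1"
  \<comment> \<open>The modified operator and its norming function will be within \<open>2 * \<gamma>\<close> of the given ones.\<close>
  define \<gamma> where "\<gamma> = \<epsilon> / 4"
  have \<gamma>: "0 < \<gamma>" "\<gamma> < 1" using \<epsilon> by (auto simp: \<gamma>_def)
  obtain \<delta> where \<delta>: "0 < \<delta>" and convex: "\<And>x y. x \<in> carrier Y \<Longrightarrow> y \<in> carrier Y \<Longrightarrow>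
      vnorm Y x \<le> 1 \<Longrightarrow> vnorm Y y \<le> 1 \<Longrightarrow> \<gamma> \<le> vnorm Y (x \<ominus>\<^bsub>Y\<^esub> y) \<Longrightarrow> vnorm Y (x \<oplus>\<^bsub>Y\<^esub> y) \<le> 2 * (1 - \<delta>)"
    using uc \<gamma> unfolding uniformly_convex_def by metis
  \<comment> \<open>\<open>\<gamma>\<close> keeps the norm of \<open>y\<close> close to one, and \<open>\<delta> * \<gamma>\<close> limits the mass of the bad sets to \<open>\<gamma>\<close>.\<close>
  define \<eta> where "\<eta> = min \<gamma> (\<delta> * \<gamma>)"
  have \<eta>: "0 < \<eta>" "\<eta> \<le> \<gamma>" "\<eta> \<le> \<delta> * \<gamma>" using \<gamma> \<delta> by (auto simp: \<eta>_def)
  have "\<exists>s f. L1_operator Y M 1 s \<and> integrable M f \<and> (LINT x|M. norm (f x)) = 1 \<and> vnorm Y (s f) = 1 \<and>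
        (LINT x|M. norm (f x - of_real (h x))) < \<epsilon> \<and>
        (\<forall>\<phi>. integrable M \<phi> \<longrightarrow> vnorm Y (s \<phi> \<ominus>\<^bsub>Y\<^esub> t \<phi>) \<le> \<epsilon> * (LINT x|M. norm (\<phi> x)))"
    if t: "L1_operator Y M 1 t" and h: "integrable M h" "\<And>x. 0 \<le> h x" "(LINT x|M. h x) = 1"
      and big: "1 - \<eta> < vnorm Y (t (\<lambda>x. of_real (h x)))" for t and h :: "'a \<Rightarrow> real"
  proof -
    interpret t: density_operator Y M t h
      using t h by (simp add: density_operator_def density_operator_axioms_def)
    note [measurable] = borel_measurable_integrable[OF h(1)]
    define y where "y = t.vmeas (space M)"
    have y: "y \<in> carrier Y" "vnorm Y y \<le> 1" "1 - \<eta> < vnorm Y y"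
      using t.vmeas[of "space M"] t.mass_space big by (auto simp: y_def t.vmeas_space)

    define bad where "bad E \<longleftrightarrow> E \<in> sets M \<and> \<gamma> * t.mass E < vnorm Y (t.vmeas E \<ominus>\<^bsub>Y\<^esub> of_real (t.mass E) \<odot>\<^bsub>Y\<^esub> y)" for E
    have bad_pos: "0 < t.mass E" if "bad E" for E
    proof (rule ccontr)
      assume "\<not> 0 < t.mass E"
      then have "t.mass E = 0" using t.mass_nonneg[of E] by simp
      then show False
        using that t.vmeas[of E] Y.vnorm_diff_le[of "t.vmeas E" "\<zero>\<^bsub>Y\<^esub>"] y unfolding bad_def by auto
    qed
    have bad_single: "vnorm Y (t.vmeas E \<oplus>\<^bsub>Y\<^esub> of_real (t.mass E) \<odot>\<^bsub>Y\<^esub> y) \<le> 2 * (1 - \<delta>) * t.mass E" if b: "bad E" for E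
    proof -
      have E: "E \<in> sets M" using b by (simp add: bad_def)
      let ?a = "of_real (1 / t.mass E) \<odot>\<^bsub>Y\<^esub> t.vmeas E" and ?m = "of_real (t.mass E) :: 'k"
      have pos: "0 < t.mass E" using bad_pos[OF b] .
      have Ga: "t.vmeas E = ?m \<odot>\<^bsub>Y\<^esub> ?a" using pos t.vmeas[OF E] by (simp add: Y.smult_smult)
      have a: "?a \<in> carrier Y" using t.vmeas[OF E] by simp
      have "vnorm Y ?a \<le> 1" using t.vmeas[OF E] pos by (simp add: Y.vnorm_smult norm_divide)
      moreover have "t.vmeas E \<ominus>\<^bsub>Y\<^esub> ?m \<odot>\<^bsub>Y\<^esub> y = ?m \<odot>\<^bsub>Y\<^esub> (?a \<ominus>\<^bsub>Y\<^esub> y)"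
        using a y Ga by (simp add: Y.smult_diff)
      then have "\<gamma> \<le> vnorm Y (?a \<ominus>\<^bsub>Y\<^esub> y)"
        using b pos a y by (simp add: bad_def Y.vnorm_smult mult.commute)
      ultimately have "vnorm Y (?a \<oplus>\<^bsub>Y\<^esub> y) \<le> 2 * (1 - \<delta>)" using a y by (intro convex)
      moreover have "t.vmeas E \<oplus>\<^bsub>Y\<^esub> ?m \<odot>\<^bsub>Y\<^esub> y = ?m \<odot>\<^bsub>Y\<^esub> (?a \<oplus>\<^bsub>Y\<^esub> y)"
        using a y Ga by (simp add: Y.smult_add_right)
      ultimately show ?thesis using pos a y by (simp add: Y.vnorm_smult mult.commute)
    qed
    have swap: "(t.vmeas A \<oplus>\<^bsub>Y\<^esub> t.vmeas B) \<oplus>\<^bsub>Y\<^esub> of_real (t.mass A + t.mass B) \<odot>\<^bsub>Y\<^esub> y =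
        (t.vmeas A \<oplus>\<^bsub>Y\<^esub> of_real (t.mass A) \<odot>\<^bsub>Y\<^esub> y) \<oplus>\<^bsub>Y\<^esub> (t.vmeas B \<oplus>\<^bsub>Y\<^esub> of_real (t.mass B) \<odot>\<^bsub>Y\<^esub> y)"
      if "A \<in> sets M" "B \<in> sets M" for A B
      using t.vmeas[OF that(1)] t.vmeas[OF that(2)] y by (simp add: Y.smult_add_left Y.a_ac)
    have bad_union: "vnorm Y (t.vmeas (\<Union>F) \<oplus>\<^bsub>Y\<^esub> of_real (t.mass (\<Union>F)) \<odot>\<^bsub>Y\<^esub> y) \<le> 2 * (1 - \<delta>) * t.mass (\<Union>F)"
      if "finite F" "disjoint F" "\<forall>E\<in>F. bad E" for F
      using that
    proof (induction F rule: finite_induct)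
      case empty
      have "t.vmeas {} = \<zero>\<^bsub>Y\<^esub>" by (simp add: t.vmeas_def t.zero)
      then show ?case using y by (simp add: t.mass_def)
    next
      case (insert E F)
      have sets: "E \<in> sets M" "\<Union>F \<in> sets M"
        using insert by (auto simp: bad_def intro!: sets.finite_Union)
      have disj: "E \<inter> \<Union>F = {}" using insert.hyps insert.prems by (auto simp: disjoint_def)
      have "vnorm Y (t.vmeas (\<Union>F) \<oplus>\<^bsub>Y\<^esub> of_real (t.mass (\<Union>F)) \<odot>\<^bsub>Y\<^esub> y) \<le> 2 * (1 - \<delta>) * t.mass (\<Union>F)"
        using insert.prems by (intro insert.IH) (auto simp: disjoint_def)
      moreover have "vnorm Y (t.vmeas E \<oplus>\<^bsub>Y\<^esub> of_real (t.mass E) \<odot>\<^bsub>Y\<^esub> y) \<le> 2 * (1 - \<delta>) * t.mass E"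
        using insert.prems by (intro bad_single) auto
      ultimately show ?case
        unfolding Union_insert t.vmeas_Un[OF sets disj] swap[OF sets] distrib_left
        using t.vmeas[OF sets(1)] t.vmeas[OF sets(2)] y
          Y.vnorm_triangle[of "t.vmeas E \<oplus>\<^bsub>Y\<^esub> of_real (t.mass E) \<odot>\<^bsub>Y\<^esub> y" "t.vmeas (\<Union>F) \<oplus>\<^bsub>Y\<^esub> of_real (t.mass (\<Union>F)) \<odot>\<^bsub>Y\<^esub> y"]
        by simp
    qed
    \<comment> \<open>Compare the norm of \<open>2 y\<close> with the sum of its parts on the union and on the complement.\<close>
    have bad_small: "t.mass (\<Union>F) \<le> \<gamma>" if F: "finite F" "disjoint F" "\<forall>E\<in>F. bad E" for F
    proof -
      define E where "E = \<Union>F"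
      have E: "E \<in> sets M" "space M - E \<in> sets M"
        using F by (auto simp: bad_def E_def intro!: sets.finite_Union)
      have EU: "E \<union> (space M - E) = space M" using sets.sets_into_space[OF E(1)] by auto
      have massE: "t.mass E + t.mass (space M - E) = 1" using t.vmeas_Un(2)[OF E] EU t.mass_space by simp
      have yE: "y = t.vmeas E \<oplus>\<^bsub>Y\<^esub> t.vmeas (space M - E)" using t.vmeas_Un(1)[OF E] EU by (simp add: y_def)
      have "y \<oplus>\<^bsub>Y\<^esub> of_real (t.mass E + t.mass (space M - E)) \<odot>\<^bsub>Y\<^esub> y =
          (t.vmeas E \<oplus>\<^bsub>Y\<^esub> of_real (t.mass E) \<odot>\<^bsub>Y\<^esub> y) \<oplus>\<^bsub>Y\<^esub> (t.vmeas (space M - E) \<oplus>\<^bsub>Y\<^esub> of_real (t.mass (space M - E)) \<odot>\<^bsub>Y\<^esub> y)"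
        using swap[OF E] yE by metis
      moreover have "y \<oplus>\<^bsub>Y\<^esub> of_real (t.mass E + t.mass (space M - E)) \<odot>\<^bsub>Y\<^esub> y = 2 \<odot>\<^bsub>Y\<^esub> y"
        using Y.smult_add_left[OF y(1), of 1 1] y massE by simp
      moreover have "vnorm Y (2 \<odot>\<^bsub>Y\<^esub> y) = 2 * vnorm Y y" using y by (simp add: Y.vnorm_smult)
      ultimately have "2 * vnorm Y y \<le>
          vnorm Y (t.vmeas E \<oplus>\<^bsub>Y\<^esub> of_real (t.mass E) \<odot>\<^bsub>Y\<^esub> y) +
          vnorm Y (t.vmeas (space M - E) \<oplus>\<^bsub>Y\<^esub> of_real (t.mass (space M - E)) \<odot>\<^bsub>Y\<^esub> y)"
        using Y.vnorm_triangle[of "t.vmeas E \<oplus>\<^bsub>Y\<^esub> of_real (t.mass E) \<odot>\<^bsub>Y\<^esub> y"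
            "t.vmeas (space M - E) \<oplus>\<^bsub>Y\<^esub> of_real (t.mass (space M - E)) \<odot>\<^bsub>Y\<^esub> y"] t.vmeas[OF E(1)] t.vmeas[OF E(2)] y
        by simp
      also have "\<dots> \<le> 2 * (1 - \<delta>) * t.mass E + 2 * t.mass (space M - E)"
      proof (intro add_mono)
        show "vnorm Y (t.vmeas E \<oplus>\<^bsub>Y\<^esub> of_real (t.mass E) \<odot>\<^bsub>Y\<^esub> y) \<le> 2 * (1 - \<delta>) * t.mass E"
          using bad_union[OF F] by (simp add: E_def)
        have "vnorm Y (t.vmeas (space M - E) \<oplus>\<^bsub>Y\<^esub> of_real (t.mass (space M - E)) \<odot>\<^bsub>Y\<^esub> y)
            \<le> vnorm Y (t.vmeas (space M - E)) + t.mass (space M - E) * vnorm Y y"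
          using Y.vnorm_triangle[of "t.vmeas (space M - E)" "of_real (t.mass (space M - E)) \<odot>\<^bsub>Y\<^esub> y"] t.vmeas[OF E(2)] y t.mass_nonneg
          by (simp add: Y.vnorm_smult)
        also have "\<dots> \<le> t.mass (space M - E) + t.mass (space M - E) * 1"
          using t.vmeas[OF E(2)] y t.mass_nonneg by (intro add_mono mult_left_mono) auto
        finally show "vnorm Y (t.vmeas (space M - E) \<oplus>\<^bsub>Y\<^esub> of_real (t.mass (space M - E)) \<odot>\<^bsub>Y\<^esub> y)
            \<le> 2 * t.mass (space M - E)" by simp
      qed
      also have "\<dots> = 2 - 2 * (\<delta> * t.mass E)" using massE by (simp add: algebra_simps)
      finally have "\<delta> * t.mass E < \<delta> * \<gamma>" using y(3) \<eta> by simp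
      then show ?thesis using \<delta> by (simp add: E_def)
    qed
    obtain C where C: "C \<in> sets M" "t.mass (space M - C) \<le> \<gamma>" "\<And>E. E \<subseteq> C \<Longrightarrow> \<not> bad E"
      using t.N.exhaustion[of bad \<gamma>] bad_pos bad_small unfolding t.mass_def[symmetric]
      by (metis bad_def sets_density space_density)

    define D where "D = {x \<in> C. 0 < h x}"
    have D: "D \<in> sets M"
    proof -
      have "D = C \<inter> {x \<in> space M. 0 < h x}" using sets.sets_into_space[OF C(1)] by (auto simp: D_def)
      then show ?thesis using C(1) by simp
    qed
    have massD: "1 - \<gamma> \<le> t.mass D" "t.mass D \<le> 1" "0 < t.mass D"
    proof -
      have "t.mass C = t.mass D"
        unfolding t.mass_eq[OF C(1)] t.mass_eq[OF D]
        by (rule Bochner_Integration.integral_cong)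
          (use h(2) in \<open>auto simp: D_def less_le split: split_indicator\<close>)
      moreover have "t.mass C + t.mass (space M - C) = 1"
        using t.vmeas_Un(2)[of C "space M - C"] C(1) sets.sets_into_space[OF C(1)] t.mass_space
        by (simp add: Un_absorb1)
      ultimately show "1 - \<gamma> \<le> t.mass D" "t.mass D \<le> 1" "0 < t.mass D"
        using C(2) t.mass_nonneg[of "space M - C"] \<gamma> by linarith+
    qed
    define c where "c = (of_real (1 / vnorm Y y) :: 'k)"
    define w where "w = c \<odot>\<^bsub>Y\<^esub> y"
    have ypos: "0 < vnorm Y y" using y \<eta> \<gamma> by linarith
    have w: "w \<in> carrier Y" "vnorm Y w = 1" "vnorm Y (w \<ominus>\<^bsub>Y\<^esub> y) \<le> \<gamma>"
    proof -
      show "w \<in> carrier Y" "vnorm Y w = 1"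
        using y ypos by (auto simp: w_def c_def Y.vnorm_smult norm_divide)
      have "w \<ominus>\<^bsub>Y\<^esub> y = (c - 1) \<odot>\<^bsub>Y\<^esub> y" using y by (simp add: w_def Y.smult_diff_left)
      then have "vnorm Y (w \<ominus>\<^bsub>Y\<^esub> y) = norm (c - 1) * vnorm Y y" using y by (simp add: Y.vnorm_smult)
      also have "c - 1 = of_real (1 / vnorm Y y - 1)" by (simp add: c_def)
      also have "norm (of_real (1 / vnorm Y y - 1) :: 'k) = 1 / vnorm Y y - 1"
        using y ypos by (simp only: norm_of_real) auto
      also have "(1 / vnorm Y y - 1) * vnorm Y y = 1 - vnorm Y y" using ypos by (simp add: field_simps)
      finally show "vnorm Y (w \<ominus>\<^bsub>Y\<^esub> y) \<le> \<gamma>" using y \<eta> by simp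
    qed

    interpret p: L1_operator Y M 1 "\<lambda>f. (LINT x|M. f x) \<odot>\<^bsub>Y\<^esub> w"
      using L1_operator_integral[OF Y w(1)] w(2) by simp
    interpret r: L1_operator Y M "1 + vnorm Y y" "\<lambda>f. t f \<ominus>\<^bsub>Y\<^esub> (LINT x|M. f x) \<odot>\<^bsub>Y\<^esub> y"
      by (intro L1_operator_diff t L1_operator_integral[OF Y y(1)])
    have r_dom: "r.dominated \<gamma> f" if "integrable M f" "\<And>x. x \<in> space M \<Longrightarrow> x \<notin> D \<Longrightarrow> f x = 0" for f
    proof (rule r.dominated_if_dominated_on_sets[OF h(1) D _ _ that])
      fix E assume E: "E \<in> sets M" "E \<subseteq> D"
      then have "\<not> bad E" using C(3)[of E] by (auto simp: D_def)
      then show "r.dominated \<gamma> (\<lambda>x. indicator E x * of_real (h x))"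
        using E t.h_indicator[OF E(1)] unfolding r.dominated_def bad_def t.vmeas_def by simp
    qed (simp add: D_def)
    define s where "s = (\<lambda>f. t (\<lambda>x. indicator (- D) x * f x) \<oplus>\<^bsub>Y\<^esub> (LINT x|M. indicator D x * f x) \<odot>\<^bsub>Y\<^esub> w)"
    note s = L1_operator_glue[OF t p.L1_operator_axioms D s_def]
    define f where "f = (\<lambda>x. of_real (1 / t.mass D) * (indicator D x * of_real (h x) :: 'k))"
    have f: "integrable M f" "(LINT x|M. norm (f x)) = 1" "(LINT x|M. f x) = 1"
      unfolding f_def norm_mult[of "of_real (1 / t.mass D)"] using t.h_indicator[OF D] massD by (simp_all add: norm_divide del: norm_mult)
    have sf: "s f = w" using s(3)[OF f(1)] f(3) w by (auto simp: f_def)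
    have dist: "(LINT x|M. norm (f x - of_real (h x))) < \<epsilon>"
    proof -
      have "(LINT x|M. norm (f x - of_real (h x))) =
          (LINT x|M. (1 / t.mass D - 1) * (indicator D x * h x) + indicator (- D) x * h x)"
      proof (rule Bochner_Integration.integral_cong[OF refl])
        fix x
        have "f x - of_real (h x) = of_real ((1 / t.mass D - 1) * (indicator D x * h x) - indicator (- D) x * h x)"
          by (auto simp: f_def algebra_simps split: split_indicator)
        moreover have "0 \<le> (1 / t.mass D - 1) * h x" using massD h(2)[of x] by simp
        ultimately show "norm (f x - of_real (h x)) = (1 / t.mass D - 1) * (indicator D x * h x) + indicator (- D) x * h x"
          using h(2)[of x] by (auto simp: norm_of_real simp del: of_real_mult of_real_diff split: split_indicator)
      qed
      also have "\<dots> = (1 / t.mass D - 1) * t.mass D + (1 - t.mass D)"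
        using integral_indicator_split[OF D h(1)] h(3) by (simp add: t.mass_eq[OF D])
      also have "\<dots> = 2 * (1 - t.mass D)" using massD by (simp add: field_simps)
      also have "\<dots> < \<epsilon>" using massD \<epsilon> by (simp add: \<gamma>_def)
      finally show ?thesis .
    qed
    have close: "vnorm Y (s \<phi> \<ominus>\<^bsub>Y\<^esub> t \<phi>) \<le> \<epsilon> * (LINT x|M. norm (\<phi> x))" if \<phi>: "integrable M \<phi>" for \<phi>
    proof -
      let ?\<phi> = "\<lambda>x. indicator D x * \<phi> x"
      let ?i = "LINT x|M. ?\<phi> x"
      note sp = integral_indicator_split[OF D \<phi>]
      have "vnorm Y (s \<phi> \<ominus>\<^bsub>Y\<^esub> t \<phi>) \<le> vnorm Y (?i \<odot>\<^bsub>Y\<^esub> w \<ominus>\<^bsub>Y\<^esub> ?i \<odot>\<^bsub>Y\<^esub> y) + vnorm Y (?i \<odot>\<^bsub>Y\<^esub> y \<ominus>\<^bsub>Y\<^esub> t ?\<phi>)"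
        unfolding s(2)[OF \<phi>] using w y sp by (intro Y.vnorm_diff_triangle) auto
      also have "vnorm Y (?i \<odot>\<^bsub>Y\<^esub> w \<ominus>\<^bsub>Y\<^esub> ?i \<odot>\<^bsub>Y\<^esub> y) = norm ?i * vnorm Y (w \<ominus>\<^bsub>Y\<^esub> y)"
        using w y by (simp add: Y.smult_diff[symmetric] Y.vnorm_smult)
      also have "\<dots> \<le> (LINT x|M. norm (?\<phi> x)) * \<gamma>"
        using w y by (intro mult_mono integral_norm_bound) (auto simp: Y.vnorm_nonneg)
      also have "vnorm Y (?i \<odot>\<^bsub>Y\<^esub> y \<ominus>\<^bsub>Y\<^esub> t ?\<phi>) \<le> \<gamma> * (LINT x|M. norm (?\<phi> x))"
        using r_dom[OF sp(1)] y sp by (simp add: r.dominated_def Y.vnorm_diff_commute)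
      finally have "vnorm Y (s \<phi> \<ominus>\<^bsub>Y\<^esub> t \<phi>) \<le> 2 * \<gamma> * (LINT x|M. norm (?\<phi> x))" by simp
      also have "\<dots> \<le> \<epsilon> * (LINT x|M. norm (\<phi> x))"
      proof (rule mult_mono)
        show "(LINT x|M. norm (?\<phi> x)) \<le> (LINT x|M. norm (\<phi> x))"
          unfolding sp(4) by simp
      qed (use \<epsilon> in \<open>auto simp: \<gamma>_def\<close>)
      finally show ?thesis .
    qed
    show ?thesis
      using s(1) f sf w dist close by (intro exI[of _ s] exI[of _ f]) auto
  qed
  then show "\<exists>\<eta>>0. \<forall>t h.
      L1_operator Y M 1 t \<and> integrable M h \<and> (\<forall>x. 0 \<le> h x) \<and> (LINT x|M. h x) = 1 \<and>
      vnorm Y (t (\<lambda>x. of_real (h x))) > 1 - \<eta> \<longrightarrow>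
      (\<exists>s f. L1_operator Y M 1 s \<and> integrable M f \<and> (LINT x|M. norm (f x)) = 1 \<and> vnorm Y (s f) = 1 \<and>
        (LINT x|M. norm (f x - of_real (h x))) < \<epsilon> \<and>
        (\<forall>\<phi>. integrable M \<phi> \<longrightarrow> vnorm Y (s \<phi> \<ominus>\<^bsub>Y\<^esub> t \<phi>) \<le> \<epsilon> * (LINT x|M. norm (\<phi> x))))"
    using \<eta>(1) by (intro exI[of _ \<eta>]) simp
qed

section \<open>Uniform convexity of \<open>L\<^sub>q(\<nu>)\<close>\<close>

lemma powr_midpoint_less:
  fixes u v q :: real
  assumes q: "1 < q" and uv: "0 \<le> u" "u < v"
  shows "((u + v) / 2) powr q < (u powr q + v powr q) / 2"
proof -
  define m where "m = (u + v) / 2"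
  have m: "0 \<le> u" "u < m" "m < v" "m - u = v - m" using uv by (auto simp: m_def field_simps)
  have mvt: "\<exists>\<xi>. a < \<xi> \<and> \<xi> < b \<and> b powr q - a powr q = (b - a) * (q * \<xi> powr (q - 1))"
    if a: "0 \<le> a" and ab: "a < b" for a b
  proof -
      have "\<exists>l z. a < z \<and> z < b \<and> ((\<lambda>x. x powr q) has_real_derivative l) (at z) \<and>
        b powr q - a powr q = (b - a) * l"
      proof (rule MVT[OF ab])
        show "continuous_on {a..b} (\<lambda>x. x powr q)"
          using q a by (intro continuous_on_powr' continuous_intros) auto
        show "(\<lambda>x. x powr q) differentiable (at x)" if "a < x" "x < b" for x
          using that a has_real_derivative_powr[of x q] real_differentiable_def by (metis le_less_trans)
      qed
      then obtain l z where z: "a < z" "z < b" "((\<lambda>x. x powr q) has_real_derivative l) (at z)"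
        "b powr q - a powr q = (b - a) * l" by blast
      have "((\<lambda>x. x powr q) has_real_derivative q * z powr (q - 1)) (at z)"
        using z a by (intro has_real_derivative_powr) auto
      then have "l = q * z powr (q - 1)" using z(3) by (rule DERIV_unique[rotated])
      then show ?thesis using z by auto
  qed
  obtain x where x: "u < x" "x < m" "m powr q - u powr q = (m - u) * (q * x powr (q - 1))"
    using mvt[of u m] m by auto
  obtain y where y: "m < y" "y < v" "v powr q - m powr q = (v - m) * (q * y powr (q - 1))"
    using mvt[of m v] m by auto
  have "x powr (q - 1) < y powr (q - 1)"
    using x y m q by (intro powr_less_mono2) auto
  then have "m powr q - u powr q < v powr q - m powr q"
    using x y m q by (simp add: mult_strict_left_mono)
  then show ?thesis by (simp add: m_def)
qed

text \<open>
  If the norms of \<open>a\<close> and \<open>b\<close> differ, strictness comes from the \<open>q\<close>-th power; if they agree, it comes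
  from the parallelogram law.
\<close>

lemma norm_powr_strictly_convex:
  fixes a b :: "'v::real_inner"
  assumes q: "1 < q" and ab: "a \<noteq> b"
  shows "norm (a + b) powr q < 2 powr q / 2 * (norm a powr q + norm b powr q)"
proof -
  have scale: "(norm a + norm b) powr q = 2 powr q * ((norm a + norm b) / 2) powr q"
    by (simp add: powr_divide)
  show ?thesis
  proof (cases "norm a = norm b")
    case False
    have "((norm a + norm b) / 2) powr q < (norm a powr q + norm b powr q) / 2"
      using powr_midpoint_less[OF q, of "norm a" "norm b"] powr_midpoint_less[OF q, of "norm b" "norm a"] False
      by (cases "norm a < norm b") (auto simp: add.commute)
    then have "(norm a + norm b) powr q < 2 powr q * ((norm a powr q + norm b powr q) / 2)"
      unfolding scale by (intro mult_strict_left_mono) auto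
    moreover have "norm (a + b) powr q \<le> (norm a + norm b) powr q"
      using q by (intro powr_mono2 norm_triangle_ineq) auto
    ultimately show ?thesis by simp
  next
    case True
    have "(norm (a + b))\<^sup>2 + (norm (a - b))\<^sup>2 = 2 * (norm a)\<^sup>2 + 2 * (norm b)\<^sup>2"
      by (simp add: power2_norm_eq_inner inner_simps inner_commute)
    moreover have "0 < (norm (a - b))\<^sup>2" using ab by simp
    moreover have "(2 * norm a)\<^sup>2 = 2 * (norm a)\<^sup>2 + 2 * (norm b)\<^sup>2"
      unfolding power_mult_distrib True by simp
    ultimately have "(norm (a + b))\<^sup>2 < (2 * norm a)\<^sup>2"
      by linarith
    then have "norm (a + b) < 2 * norm a" by (rule power_less_imp_less_base) simp
    then have "norm (a + b) powr q < (2 * norm a) powr q"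
      using q by (intro powr_less_mono2) auto
    then show ?thesis using True by (simp add: powr_mult)
  qed
qed

text \<open>
  A quantitative form of strict convexity. By homogeneity it suffices to consider
  \<open>|a|\<^sup>q + |b|\<^sup>q = 1\<close>, and there the pairs with \<open>|a - b|\<^sup>q \<ge> \<epsilon>\<close> form a compact set.
  The inequality is linear in the \<open>q\<close>-th powers and is therefore ready to be integrated.
\<close>

lemma norm_powr_uniformly_convex:
  fixes \<epsilon> q :: real
  assumes q: "1 < q" and \<epsilon>: "0 < \<epsilon>"
  obtains \<delta> where "0 < \<delta>"
    "\<And>a b :: 'k::euclidean_space. norm (a + b) powr q + \<delta> * norm (a - b) powr q \<le>
        (2 powr q / 2 + \<delta> * \<epsilon>) * (norm a powr q + norm b powr q)"
proof -
  define K where "K = {p :: 'k \<times> 'k. norm (fst p) powr q + norm (snd p) powr q = 1 \<and> \<epsilon> \<le> norm (fst p - snd p) powr q}"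
  have weak: "norm (a + b) powr q \<le> 2 powr q / 2 * (norm a powr q + norm b powr q)" for a b :: 'k
  proof (cases "a = b")
    case True
    then have "norm (a + b) = 2 * norm a" by (simp add: scaleR_2[symmetric])
    then show ?thesis using True by (simp add: powr_mult)
  next
    case False
    then show ?thesis using norm_powr_strictly_convex[OF q, of a b] by simp
  qed
  have "compact K"
  proof (rule compact_eq_bounded_closed[THEN iffD2], intro conjI)
    have le1: "norm a \<le> 1" if "norm a powr q + norm b powr q = 1" for a b :: 'k
    proof (rule ccontr)
      assume "\<not> norm a \<le> 1"
      then have "1 powr q < norm a powr q" using q by (intro powr_less_mono2) auto
      then show False using that powr_ge_zero[of "norm b" q] by simp
    qed
    have "K \<subseteq> cball 0 1 \<times> cball 0 1"
      using le1 by (auto simp: K_def) (metis add.commute)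
    then show "bounded K" by (rule bounded_subset[rotated]) (intro bounded_Times bounded_cball)
    have "K = {p. norm (fst p) powr q + norm (snd p) powr q = 1} \<inter> {p. \<epsilon> \<le> norm (fst p - snd p) powr q}"
      by (auto simp: K_def)
    moreover have "closed \<dots>"
      using q by (intro closed_Int closed_Collect_eq closed_Collect_le continuous_intros continuous_on_powr') auto
    ultimately show "closed K" by simp
  qed
  have "\<exists>m<2 powr q / 2. \<forall>(a, b)\<in>K. norm (a + b) powr q \<le> m"
  proof (cases "K = {}")
    case True
    then show ?thesis by (intro exI[of _ 0]) auto
  next
    case False
    have "continuous_on K (\<lambda>p. norm (fst p + snd p) powr q)"
      using q by (intro continuous_on_powr' continuous_intros) auto
    from continuous_attains_sup[OF \<open>compact K\<close> False this]
    obtain a b where ab: "(a, b) \<in> K" "\<forall>p\<in>K. norm (fst p + snd p) powr q \<le> norm (a + b) powr q"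
      by auto
    have "a \<noteq> b" using ab(1) \<epsilon> by (auto simp: K_def)
    from norm_powr_strictly_convex[OF q this] show ?thesis
      using ab by (intro exI[of _ "norm (a + b) powr q"]) (force simp: K_def)
  qed
  then obtain m where m: "m < 2 powr q / 2" "\<And>a b. (a, b) \<in> K \<Longrightarrow> norm (a + b) powr q \<le> m" by auto
  define \<delta> where "\<delta> = (2 powr q / 2 - m) / 2 powr q"
  have \<delta>: "0 < \<delta>" "\<delta> * 2 powr q = 2 powr q / 2 - m" using m by (auto simp: \<delta>_def)
  have normalised: "norm (a + b) powr q + \<delta> * norm (a - b) powr q \<le> 2 powr q / 2 + \<delta> * \<epsilon>"
    if ab: "norm a powr q + norm b powr q = 1" for a b :: 'k
  proof (cases "\<epsilon> \<le> norm (a - b) powr q")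
    case True
    then have "norm (a + b) powr q \<le> m" using ab by (intro m) (simp add: K_def)
    moreover have "norm (a - b) powr q \<le> 2 powr q"
    proof -
      have "norm (a - b) powr q \<le> 2 powr q / 2" using weak[of a "- b"] ab by simp
      moreover have "0 < (2::real) powr q" by simp
      ultimately show ?thesis by linarith
    qed
    then have "\<delta> * norm (a - b) powr q \<le> \<delta> * 2 powr q" using \<delta> by (intro mult_left_mono) auto
    ultimately show ?thesis using \<delta> mult_pos_pos[OF \<delta>(1) \<epsilon>] by linarith
  next
    case False
    then have "\<delta> * norm (a - b) powr q \<le> \<delta> * \<epsilon>" using \<delta> by (intro mult_left_mono) auto
    then show ?thesis using weak[of a b] ab by simp
  qed
  show thesis
  proof (rule that[OF \<delta>(1)])
    fix a b :: 'k
    define s where "s = norm a powr q + norm b powr q"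
    show "norm (a + b) powr q + \<delta> * norm (a - b) powr q \<le>
        (2 powr q / 2 + \<delta> * \<epsilon>) * (norm a powr q + norm b powr q)"
    proof (cases "s = 0")
      case True
      then have "a = 0" "b = 0"
        by (auto simp: s_def add_nonneg_eq_0_iff)
      then show ?thesis by simp
    next
      case False
      then have s: "0 < s" by (auto simp: s_def less_le)
      define r where "r = 1 / s powr (1 / q)"
      have r: "0 < r" "r powr q = 1 / s" using s q by (auto simp: r_def powr_divide powr_powr)
      have sc: "norm (r *\<^sub>R c) powr q = norm c powr q / s" for c :: 'k
        using r by (simp add: powr_mult)
      have "norm (r *\<^sub>R a + r *\<^sub>R b) powr q + \<delta> * norm (r *\<^sub>R a - r *\<^sub>R b) powr q \<le> 2 powr q / 2 + \<delta> * \<epsilon>"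
        by (rule normalised) (use s in \<open>simp add: sc add_divide_distrib[symmetric] s_def[symmetric] del: norm_scaleR\<close>)
      then have "norm (a + b) powr q / s + \<delta> * (norm (a - b) powr q / s) \<le> 2 powr q / 2 + \<delta> * \<epsilon>"
        unfolding scaleR_right_distrib[symmetric] scaleR_right_diff_distrib[symmetric] sc .
      then show ?thesis
        unfolding s_def[symmetric] using s by (simp add: field_simps)
    qed
  qed
qed

text \<open>
  Integration of the pointwise inequality for \<open>\<epsilon>\<^sup>q / 4\<close>: its error term then cancels only half of what
  \<open>\<parallel>f - g\<parallel> \<ge> \<epsilon>\<close> gains.
\<close>

theorem uniformly_convex_Lp:
  fixes M :: "'a measure"
  assumes q: "1 < q"
  shows "uniformly_convex (Lp q M :: ('k::{real_normed_field, euclidean_space}, ('a \<Rightarrow> 'k) set) nspace)"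
  unfolding uniformly_convex_def
proof (intro allI impI)
  fix \<epsilon> :: real assume \<epsilon>: "0 < \<epsilon>"
  have q1: "1 \<le> q" using q by simp
  obtain \<delta>' where \<delta>': "0 < \<delta>'" and pw: "\<And>a b :: 'k. norm (a + b) powr q + \<delta>' * norm (a - b) powr q \<le>
        (2 powr q / 2 + \<delta>' * (\<epsilon> powr q / 4)) * (norm a powr q + norm b powr q)"
    using norm_powr_uniformly_convex[OF q, of "\<epsilon> powr q / 4"] \<epsilon> by auto
  define c where "c = max 0 (2 powr q - \<delta>' * \<epsilon> powr q / 2) powr (1 / q)"
  have c: "0 \<le> c" "c powr q = max 0 (2 powr q - \<delta>' * \<epsilon> powr q / 2)" using q by (auto simp: c_def powr_powr)
  have "c < 2"
  proof (rule ccontr)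
    assume "\<not> c < 2"
    then have "2 powr q \<le> c powr q" using q by (intro powr_mono2) auto
    moreover have "c powr q < 2 powr q" using c \<delta>' \<epsilon> by simp
    ultimately show False by simp
  qed
  show "\<exists>\<delta>>0. \<forall>x\<in>carrier (Lp q M). \<forall>y\<in>carrier (Lp q M :: ('k, ('a \<Rightarrow> 'k) set) nspace).
      vnorm (Lp q M) x \<le> 1 \<and> vnorm (Lp q M) y \<le> 1 \<and> \<epsilon> \<le> vnorm (Lp q M) (x \<ominus>\<^bsub>Lp q M\<^esub> y) \<longrightarrow>
      vnorm (Lp q M) (x \<oplus>\<^bsub>Lp q M\<^esub> y) \<le> 2 * (1 - \<delta>)"
  proof (intro exI[of _ "1 - c / 2"] conjI ballI impI; (elim conjE)?)
    show "0 < 1 - c / 2" using \<open>c < 2\<close> by simp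
    fix x y :: "('a \<Rightarrow> 'k) set"
    assume "x \<in> carrier (Lp q M)" "y \<in> carrier (Lp q M)" and
      n: "vnorm (Lp q M) x \<le> 1" "vnorm (Lp q M) y \<le> 1" "\<epsilon> \<le> vnorm (Lp q M) (x \<ominus>\<^bsub>Lp q M\<^esub> y)"
    then obtain f g where fg: "f \<in> Lp_functions q M" "g \<in> Lp_functions q M"
      "x = Lp_class q M f" "y = Lp_class q M g" by (auto simp: carrier_Lp)
    have diff: "(\<lambda>x. f x - g x) \<in> Lp_functions q M"
      using Lp_functions_add[OF q1 fg(1) Lp_functions_smult[OF q1 fg(2), of "- 1"]] by simp
    note sum = Lp_functions_add[OF q1 fg(1,2)]
    have int: "integrable M (\<lambda>x. norm (f x) powr q)" "integrable M (\<lambda>x. norm (g x) powr q)"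
      "integrable M (\<lambda>x. norm (f x + g x) powr q)" "integrable M (\<lambda>x. norm (f x - g x) powr q)"
      using fg diff sum by (auto simp: Lp_functions_def)
    have norms: "(LINT x|M. norm (f x) powr q) \<le> 1" "(LINT x|M. norm (g x) powr q) \<le> 1"
      "\<epsilon> powr q \<le> (LINT x|M. norm (f x - g x) powr q)"
    proof -
      show "(LINT x|M. norm (f x) powr q) \<le> 1" "(LINT x|M. norm (g x) powr q) \<le> 1"
        using n fg Lp_norm_le_iff[OF q1, of 1 M] by (auto simp: vnorm_Lp)
      have "\<epsilon> \<le> Lp_norm q M (\<lambda>x. f x - g x)"
        using n fg diff by (simp add: diff_Lp[OF q1] vnorm_Lp)
      then have "\<epsilon> powr q \<le> Lp_norm q M (\<lambda>x. f x - g x) powr q" using \<epsilon> q by (intro powr_mono2) auto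
      then show "\<epsilon> powr q \<le> (LINT x|M. norm (f x - g x) powr q)" by (simp add: Lp_norm_powr[OF q1])
    qed
    let ?C = "2 powr q / 2 + \<delta>' * (\<epsilon> powr q / 4)"
    have C: "0 \<le> ?C" using \<delta>' by simp
    have "(LINT x|M. norm (f x + g x) powr q + \<delta>' * norm (f x - g x) powr q) \<le>
        (LINT x|M. ?C * (norm (f x) powr q + norm (g x) powr q))"
      using int by (intro integral_mono pw) auto
    then have "(LINT x|M. norm (f x + g x) powr q) + \<delta>' * (LINT x|M. norm (f x - g x) powr q) \<le>
        ?C * ((LINT x|M. norm (f x) powr q) + (LINT x|M. norm (g x) powr q))"
      using int by simp
    also have "\<dots> \<le> ?C * 2" using norms C by (intro mult_left_mono) auto
    also have "\<dots> = 2 powr q + \<delta>' * \<epsilon> powr q / 2" by simp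
    finally have "(LINT x|M. norm (f x + g x) powr q) \<le> 2 powr q - \<delta>' * \<epsilon> powr q / 2"
      using mult_left_mono[OF norms(3), of \<delta>'] \<delta>' by linarith
    then have "Lp_norm q M (\<lambda>x. f x + g x) \<le> c"
      using c by (simp add: Lp_norm_le_iff[OF q1])
    then show "vnorm (Lp q M) (x \<oplus>\<^bsub>Lp q M\<^esub> y) \<le> 2 * (1 - (1 - c / 2))"
      using fg sum by (simp add: add_Lp[OF q1] vnorm_Lp)
  qed
qed

section \<open>The Radon-Nikodym property\<close>

context normed_space
begin

lemma tendsto_vnorm_diff:
  assumes "w \<in> carrier X" "z \<in> carrier X" "\<And>j. y j \<in> carrier X"
    and lim: "(\<lambda>j. vnorm X (y j \<ominus> z)) \<longlonglongrightarrow> 0"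
  shows "(\<lambda>j. vnorm X (w \<ominus> y j)) \<longlonglongrightarrow> vnorm X (w \<ominus> z)"
proof -
  have "\<bar>vnorm X (w \<ominus> y j) - vnorm X (w \<ominus> z)\<bar> \<le> vnorm X (y j \<ominus> z)" for j
    using vnorm_diff_triangle[of w z "y j"] vnorm_diff_triangle[of w "y j" z]
      vnorm_diff_commute[of "y j" z] assms(1-3) by auto
  then have "(\<lambda>j. vnorm X (w \<ominus> y j) - vnorm X (w \<ominus> z)) \<longlonglongrightarrow> 0"
    by (intro Lim_null_comparison[OF _ lim]) auto
  then show ?thesis by (simp add: LIM_zero_iff)
qed

lemma vnorm_weighted_finsum_diff_le:
  assumes "finite V" "V \<subseteq> carrier X" "v \<in> carrier X" and m: "\<And>w. 0 \<le> m w"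
  shows "vnorm X ((\<Oplus>w\<in>V. of_real (m w) \<odot>\<^bsub>X\<^esub> w) \<ominus> of_real (\<Sum>w\<in>V. m w) \<odot>\<^bsub>X\<^esub> v)
    \<le> (\<Sum>w\<in>V. m w * vnorm X (w \<ominus> v))"
  using assms(1,2)
proof (induction V rule: finite_induct)
  case (insert u V)
  let ?S = "\<Oplus>w\<in>V. of_real (m w) \<odot>\<^bsub>X\<^esub> w"
  have u: "u \<in> carrier X" and S: "?S \<in> carrier X"
    using insert.prems by (auto intro!: finsum_closed)
  have "(\<Oplus>w\<in>insert u V. of_real (m w) \<odot>\<^bsub>X\<^esub> w) = of_real (m u) \<odot>\<^bsub>X\<^esub> u \<oplus> ?S"
    using insert.prems insert.hyps by (intro finsum_insert) auto
  moreover have "of_real (\<Sum>w\<in>insert u V. m w) \<odot>\<^bsub>X\<^esub> v =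
      of_real (m u) \<odot>\<^bsub>X\<^esub> v \<oplus> of_real (\<Sum>w\<in>V. m w) \<odot>\<^bsub>X\<^esub> v"
    using insert.hyps assms(3) by (simp add: smult_add_left)
  ultimately have "(\<Oplus>w\<in>insert u V. of_real (m w) \<odot>\<^bsub>X\<^esub> w) \<ominus> of_real (\<Sum>w\<in>insert u V. m w) \<odot>\<^bsub>X\<^esub> v
      = of_real (m u) \<odot>\<^bsub>X\<^esub> (u \<ominus> v) \<oplus> (?S \<ominus> of_real (\<Sum>w\<in>V. m w) \<odot>\<^bsub>X\<^esub> v)"
    using u S assms(3) by (simp add: add_diff_add smult_diff)
  then have "vnorm X ((\<Oplus>w\<in>insert u V. of_real (m w) \<odot>\<^bsub>X\<^esub> w) \<ominus> of_real (\<Sum>w\<in>insert u V. m w) \<odot>\<^bsub>X\<^esub> v)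
      \<le> m u * vnorm X (u \<ominus> v) + vnorm X (?S \<ominus> of_real (\<Sum>w\<in>V. m w) \<odot>\<^bsub>X\<^esub> v)"
    using vnorm_triangle[of "of_real (m u) \<odot>\<^bsub>X\<^esub> (u \<ominus> v)" "?S \<ominus> of_real (\<Sum>w\<in>V. m w) \<odot>\<^bsub>X\<^esub> v"]
      u S assms(3) m[of u] by (simp add: vnorm_smult)
  then show ?case using insert by (simp add: add.commute)
qed (use assms in simp)

lemma simple_int_diff_le:
  assumes M: "finite_measure M" and E: "E \<in> sets M" and s: "simple_fun X M s" and v: "v \<in> carrier X"
  shows "ennreal (vnorm X (simple_int X M E s \<ominus> of_real (measure M E) \<odot>\<^bsub>X\<^esub> v))
    \<le> (\<integral>\<^sup>+x. ennreal (vnorm X (s x \<ominus> v)) * indicator E x \<partial>M)"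
proof -
  interpret finite_measure M by fact
  let ?V = "s ` space M" and ?A = "\<lambda>w. {x \<in> E. s x = w}"
  have fin: "finite ?V" and V: "?V \<subseteq> carrier X"
    using s by (auto simp: simple_fun_def simple_functionD)
  have A: "?A w \<in> sets M" for w
  proof -
    have "?A w = E \<inter> (s -` {w} \<inter> space M)" using sets.sets_into_space[OF E] by auto
    then show ?thesis using E s by (auto simp: simple_fun_def intro: simple_functionD)
  qed
  have "E = (\<Union>w\<in>?V. ?A w)" using sets.sets_into_space[OF E] by auto
  moreover have "measure M (\<Union>w\<in>?V. ?A w) = (\<Sum>w\<in>?V. measure M (?A w))"
    using A fin by (intro finite_measure_finite_Union) (auto simp: disjoint_family_on_def)
  ultimately have mE: "measure M E = (\<Sum>w\<in>?V. measure M (?A w))" by simp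
  have "vnorm X (simple_int X M E s \<ominus> of_real (measure M E) \<odot>\<^bsub>X\<^esub> v)
      \<le> (\<Sum>w\<in>?V. measure M (?A w) * vnorm X (w \<ominus> v))"
    unfolding simple_int_def mE by (rule vnorm_weighted_finsum_diff_le[OF fin V v]) simp
  also have "ennreal \<dots> = (\<Sum>w\<in>?V. ennreal (vnorm X (w \<ominus> v)) * emeasure M (?A w))"
    using V v by (subst sum_ennreal[symmetric])
      (auto simp: vnorm_nonneg emeasure_eq_measure ennreal_mult[symmetric] mult.commute intro!: sum.cong)
  also have "\<dots> = (\<Sum>w\<in>?V. \<integral>\<^sup>+x. ennreal (vnorm X (w \<ominus> v)) * indicator (?A w) x \<partial>M)"
    using A by (simp add: nn_integral_cmult_indicator)
  also have "\<dots> = (\<integral>\<^sup>+x. (\<Sum>w\<in>?V. ennreal (vnorm X (w \<ominus> v)) * indicator (?A w) x) \<partial>M)"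
    using A by (intro nn_integral_sum[symmetric]) auto
  also have "\<dots> = (\<integral>\<^sup>+x. ennreal (vnorm X (s x \<ominus> v)) * indicator E x \<partial>M)"
  proof (rule nn_integral_cong)
    fix x assume x: "x \<in> space M"
    have "(\<Sum>w\<in>?V. ennreal (vnorm X (w \<ominus> v)) * indicator (?A w) x) =
        (\<Sum>w\<in>?V. if w = s x then ennreal (vnorm X (s x \<ominus> v)) * indicator E x else 0)"
      by (intro sum.cong) (auto split: split_indicator)
    then show "(\<Sum>w\<in>?V. ennreal (vnorm X (w \<ominus> v)) * indicator (?A w) x) =
        ennreal (vnorm X (s x \<ominus> v)) * indicator E x"
      using fin x by simp
  qed
  finally show ?thesis by (simp add: ennreal_leI)
qed

text \<open>
  The density \<open>g\<close> is only almost everywhere a limit of simple functions, so the distances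
  \<open>\<parallel>w - g x\<parallel>\<close> need not be measurable in \<open>x\<close>; they are replaced by measurable functions that agree
  with them almost everywhere.
\<close>

lemma strongly_measurable_dist:
  assumes g: "strongly_measurable X M g"
    and \<sigma>: "\<And>i. simple_fun X M (\<sigma> i)" "AE x in M. (\<lambda>i. vnorm X (\<sigma> i x \<ominus> g x)) \<longlonglongrightarrow> 0"
    and s: "simple_fun X M s"
    and d_def: "d = (\<lambda>x. liminf (\<lambda>i. ennreal (vnorm X (s x \<ominus> \<sigma> i x))))"
  shows "d \<in> borel_measurable M" "AE x in M. d x = ennreal (vnorm X (s x \<ominus> g x))"
proof -
  have "simple_function M (\<lambda>x. vnorm X (s x \<ominus> \<sigma> i x))" for i
    using simple_function_compose2[of M s "\<sigma> i" "\<lambda>a b. vnorm X (a \<ominus> b)"] s \<sigma>(1)[of i]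
    by (auto simp: simple_fun_def)
  then have [measurable]: "(\<lambda>x. vnorm X (s x \<ominus> \<sigma> i x)) \<in> borel_measurable M" for i
    by (rule borel_measurable_simple_function)
  show "d \<in> borel_measurable M" unfolding d_def by measurable
  show "AE x in M. d x = ennreal (vnorm X (s x \<ominus> g x))"
    using \<sigma>(2) AE_space
  proof eventually_elim
    case (elim x)
    have "(\<lambda>i. vnorm X (s x \<ominus> \<sigma> i x)) \<longlonglongrightarrow> vnorm X (s x \<ominus> g x)"
      using elim s \<sigma>(1) g
      by (intro tendsto_vnorm_diff) (auto simp: simple_fun_def strongly_measurable_def Pi_iff)
    then have "(\<lambda>i. ennreal (vnorm X (s x \<ominus> \<sigma> i x))) \<longlonglongrightarrow> ennreal (vnorm X (s x \<ominus> g x))"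
      by (rule tendsto_ennrealI)
    then show ?case unfolding d_def by (intro lim_imp_Liminf) auto
  qed
qed

text \<open>
  For a simple function the bound is the triangle inequality for a finite sum; it passes to the Bochner
  integral because the simple functions approximate \<open>g\<close> in mean.
\<close>

lemma has_bochner_int_diff_le:
  assumes M: "finite_measure M" and E: "E \<in> sets M" and int: "has_bochner_int X M E g y"
    and v: "v \<in> carrier X" and c: "0 \<le> c" "AE x in M. x \<in> E \<longrightarrow> vnorm X (g x \<ominus> v) \<le> c"
  shows "vnorm X (y \<ominus> of_real (measure M E) \<odot>\<^bsub>X\<^esub> v) \<le> c * measure M E"
proof (rule field_le_epsilon)
  interpret finite_measure M by fact
  fix e :: real assume e: "0 < e"
  from int obtain s where g: "strongly_measurable X M g" and y: "y \<in> carrier X"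
    and s: "\<And>i. simple_fun X M (s i)"
    and lim1: "(\<lambda>i. \<integral>\<^sup>+x. ennreal (vnorm X (s i x \<ominus> g x)) \<partial>M) \<longlonglongrightarrow> 0"
    and lim2: "(\<lambda>i. vnorm X (simple_int X M E (s i) \<ominus> y)) \<longlonglongrightarrow> 0"
    unfolding has_bochner_int_def by blast
  from g obtain \<sigma> where \<sigma>: "\<And>i. simple_fun X M (\<sigma> i)"
    "AE x in M. (\<lambda>i. vnorm X (\<sigma> i x \<ominus> g x)) \<longlonglongrightarrow> 0"
    unfolding strongly_measurable_def by blast
  have "\<forall>\<^sub>F i in sequentially. (\<integral>\<^sup>+x. ennreal (vnorm X (s i x \<ominus> g x)) \<partial>M) < ennreal (e / 2)"
    using e by (intro order_tendstoD(2)[OF lim1]) simp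
  moreover have "\<forall>\<^sub>F i in sequentially. vnorm X (simple_int X M E (s i) \<ominus> y) < e / 2"
    using e by (intro order_tendstoD(2)[OF lim2]) simp
  ultimately have "\<forall>\<^sub>F i in sequentially. (\<integral>\<^sup>+x. ennreal (vnorm X (s i x \<ominus> g x)) \<partial>M) < ennreal (e / 2) \<and>
      vnorm X (simple_int X M E (s i) \<ominus> y) < e / 2"
    by (rule eventually_conj)
  then obtain i where i: "(\<integral>\<^sup>+x. ennreal (vnorm X (s i x \<ominus> g x)) \<partial>M) < ennreal (e / 2)"
    "vnorm X (simple_int X M E (s i) \<ominus> y) < e / 2"
    by (auto simp: eventually_sequentially)
  define d where "d = (\<lambda>x. liminf (\<lambda>j. ennreal (vnorm X (s i x \<ominus> \<sigma> j x))))"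
  note d = strongly_measurable_dist[OF g \<sigma> s[of i] d_def]
  note [measurable] = d(1) E
  have si: "simple_int X M E (s i) \<in> carrier X"
    using s[of i] unfolding simple_int_def by (intro finsum_closed) (auto simp: simple_fun_def)
  have "ennreal (vnorm X (simple_int X M E (s i) \<ominus> of_real (measure M E) \<odot>\<^bsub>X\<^esub> v))
    \<le> (\<integral>\<^sup>+x. ennreal (vnorm X (s i x \<ominus> v)) * indicator E x \<partial>M)"
    by (rule simple_int_diff_le[OF M E s v])
  also have "\<dots> \<le> (\<integral>\<^sup>+x. d x + ennreal c * indicator E x \<partial>M)"
  proof (rule nn_integral_mono_AE)
    show "AE x in M. ennreal (vnorm X (s i x \<ominus> v)) * indicator E x \<le> d x + ennreal c * indicator E x"
      using d(2) c(2) AE_space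
    proof eventually_elim
      case (elim x)
      show ?case
      proof (cases "x \<in> E")
        case True
        have mem: "s i x \<in> carrier X" "g x \<in> carrier X"
          using s[of i] g elim(3) by (auto simp: simple_fun_def strongly_measurable_def)
        have "vnorm X (s i x \<ominus> v) \<le> vnorm X (s i x \<ominus> g x) + c"
          using vnorm_diff_triangle[OF mem v] elim(2) True by simp
        then show ?thesis
          using True elim(1) c(1) mem by (simp add: ennreal_leI vnorm_nonneg ennreal_plus[symmetric] del: ennreal_plus)
      qed simp
    qed
  qed
  also have "\<dots> = (\<integral>\<^sup>+x. d x \<partial>M) + ennreal c * emeasure M E"
    by (simp add: nn_integral_add nn_integral_cmult_indicator)
  also have "(\<integral>\<^sup>+x. d x \<partial>M) = (\<integral>\<^sup>+x. ennreal (vnorm X (s i x \<ominus> g x)) \<partial>M)"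
    by (rule nn_integral_cong_AE[OF d(2)])
  also have "\<dots> + ennreal c * emeasure M E \<le> ennreal (e / 2) + ennreal (c * measure M E)"
    using i(1) c(1) by (intro add_mono) (auto simp: emeasure_eq_measure ennreal_mult)
  also have "\<dots> = ennreal (e / 2 + c * measure M E)"
    using e c(1) by (simp add: ennreal_plus)
  finally have "vnorm X (simple_int X M E (s i) \<ominus> of_real (measure M E) \<odot>\<^bsub>X\<^esub> v) \<le> e / 2 + c * measure M E"
    using e c(1) by (subst (asm) ennreal_le_iff) auto
  then show "vnorm X (y \<ominus> of_real (measure M E) \<odot>\<^bsub>X\<^esub> v) \<le> c * measure M E + e"
    using vnorm_diff_triangle[of y "simple_int X M E (s i)" "of_real (measure M E) \<odot>\<^bsub>X\<^esub> v"]
      vnorm_diff_commute[OF y si] i(2) y si v by simp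
qed

text \<open>
  A strongly measurable density is essentially separably valued: the values \<open>v n\<close> are those of a
  sequence of simple functions that converges to it, and \<open>k x\<close> is the first index for which \<open>v n\<close>
  is close to the density at \<open>x\<close>.
\<close>

lemma density_almost_constant_on_partition:
  assumes M: "finite_measure M" and g: "\<And>E. E \<in> sets M \<Longrightarrow> has_bochner_int X M E g (G E)"
    and \<kappa>: "0 < \<kappa>"
  shows "\<exists>k \<in> measurable M (count_space (UNIV :: nat set)). \<exists>v. \<forall>n. v n \<in> carrier X \<and>
    (\<forall>E\<in>sets M. (\<forall>x\<in>E. k x = n) \<longrightarrow>
      vnorm X (G E \<ominus> of_real (measure M E) \<odot>\<^bsub>X\<^esub> v n) \<le> \<kappa> * measure M E)"
proof -
  have sm: "strongly_measurable X M g" using g[of "{}"] by (simp add: has_bochner_int_def)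
  then obtain \<sigma> where \<sigma>: "\<And>i. simple_fun X M (\<sigma> i)"
    "AE x in M. (\<lambda>i. vnorm X (\<sigma> i x \<ominus> g x)) \<longlonglongrightarrow> 0"
    unfolding strongly_measurable_def by blast
  define D where "D = insert \<zero> (\<Union>i. \<sigma> i ` space M)"
  define v where "v = from_nat_into D"
  have "countable D"
    unfolding D_def
  proof (intro countable_insert countable_UN[OF countableI_type])
    show "countable (\<sigma> i ` space M)" for i
      using \<sigma>(1)[of i] by (intro countable_finite) (simp add: simple_fun_def simple_functionD)
  qed
  then have range: "range v = D" unfolding v_def by (intro range_from_nat_into) (auto simp: D_def)
  moreover have "D \<subseteq> carrier X" using \<sigma>(1) by (auto simp: D_def simple_fun_def)
  ultimately have v: "v n \<in> carrier X" for n by auto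
  have const: "simple_fun X M (\<lambda>x. v n)" for n using v by (auto simp: simple_fun_def)
  define d where "d n = (\<lambda>x. liminf (\<lambda>i. ennreal (vnorm X (v n \<ominus> \<sigma> i x))))" for n
  have d: "d n \<in> borel_measurable M" "AE x in M. d n x = ennreal (vnorm X (v n \<ominus> g x))" for n
    using strongly_measurable_dist[OF sm \<sigma> const[of n] d_def] by auto
  note [measurable] = d(1)
  define k where "k x = (LEAST n. d n x < ennreal \<kappa>)" for x
  have k: "k \<in> measurable M (count_space UNIV)" unfolding k_def by measurable
  have close: "AE x in M. vnorm X (g x \<ominus> v (k x)) \<le> \<kappa>"
  proof -
    have "AE x in M. \<forall>n. d n x = ennreal (vnorm X (v n \<ominus> g x))"
      unfolding AE_all_countable using d(2) by blast
    with \<sigma>(2) AE_space show ?thesis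
    proof eventually_elim
      case (elim x)
      have gx: "g x \<in> carrier X" using sm elim(2) by (auto simp: strongly_measurable_def)
      have "\<forall>\<^sub>F i in sequentially. vnorm X (\<sigma> i x \<ominus> g x) < \<kappa>"
        using \<kappa> by (rule order_tendstoD(2)[OF elim(1)])
      then obtain i where i: "vnorm X (\<sigma> i x \<ominus> g x) < \<kappa>" by (auto simp: eventually_sequentially)
      have "\<sigma> i x \<in> range v" unfolding range D_def using elim(2) by blast
      then obtain n where n: "\<sigma> i x = v n" by auto
      have "d n x < ennreal \<kappa>"
        using i n elim(3) \<kappa> by (simp add: ennreal_less_iff vnorm_nonneg v gx)
      then have "d (k x) x < ennreal \<kappa>" unfolding k_def by (rule LeastI)
      then show ?case
        using elim(3) \<kappa> vnorm_diff_commute[OF v gx] by (simp add: ennreal_less_iff vnorm_nonneg v gx)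
    qed
  qed
  show ?thesis
  proof (intro bexI[OF _ k] exI[of _ v] allI conjI v ballI impI)
    fix n E assume E: "E \<in> sets M" and kE: "\<forall>x\<in>E. k x = n"
    show "vnorm X (G E \<ominus> of_real (measure M E) \<odot>\<^bsub>X\<^esub> v n) \<le> \<kappa> * measure M E"
    proof (rule has_bochner_int_diff_le[OF M E g[OF E] v])
      show "AE x in M. x \<in> E \<longrightarrow> vnorm X (g x \<ominus> v n) \<le> \<kappa>"
        using close by eventually_elim (use kE in auto)
    qed (use \<kappa> in simp)
  qed
qed

text \<open>
  Domination by \<open>M\<close> upgrades finite to countable additivity, since the tails of a sequence of disjoint
  sets have small measure.
\<close>

lemma vector_measure_if_dominated:
  fixes M :: "'s measure"
  assumes M: "finite_measure M" and mem: "\<And>E. E \<in> sets M \<Longrightarrow> G E \<in> carrier X"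
    and Un: "\<And>A B. A \<in> sets M \<Longrightarrow> B \<in> sets M \<Longrightarrow> A \<inter> B = {} \<Longrightarrow> G (A \<union> B) = G A \<oplus> G B"
    and le: "\<And>E. E \<in> sets M \<Longrightarrow> vnorm X (G E) \<le> measure M E"
  shows "vector_measure X M G" "bounded_variation X M G" "measure_continuous X M G"
proof -
  interpret finite_measure M by fact
  have empty: "G {} = \<zero>"
    using le[of "{}"] vnorm_nonneg[of "G {}"] mem[of "{}"] by (simp add: vnorm_eq_0_iff[symmetric])
  show "vector_measure X M G"
    unfolding vector_measure_def
  proof (intro conjI allI impI)
    show "G \<in> sets M \<rightarrow> carrier X" using mem by auto
    fix A :: "nat \<Rightarrow> 's set" assume A: "range A \<subseteq> sets M" "disjoint_family A"
    define U where "U n = (\<Union>i<n. A i)" for n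
    define R where "R n = (\<Union>i. A i) - U n" for n
    have sets: "U n \<in> sets M" "(\<Union>i. A i) \<in> sets M" "R n \<in> sets M" for n
      using A by (auto simp: U_def R_def)
    have fin: "(\<Oplus>i\<in>{..<n}. G (A i)) = G (U n)" for n
    proof (induction n)
      case (Suc n)
      have "A n \<inter> A i = {}" if "i < n" for i
        using A(2) that by (intro disjoint_family_onD[of A UNIV]) auto
      then have "A n \<inter> U n = {}" by (auto simp: U_def)
      moreover have "U (Suc n) = A n \<union> U n" by (auto simp: U_def lessThan_Suc)
      ultimately show ?case
        using Suc A sets mem by (auto simp: lessThan_Suc finsum_insert Un)
    qed (simp add: U_def empty)
    have eq: "G (U n) \<ominus> G (\<Union>i. A i) = \<ominus> G (R n)" for n
    proof -
      have "G (\<Union>i. A i) = G (U n) \<oplus> G (R n)"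
      proof -
        have split: "(\<Union>i. A i) = U n \<union> R n" by (auto simp: U_def R_def)
        have "U n \<inter> R n = {}" by (auto simp: R_def)
        then show ?thesis unfolding split by (rule Un[OF sets(1,3)])
      qed
      moreover have "G (U n) \<in> carrier X" "G (R n) \<in> carrier X" using mem sets(1,3) by blast+
      ultimately show ?thesis by (simp add: minus_eq minus_add r_neg2)
    qed
    have "(\<lambda>n. measure M (U n)) \<longlonglongrightarrow> measure M (\<Union>n. U n)"
    proof (rule finite_Lim_measure_incseq)
      show "range U \<subseteq> sets M" using sets(1) by (rule image_subsetI)
      show "incseq U" unfolding incseq_def U_def by (intro allI impI UN_mono) auto
    qed
    also have "(\<Union>n. U n) = (\<Union>i. A i)" by (auto simp: U_def)
    finally have diff: "(\<lambda>n. measure M (\<Union>i. A i) - measure M (U n)) \<longlonglongrightarrow>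
        measure M (\<Union>i. A i) - measure M (\<Union>i. A i)"
      by (intro tendsto_intros)
    have "(\<lambda>n. measure M (R n)) \<longlonglongrightarrow> 0"
    proof -
      have "measure M (R n) = measure M (\<Union>i. A i) - measure M (U n)" for n
        unfolding R_def using sets(1,2) by (intro finite_measure_Diff) (auto simp: U_def)
      then show ?thesis using diff by simp
    qed
    then show "(\<lambda>n. vnorm X ((\<Oplus>i\<in>{..<n}. G (A i)) \<ominus> G (\<Union>i. A i))) \<longlonglongrightarrow> 0"
      unfolding fin eq
    proof (rule Lim_null_comparison[rotated])
      have "norm (vnorm X (\<ominus> G (R n))) \<le> measure M (R n)" for n
        using le[OF sets(3)] mem[OF sets(3)] by (simp add: vnorm_minus vnorm_nonneg)
      then show "\<forall>\<^sub>F n in sequentially. norm (vnorm X (\<ominus> G (R n))) \<le> measure M (R n)" by simp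
    qed
  qed
  show "bounded_variation X M G"
    unfolding bounded_variation_def
  proof (intro exI[of _ "measure M (space M)"] allI impI, elim conjE)
    fix P assume P: "finite P" "P \<subseteq> sets M" "partition_on (space M) P"
    have "(\<Sum>E\<in>P. vnorm X (G E)) \<le> (\<Sum>E\<in>P. measure M E)"
      by (rule sum_mono) (use P(2) le in blast)
    also have "\<dots> = measure M (\<Union>E\<in>P. E)"
    proof (rule finite_measure_finite_Union[symmetric])
      show "disjoint_family_on (\<lambda>E. E) P"
        unfolding disjoint_family_on_def using disjointD[OF partition_onD2[OF P(3)]] by blast
    qed (use P in auto)
    also have "\<dots> = measure M (space M)" using partition_onD1[OF P(3)] by simp
    finally show "(\<Sum>E\<in>P. vnorm X (G E)) \<le> measure M (space M)" .
  qed
  show "measure_continuous X M G"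
    unfolding measure_continuous_def
  proof (intro allI impI)
    fix \<epsilon> :: real assume "0 < \<epsilon>"
    then show "\<exists>\<delta>>0. \<forall>E\<in>sets M. measure M E < \<delta> \<longrightarrow> vnorm X (G E) < \<epsilon>"
      using le by (intro exI[of _ \<epsilon>]) (auto intro: order_le_less_trans)
  qed
qed

text \<open>
  The measure space is copied along an injection \<open>\<phi>\<close> into a type for which the Radon-Nikodym
  property is known, and the partition is pulled back.
\<close>

lemma RNP_almost_constant_on_partition:
  fixes M :: "'b measure" and \<phi> :: "'b \<Rightarrow> 's"
  assumes rnp: "RNP TYPE('s) X" and inj: "inj \<phi>" and M: "finite_measure M"
    and mem: "\<And>E. E \<in> sets M \<Longrightarrow> G E \<in> carrier X"
    and Un: "\<And>A B. A \<in> sets M \<Longrightarrow> B \<in> sets M \<Longrightarrow> A \<inter> B = {} \<Longrightarrow> G (A \<union> B) = G A \<oplus> G B"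
    and le: "\<And>E. E \<in> sets M \<Longrightarrow> vnorm X (G E) \<le> measure M E"
    and \<kappa>: "0 < \<kappa>"
  shows "\<exists>k \<in> measurable M (count_space (UNIV :: nat set)). \<exists>v. \<forall>n. v n \<in> carrier X \<and>
    (\<forall>E\<in>sets M. (\<forall>x\<in>E. k x = n) \<longrightarrow>
      vnorm X (G E \<ominus> of_real (measure M E) \<odot>\<^bsub>X\<^esub> v n) \<le> \<kappa> * measure M E)"
proof -
  interpret finite_measure M by fact
  define N where "N = embed_measure M \<phi>"
  define H where "H E = G (\<phi> -` E)" for E
  have sets: "\<phi> -` A \<in> sets M" if "A \<in> sets N" for A
    using that inj by (auto simp: N_def sets_embed_measure inj_vimage_image_eq)
  have img: "\<phi> ` A \<in> sets N" "measure N (\<phi> ` A) = measure M A" "H (\<phi> ` A) = G A" if "A \<in> sets M" for A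
    using that inj
    by (auto simp: N_def H_def in_sets_embed_measure measure_def emeasure_embed_measure_image inj_vimage_image_eq)
  have meas: "measure N A = measure M (\<phi> -` A)" if "A \<in> sets N" for A
    using that inj img by (auto simp: N_def sets_embed_measure inj_vimage_image_eq)
  have N: "finite_measure N"
  proof (rule finite_measureI)
    show "emeasure N (space N) \<noteq> \<infinity>"
      using inj by (simp add: N_def space_embed_measure emeasure_embed_measure_image)
  qed
  have H_mem: "H E \<in> carrier X" and H_le: "vnorm X (H E) \<le> measure N E" if "E \<in> sets N" for E
    using sets[OF that] by (simp_all add: H_def mem le meas that)
  have H_Un: "H (A \<union> B) = H A \<oplus> H B" if "A \<in> sets N" "B \<in> sets N" "A \<inter> B = {}" for A B
    unfolding H_def vimage_Un using that sets by (intro Un) auto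
  note vector_measure_if_dominated[OF N H_mem H_Un H_le]
  then obtain g where "\<And>E. E \<in> sets N \<Longrightarrow> has_bochner_int X N E g (H E)"
    using rnp N unfolding RNP_def by blast
  from density_almost_constant_on_partition[OF N this \<kappa>]
  obtain k v where k: "k \<in> measurable N (count_space (UNIV :: nat set))" and v: "\<And>n. v n \<in> carrier X"
    and close: "\<And>n E. E \<in> sets N \<Longrightarrow> (\<forall>x\<in>E. k x = n) \<Longrightarrow>
      vnorm X (H E \<ominus> of_real (measure N E) \<odot>\<^bsub>X\<^esub> v n) \<le> \<kappa> * measure N E"
    by blast
  show ?thesis
  proof (intro bexI[of _ "\<lambda>x. k (\<phi> x)"] exI[of _ v] allI conjI v ballI impI)
    show "(\<lambda>x. k (\<phi> x)) \<in> measurable M (count_space UNIV)"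
      using k measurable_embed_measure2[OF inj, of M] unfolding N_def by (rule measurable_compose[rotated])
    fix n E assume "E \<in> sets M" "\<forall>x\<in>E. k (\<phi> x) = n"
    then show "vnorm X (G E \<ominus> of_real (measure M E) \<odot>\<^bsub>X\<^esub> v n) \<le> \<kappa> * measure M E"
      using close[of "\<phi> ` E" n] img[of E] by simp
  qed
qed

end

section \<open>Range spaces with the Radon-Nikodym property\<close>

lemma integrable_partition:
  fixes f :: "'a \<Rightarrow> 'b::{banach, second_countable_topology}" and k :: "'a \<Rightarrow> nat"
  assumes [measurable]: "k \<in> measurable M (count_space UNIV)" and f: "integrable M f"
  shows "integrable M (\<lambda>x. if k x = n then f x else 0)"
    and "summable (\<lambda>n. LINT x|M. norm (if k x = n then f x else 0))"
proof -
  have int: "integrable M (\<lambda>x. if k x = n then f x else 0)" for n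
    by (rule Bochner_Integration.integrable_bound[OF f]) (use f in \<open>auto simp: borel_measurable_integrable\<close>)
  then show "integrable M (\<lambda>x. if k x = n then f x else 0)" .
  have "(\<Sum>i<m. LINT x|M. norm (if k x = i then f x else 0)) \<le> (LINT x|M. norm (f x))" for m
  proof -
    have "(\<Sum>i<m. LINT x|M. norm (if k x = i then f x else 0)) =
        (LINT x|M. (\<Sum>i<m. norm (if k x = i then f x else 0)))"
      using int by (intro Bochner_Integration.integral_sum[symmetric] integrable_norm)
    also have "\<dots> \<le> (LINT x|M. norm (f x))"
    proof (rule integral_mono)
      show "integrable M (\<lambda>x. \<Sum>i<m. norm (if k x = i then f x else 0))"
        using int by (intro Bochner_Integration.integrable_sum integrable_norm)
      fix x
      have "(\<Sum>i<m. norm (if k x = i then f x else 0)) = (\<Sum>i<m. if k x = i then norm (f x) else 0)"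
        by (intro sum.cong) auto
      then show "(\<Sum>i<m. norm (if k x = i then f x else 0)) \<le> norm (f x)" by simp
    qed (use f in simp)
    finally show ?thesis .
  qed
  then show "summable (\<lambda>n. LINT x|M. norm (if k x = n then f x else 0))"
    by (intro summableI_nonneg_bounded) auto
qed

lemma sums_integral_partition:
  fixes f :: "'a \<Rightarrow> 'b::{banach, second_countable_topology}" and k :: "'a \<Rightarrow> nat"
  assumes int: "\<And>n. integrable M (\<lambda>x. if k x = n then f x else 0)"
    and sum: "summable (\<lambda>n. LINT x|M. norm (if k x = n then f x else 0))"
  shows "integrable M f"
    and "(\<lambda>n. LINT x|M. (if k x = n then f x else 0)) sums (LINT x|M. f x)"
    and "(\<lambda>n. LINT x|M. norm (if k x = n then f x else 0)) sums (LINT x|M. norm (f x))"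
proof -
  have 1: "(\<lambda>n. if k x = n then c else 0) sums c" for c :: "'c::{topological_comm_monoid_add, t2_space}" and x
    using sums_single[of "k x" "\<lambda>_. c"] by (simp add: eq_commute)
  have 2: "norm (if k x = n then f x else 0) = (if k x = n then norm (f x) else 0)" for x n by simp
  have "AE x in M. summable (\<lambda>n. norm (if k x = n then f x else 0))"
    unfolding 2 using sums_summable[OF 1] by simp
  note * = this sum
  have eq: "(\<lambda>x. \<Sum>n. if k x = n then f x else 0) = f"
    by (intro ext sums_unique[symmetric] 1)
  show "integrable M f"
    using integrable_suminf[OF int *] unfolding eq .
  show "(\<lambda>n. LINT x|M. (if k x = n then f x else 0)) sums (LINT x|M. f x)"
    using sums_integral[OF int *] unfolding eq .
  have *: "AE x in M. summable (\<lambda>n. norm (norm (if k x = n then f x else 0)))"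
    "summable (\<lambda>n. LINT x|M. norm (norm (if k x = n then f x else 0)))"
    using * by simp_all
  have eq: "(\<lambda>x. \<Sum>n. norm (if k x = n then f x else 0)) = (\<lambda>x. norm (f x))"
    unfolding 2 by (intro ext sums_unique[symmetric] 1)
  show "(\<lambda>n. LINT x|M. norm (if k x = n then f x else 0)) sums (LINT x|M. norm (f x))"
    using sums_integral[OF integrable_norm[OF int] *] unfolding eq .
qed

text \<open>
  A countable partition \<open>{k = n}\<close> links \<open>L\<^sub>1(M)\<close> with \<open>\<ell>\<^sub>1\<close>: \<open>averages\<close> integrates over the cells, and
  \<open>spread\<close> places the mass \<open>x n\<close> on the \<open>n\<close>-th cell with density proportional to \<open>h\<close>. Cells of mass zero
  receive nothing, since \<open>1 / 0 = 0\<close>; hence \<open>averages (spread x)\<close> is the restriction of \<open>x\<close> to the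
  indices of the other cells.
\<close>

locale partitioned_density_operator = density_operator Y M t h
  for Y :: "('k::{real_normed_field, euclidean_space}, 'y, 'n) nspace_scheme" (structure)
    and M :: "'a measure" and t :: "('a \<Rightarrow> 'k) \<Rightarrow> 'y" and h :: "'a \<Rightarrow> real" +
  fixes k :: "'a \<Rightarrow> nat"
  assumes k [measurable]: "k \<in> measurable M (count_space UNIV)"
begin

lemma measurable_h [measurable]: "h \<in> borel_measurable M"
  using h_integrable by (rule borel_measurable_integrable)

definition D :: "'a set" where "D = {x \<in> space M. 0 < h x}"

definition cell :: "nat \<Rightarrow> 'a set" where "cell n = {x \<in> D. k x = n}"

definition averages :: "('a \<Rightarrow> 'k) \<Rightarrow> nat \<Rightarrow> 'k" where
  "averages f n = (LINT x|M. indicator (cell n) x * f x)"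

definition spread :: "(nat \<Rightarrow> 'k) \<Rightarrow> 'a \<Rightarrow> 'k" where
  "spread x \<omega> = indicator D \<omega> * (x (k \<omega>) * of_real (h \<omega> / mass (cell (k \<omega>))))"

definition charged :: "nat \<Rightarrow> 'k" where
  "charged n = (if mass (cell n) = 0 then 0 else 1)"

lemma D_sets [measurable]: "D \<in> sets M"
  unfolding D_def by measurable

lemma cell_sets [measurable]: "cell n \<in> sets M"
proof -
  have "cell n = {x \<in> space M. 0 < h x \<and> k x = n}" by (auto simp: cell_def D_def)
  then show ?thesis by simp
qed

lemma cell_eq: "indicator (cell n) x * f x = (if k x = n then indicator D x * f x else 0)" for f :: "'a \<Rightarrow> 'k"
  by (auto simp: cell_def split: split_indicator)

lemma averages_l1:
  assumes f: "integrable M f"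
  shows "averages f \<in> carrier l1" "vnorm l1 (averages f) \<le> (LINT x|M. norm (f x))"
proof -
  note Df = integral_indicator_split(1,4)[OF D_sets f]
  note part = integrable_partition[OF k Df(1)]
  note sums = sums_integral_partition(3)[OF part]
  have le: "norm (averages f n) \<le> (LINT x|M. norm (if k x = n then indicator D x * f x else 0))" for n
    unfolding averages_def cell_eq by (rule integral_norm_bound)
  then have summ: "summable (\<lambda>n. norm (averages f n))"
    by (intro summable_comparison_test'[OF part(2), of 0]) simp
  then show "averages f \<in> carrier l1" by (simp add: l1_simps)
  have "(\<Sum>n. norm (averages f n)) \<le> (\<Sum>n. LINT x|M. norm (if k x = n then indicator D x * f x else 0))"
    by (intro suminf_le le summ part(2))
  also have "\<dots> = (LINT x|M. norm (indicator D x * f x))" using sums by (simp add: sums_iff)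
  also have "\<dots> \<le> (LINT x|M. norm (f x))" using Df(2) by simp
  finally show "vnorm l1 (averages f) \<le> (LINT x|M. norm (f x))" by (simp add: l1_simps)
qed

lemma averages_add:
  assumes "integrable M f" "integrable M g"
  shows "averages (\<lambda>x. f x + g x) = averages f \<oplus>\<^bsub>l1\<^esub> averages g"
  unfolding averages_def l1_simps distrib_left using assms
  by (intro ext Bochner_Integration.integral_add integral_indicator_split(1) cell_sets)

lemma averages_smult: "averages (\<lambda>x. c * f x) = c \<odot>\<^bsub>l1\<^esub> averages f"
  by (simp add: averages_def l1_simps fun_eq_iff mult.left_commute)

lemma L1_operator_averages:
  assumes W: "contraction l1 Y W"
  shows "L1_operator Y M 1 (\<lambda>f. W (averages f))"
proof
  fix f :: "'a \<Rightarrow> 'k" assume "integrable M f"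
  note f = averages_l1[OF this]
  show "vnorm Y (W (averages f)) \<le> 1 * (LINT x|M. norm (f x))"
    using W f by (force simp: contraction_def)
qed (use W averages_l1(1) in \<open>simp_all add: contraction_def averages_add averages_smult\<close>)

lemma cell_spread:
  "indicator (cell n) \<omega> * spread x \<omega> =
    x n * of_real (1 / mass (cell n)) * (indicator (cell n) \<omega> * of_real (h \<omega>))"
  by (auto simp: spread_def cell_def split: split_indicator)

lemma averages_spread: "averages (spread x) = (\<lambda>n. x n * charged n)"
  by (auto simp: averages_def cell_spread h_indicator charged_def fun_eq_iff)

lemma spread:
  assumes x: "x \<in> carrier l1"
  shows "integrable M (spread x)" "(LINT \<omega>|M. norm (spread x \<omega>)) = (\<Sum>n. norm (x n * charged n))"
proof -
  have cell: "(if k \<omega> = n then spread x \<omega> else 0) = indicator (cell n) \<omega> * spread x \<omega>" for n \<omega>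
    by (auto simp: spread_def cell_def split: split_indicator)
  have int: "integrable M (\<lambda>\<omega>. if k \<omega> = n then spread x \<omega> else 0)" for n
    unfolding cell cell_spread using h_indicator(1)[of "cell n"] by (intro integrable_mult_right) simp
  have norm: "(LINT \<omega>|M. norm (if k \<omega> = n then spread x \<omega> else 0)) = norm (x n * charged n)" for n
    unfolding cell cell_spread norm_mult[of "x n * of_real (1 / mass (cell n))"]
    using mass_nonneg[of "cell n"]
    by (simp add: h_indicator(2) norm_divide charged_def del: norm_mult)
  have "summable (\<lambda>n. norm (x n * charged n))"
    by (rule summable_comparison_test'[of "\<lambda>n. norm (x n)" 0])
      (use x in \<open>auto simp: l1_simps charged_def\<close>)
  then have "summable (\<lambda>n. LINT \<omega>|M. norm (if k \<omega> = n then spread x \<omega> else 0))"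
    unfolding norm .
  note sums = sums_integral_partition[OF int this]
  show "integrable M (spread x)" by (rule sums(1))
  show "(LINT \<omega>|M. norm (spread x \<omega>)) = (\<Sum>n. norm (x n * charged n))"
    using sums(3) unfolding norm by (simp add: sums_iff)
qed

lemma vnorm_charged_le:
  assumes x: "x \<in> carrier l1"
  shows "(\<lambda>n. x n * charged n) \<in> carrier l1" "(\<Sum>n. norm (x n * charged n)) \<le> vnorm l1 x"
proof -
  have le: "norm (x n * charged n) \<le> norm (x n)" for n by (simp add: charged_def)
  have summ: "summable (\<lambda>n. norm (x n * charged n))"
    by (rule summable_comparison_test'[of "\<lambda>n. norm (x n)" 0]) (use x le in \<open>simp_all add: l1_simps\<close>)
  then show "(\<lambda>n. x n * charged n) \<in> carrier l1" by (simp add: l1_simps)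
  show "(\<Sum>n. norm (x n * charged n)) \<le> vnorm l1 x"
    unfolding l1_simps by (rule suminf_le[OF le summ]) (use x in \<open>simp add: l1_simps\<close>)
qed

lemma contraction_spread: "contraction l1 Y (\<lambda>x. t (spread x))"
  unfolding contraction_def
proof (intro conjI ballI allI)
  fix x y :: "nat \<Rightarrow> 'k" and c :: 'k assume x: "x \<in> carrier l1"
  show "t (spread x) \<in> carrier Y" using spread[OF x] by simp
  have "t (spread (c \<odot>\<^bsub>l1\<^esub> x)) = t (\<lambda>\<omega>. c * spread x \<omega>)"
    by (rule arg_cong[of _ _ t]) (simp add: spread_def l1_simps fun_eq_iff)
  then show "t (spread (c \<odot>\<^bsub>l1\<^esub> x)) = c \<odot>\<^bsub>Y\<^esub> t (spread x)"
    using spread[OF x] by (simp add: smult)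
  show "vnorm Y (t (spread x)) \<le> vnorm l1 x"
    using bound[OF spread(1)[OF x]] spread(2)[OF x] vnorm_charged_le(2)[OF x] by simp
  assume y: "y \<in> carrier l1"
  have "t (spread (x \<oplus>\<^bsub>l1\<^esub> y)) = t (\<lambda>\<omega>. spread x \<omega> + spread y \<omega>)"
    by (rule arg_cong[of _ _ t]) (simp add: spread_def l1_simps fun_eq_iff distrib_left distrib_right add_divide_distrib)
  then show "t (spread (x \<oplus>\<^bsub>l1\<^esub> y)) = t (spread x) \<oplus> t (spread y)"
    using spread[OF x] spread[OF y] by (simp add: add)
qed

lemma averages_h: "averages (\<lambda>x. of_real (h x)) n = of_real (mass (cell n))"
  unfolding averages_def by (rule h_indicator(3)) simp

lemma spread_averages_h: "AE \<omega> in M. spread (averages (\<lambda>x. of_real (h x))) \<omega> = of_real (h \<omega>)"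
proof -
  have "AE \<omega> in M. mass (cell n) = 0 \<longrightarrow> \<omega> \<notin> cell n" for n
  proof (cases "mass (cell n) = 0")
    case True
    have "AE \<omega> in M. indicator (cell n) \<omega> * h \<omega> = 0"
      using True integral_indicator_split(1)[OF cell_sets h_integrable] h_nonneg
      unfolding mass_eq[OF cell_sets] by (subst (asm) integral_nonneg_eq_0_iff_AE) auto
    then show ?thesis by eventually_elim (auto simp: cell_def D_def split: split_indicator_asm)
  qed simp
  then have "AE \<omega> in M. \<forall>n. mass (cell n) = 0 \<longrightarrow> \<omega> \<notin> cell n" by (simp add: AE_all_countable)
  with AE_space show ?thesis
  proof eventually_elim
    case (elim \<omega>)
    show ?case
    proof (cases "\<omega> \<in> D")
      case True
      then have "mass (cell (k \<omega>)) \<noteq> 0" using elim(2) by (auto simp: cell_def)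
      then show ?thesis using True by (simp add: spread_def averages_h)
    next
      case False
      then have "h \<omega> = 0" using elim(1) h_nonneg[of \<omega>] by (auto simp: D_def)
      then show ?thesis by (simp add: spread_def)
    qed
  qed
qed

text \<open>
  The map \<open>spread (averages f)\<close> is the conditional expectation relative to the weight \<open>h\<close>. It suffices to
  test it on \<open>h 1\<^sub>E\<close> for sets \<open>E\<close> inside one cell, where it spreads the mass of \<open>E\<close> over the cell. Both
  averages of \<open>t\<close>, over \<open>E\<close> and over the cell, are then close to \<open>v n\<close>, which accounts for the factor \<open>2\<close>.
\<close>

lemma spread_averages_close:
  assumes v: "\<And>n. v n \<in> carrier Y"
    and close: "\<And>n E. E \<in> sets M \<Longrightarrow> (\<forall>x\<in>E. k x = n) \<Longrightarrow>
      vnorm Y (vmeas E \<ominus> of_real (mass E) \<odot>\<^bsub>Y\<^esub> v n) \<le> \<kappa> * mass E"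
    and f: "integrable M f" and supp: "\<And>x. x \<in> space M \<Longrightarrow> x \<notin> D \<Longrightarrow> f x = 0"
  shows "vnorm Y (t (spread (averages f)) \<ominus> t f) \<le> 2 * \<kappa> * (LINT x|M. norm (f x))"
proof -
  interpret r: L1_operator Y M "1 + 1" "\<lambda>f. t (spread (averages f)) \<ominus> t f"
    by (intro L1_operator_diff L1_operator_averages contraction_spread L1_operator_axioms)
  have "r.dominated (2 * \<kappa>) f"
  proof (rule r.dominated_countable_partition[OF k f])
    fix n
    have eq: "indicator {x. k x = n} x * f x = indicator (cell n) x * f x" if "x \<in> space M" for x
      using supp[OF that] by (auto simp: cell_def split: split_indicator)
    have "r.dominated (2 * \<kappa>) (\<lambda>x. indicator (cell n) x * f x)"
    proof (rule r.dominated_if_dominated_on_sets[OF h_integrable cell_sets])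
      show "0 < h x" if "x \<in> cell n" for x using that by (simp add: cell_def D_def)
      fix E assume E: "E \<in> sets M" "E \<subseteq> cell n"
      let ?m = "mass E" and ?c = "mass (cell n)" and ?hE = "\<lambda>x. indicator E x * of_real (h x) :: 'k"
      have kE: "\<forall>x\<in>E. k x = n" "\<forall>x\<in>cell n. k x = n" using E by (auto simp: cell_def)
      have mc: "?m \<le> ?c" unfolding mass_def using E by (intro N.finite_measure_mono) auto
      have avg: "averages ?hE = (\<lambda>i. if i = n then of_real ?m else 0)"
      proof
        fix i
        have "indicator (cell i) x * ?hE x = (if i = n then ?hE x else 0)" for x
          using E(2) by (auto simp: cell_def split: split_indicator)
        then show "averages ?hE i = (if i = n then of_real ?m else 0)"
          using h_indicator(3)[OF E(1)] by (simp add: averages_def)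
      qed
      have "t (spread (averages ?hE)) = t (\<lambda>x. of_real (?m / ?c) * (indicator (cell n) x * of_real (h x)))"
        by (rule arg_cong[of _ _ t]) (auto simp: spread_def avg cell_def fun_eq_iff split: split_indicator)
      also have "\<dots> = of_real (?m / ?c) \<odot>\<^bsub>Y\<^esub> vmeas (cell n)"
        unfolding vmeas_def using h_indicator(1)[OF cell_sets] by (intro smult)
      finally have r: "t (spread (averages ?hE)) \<ominus> t ?hE = of_real (?m / ?c) \<odot>\<^bsub>Y\<^esub> vmeas (cell n) \<ominus> vmeas E"
        by (simp add: vmeas_def)
      have "vnorm Y (of_real (?m / ?c) \<odot>\<^bsub>Y\<^esub> vmeas (cell n) \<ominus> vmeas E) \<le> 2 * \<kappa> * ?m"
      proof (cases "?m = 0")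
        case True
        then have "vmeas E = \<zero>"
          using vmeas[OF E(1)] vnorm_nonneg[of "vmeas E"] by (simp add: vnorm_eq_0_iff[symmetric])
        then show ?thesis using True vmeas[OF cell_sets] by simp
      next
        case False
        then have pos: "0 < ?m" "0 < ?c" using mass_nonneg[of E] mc by auto
        let ?a = "of_real (?m / ?c) :: 'k"
        have mem: "vmeas E \<in> carrier Y" "vmeas (cell n) \<in> carrier Y" "v n \<in> carrier Y"
          using vmeas E(1) v by auto
        have "?a \<odot>\<^bsub>Y\<^esub> vmeas (cell n) \<ominus> of_real ?m \<odot>\<^bsub>Y\<^esub> v n = ?a \<odot>\<^bsub>Y\<^esub> (vmeas (cell n) \<ominus> of_real ?c \<odot>\<^bsub>Y\<^esub> v n)"
          using pos mem by (simp add: smult_diff smult_smult)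
        then have "vnorm Y (?a \<odot>\<^bsub>Y\<^esub> vmeas (cell n) \<ominus> of_real ?m \<odot>\<^bsub>Y\<^esub> v n) =
            ?m / ?c * vnorm Y (vmeas (cell n) \<ominus> of_real ?c \<odot>\<^bsub>Y\<^esub> v n)"
          using pos mem by (simp add: vnorm_smult norm_divide)
        also have "\<dots> \<le> ?m / ?c * (\<kappa> * ?c)"
          using pos close[OF cell_sets kE(2)] by (intro mult_left_mono) auto
        also have "\<dots> = \<kappa> * ?m" using pos by simp
        finally have "vnorm Y (?a \<odot>\<^bsub>Y\<^esub> vmeas (cell n) \<ominus> of_real ?m \<odot>\<^bsub>Y\<^esub> v n) \<le> \<kappa> * ?m" .
        then show ?thesis
          using close[OF E(1) kE(1)] mem
            vnorm_diff_triangle[of "?a \<odot>\<^bsub>Y\<^esub> vmeas (cell n)" "of_real ?m \<odot>\<^bsub>Y\<^esub> v n" "vmeas E"]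
            vnorm_diff_commute[of "vmeas E" "of_real ?m \<odot>\<^bsub>Y\<^esub> v n"] by simp
      qed
      then show "r.dominated (2 * \<kappa>) ?hE"
        unfolding r.dominated_def r using h_indicator[OF E(1)] by simp
    qed (use integral_indicator_split(1)[OF cell_sets f] in auto)
    then show "r.dominated (2 * \<kappa>) (\<lambda>x. indicator {x. k x = n} x * f x)"
      using r.dominated_cong[of "\<lambda>x. indicator {x. k x = n} x * f x" "\<lambda>x. indicator (cell n) x * f x"] eq
      by simp
  qed
  then show ?thesis by (simp add: r.dominated_def)
qed

end

text \<open>
  The Radon-Nikodym property provides a partition on whose cells the averages of \<open>t\<close> hardly vary. The
  operator is thereby transported to \<open>\<ell>\<^sub>1\<close>, without changing its value at \<open>h\<close>, since \<open>h\<close> is its own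
  conditional expectation. There the property is known; its witnesses are carried back by
  \<open>averages\<close> and \<open>spread\<close>, while nothing is changed on the set where \<open>h\<close> vanishes.
\<close>

theorem BPBp_L1_RNP:
  fixes Y :: "('k::{real_normed_field, euclidean_space}, 'y, 'n) nspace_scheme" and M :: "'a measure"
    and \<phi> :: "'a \<Rightarrow> 's"
  assumes Y: "normed_space Y" and rnp: "RNP TYPE('s) Y" and inj: "inj \<phi>" and l1: "BPBp l1 Y"
  shows "BPBp (Lp 1 M) Y"
proof (rule BPBp_L1I[OF Y])
  interpret Y: normed_space Y by fact
  interpret l1: normed_space "l1 :: ('k, nat \<Rightarrow> 'k) nspace" by (rule normed_space_l1)
  fix \<epsilon> :: real assume \<epsilon>: "0 < \<epsilon>" "\<epsilon> < 1"
  \<comment> \<open>The errors of passing to \<open>\<ell>\<^sub>1\<close> and of the approximation there will be at most \<open>\<gamma>\<close> each.\<close>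
  define \<gamma> where "\<gamma> = \<epsilon> / 4"
  have \<gamma>: "0 < \<gamma>" "\<gamma> < 1" using \<epsilon> by (auto simp: \<gamma>_def)
  obtain \<eta> where \<eta>: "\<eta> > 0" and bpb: "\<And>U x\<^sub>0. contraction l1 Y U \<Longrightarrow> x\<^sub>0 \<in> unit_sphere l1 \<Longrightarrow>
      vnorm Y (U x\<^sub>0) > 1 - \<eta> \<Longrightarrow>
      \<exists>z V. z \<in> unit_sphere l1 \<and> contraction l1 Y V \<and> vnorm Y (V z) = 1 \<and>
         vnorm l1 (z \<ominus>\<^bsub>l1\<^esub> x\<^sub>0) < \<gamma> \<and> (\<forall>x\<in>carrier l1. vnorm Y (V x \<ominus>\<^bsub>Y\<^esub> U x) \<le> \<gamma> * vnorm l1 x)"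
    by (rule BPBpD[OF normed_space_l1 Y l1 \<gamma>]) (rule that, assumption, blast)
  have "\<exists>s f. L1_operator Y M 1 s \<and> integrable M f \<and> (LINT x|M. norm (f x)) = 1 \<and> vnorm Y (s f) = 1 \<and>
        (LINT x|M. norm (f x - of_real (h x))) < \<epsilon> \<and>
        (\<forall>\<phi>. integrable M \<phi> \<longrightarrow> vnorm Y (s \<phi> \<ominus>\<^bsub>Y\<^esub> t \<phi>) \<le> \<epsilon> * (LINT x|M. norm (\<phi> x)))"
    if t: "L1_operator Y M 1 t" and h: "integrable M h" "\<And>x. 0 \<le> h x" "(LINT x|M. h x) = 1"
      and big: "1 - \<eta> < vnorm Y (t (\<lambda>x. of_real (h x)))" for t and h :: "'a \<Rightarrow> real"
  proof -
    interpret density_operator Y M t h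
      using t h by (simp add: density_operator_def density_operator_axioms_def)
    have "\<exists>k \<in> measurable (density M h) (count_space (UNIV :: nat set)). \<exists>v. \<forall>n. v n \<in> carrier Y \<and>
      (\<forall>E\<in>sets (density M h). (\<forall>x\<in>E. k x = n) \<longrightarrow>
        vnorm Y (vmeas E \<ominus>\<^bsub>Y\<^esub> of_real (measure (density M h) E) \<odot>\<^bsub>Y\<^esub> v n) \<le> \<gamma> / 2 * measure (density M h) E)"
      using \<gamma> vmeas vmeas_Un
      by (intro Y.RNP_almost_constant_on_partition[OF rnp inj N.finite_measure_axioms])
        (auto simp: mass_def)
    then obtain k v where "k \<in> measurable (density M h) (count_space (UNIV :: nat set))" and
      kv: "\<And>n. v n \<in> carrier Y \<and> (\<forall>E\<in>sets (density M h). (\<forall>x\<in>E. k x = n) \<longrightarrow>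
        vnorm Y (vmeas E \<ominus>\<^bsub>Y\<^esub> of_real (measure (density M h) E) \<odot>\<^bsub>Y\<^esub> v n) \<le> \<gamma> / 2 * measure (density M h) E)"
      by blast
    then have k: "k \<in> measurable M (count_space UNIV)" by simp
    have v: "v n \<in> carrier Y" for n using kv by blast
    have close: "vnorm Y (vmeas E \<ominus>\<^bsub>Y\<^esub> of_real (mass E) \<odot>\<^bsub>Y\<^esub> v n) \<le> \<gamma> / 2 * mass E"
      if "E \<in> sets M" "\<forall>x\<in>E. k x = n" for n E
      using kv[of n] that unfolding mass_def sets_density by blast
    interpret partitioned_density_operator Y M t h k
      by unfold_locales (rule k)
    let ?h = "\<lambda>x. of_real (h x) :: 'k"
    have h_int: "integrable M ?h" using h(1) by simp
    define x\<^sub>0 where "x\<^sub>0 = averages ?h"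
    have x0: "x\<^sub>0 \<in> carrier l1" "x\<^sub>0 n = x\<^sub>0 n * charged n" for n
      using averages_l1(1)[OF h_int] by (auto simp: x\<^sub>0_def averages_h charged_def)
    have hx0: "AE \<omega> in M. spread x\<^sub>0 \<omega> = ?h \<omega>" unfolding x\<^sub>0_def by (rule spread_averages_h)
    have "vnorm l1 x\<^sub>0 = (LINT \<omega>|M. norm (spread x\<^sub>0 \<omega>))"
      unfolding spread(2)[OF x0(1)] x0(2)[symmetric] l1_simps ..
    also have "\<dots> = (LINT \<omega>|M. norm (?h \<omega>))"
      using spread(1)[OF x0(1)] h_int hx0
      by (intro integral_cong_AE) (auto simp: borel_measurable_integrable)
    also have "\<dots> = 1" using h by simp
    finally have "x\<^sub>0 \<in> unit_sphere l1" using x0(1) by (simp add: unit_sphere_def)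
    moreover have "t (spread x\<^sub>0) = t ?h"
      by (rule cong_AE[OF spread(1)[OF x0(1)] h_int hx0])
    ultimately obtain z V where z: "z \<in> unit_sphere l1" and V: "contraction l1 Y V"
      and Vz: "vnorm Y (V z) = 1" and zx0: "vnorm l1 (z \<ominus>\<^bsub>l1\<^esub> x\<^sub>0) < \<gamma>"
      and VU: "\<And>x. x \<in> carrier l1 \<Longrightarrow> vnorm Y (V x \<ominus>\<^bsub>Y\<^esub> t (spread x)) \<le> \<gamma> * vnorm l1 x"
      using bpb[OF contraction_spread] big by (metis (no_types, lifting))

    \<comment> \<open>The part \<open>z'\<close> of \<open>z\<close> on the charged cells; \<open>V\<close> attains its norm at \<open>z'\<close> as well, and the rest
      of \<open>z\<close> is small because \<open>x\<^sub>0\<close> lives on the charged cells.\<close>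
    define z' where "z' = (\<lambda>n. z n * charged n)"
    have zc: "z \<in> carrier l1" "vnorm l1 z = 1" using z by (auto simp: unit_sphere_def)
    have z'c: "z' \<in> carrier l1" unfolding z'_def by (rule vnorm_charged_le(1)[OF zc(1)])
    define u where "u = (\<lambda>n. z n - z' n)"
    have uc: "u \<in> carrier l1" and zu: "z = z' \<oplus>\<^bsub>l1\<^esub> u"
    proof -
      have "u = z \<ominus>\<^bsub>l1\<^esub> z'" using zc z'c by (simp add: u_def l1_diff)
      then show "u \<in> carrier l1" using zc z'c by simp
    qed (simp add: u_def l1_simps)
    have s1: "summable (\<lambda>n. norm (z' n))" "summable (\<lambda>n. norm (u n))"
      using z'c uc by (simp_all add: l1_simps)
    define \<rho> where "\<rho> = vnorm l1 z'"
    have "norm (z n) = norm (z' n) + norm (u n)" for n by (simp add: u_def z'_def charged_def)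
    then have sum1: "\<rho> + vnorm l1 u = 1"
      using zc(2) suminf_add[OF s1] by (simp add: \<rho>_def l1_simps)
    have "vnorm l1 u \<le> vnorm l1 (z \<ominus>\<^bsub>l1\<^esub> x\<^sub>0)"
      unfolding l1_diff[OF zc(1) x0(1)] l1_simps
    proof (rule suminf_le[OF _ s1(2)])
      show "summable (\<lambda>n. norm (z n - x\<^sub>0 n))"
        using l1.minus_closed[OF zc(1) x0(1)] by (simp add: l1_diff[OF zc(1) x0(1)] l1_simps)
      show "norm (u n) \<le> norm (z n - x\<^sub>0 n)" for n
        using x0(2)[of n] by (auto simp: u_def z'_def charged_def split: if_splits)
    qed
    then have \<rho>: "1 - \<gamma> < \<rho>" "\<rho> \<le> 1" "0 < \<rho>"
      using sum1 zx0 \<gamma> l1.vnorm_nonneg[OF uc] by linarith+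
    have Vmem: "V z' \<in> carrier Y" "V u \<in> carrier Y" using V z'c uc by (auto simp: contraction_def)
    have Vz': "vnorm Y (V z') = \<rho>"
    proof (rule antisym)
      show "vnorm Y (V z') \<le> \<rho>" using V z'c by (simp add: contraction_def \<rho>_def)
      have "V z = V z' \<oplus>\<^bsub>Y\<^esub> V u" using V z'c uc zu by (auto simp: contraction_def)
      then have "1 \<le> vnorm Y (V z') + vnorm Y (V u)" using Vz Vmem Y.vnorm_triangle by metis
      moreover have "vnorm Y (V u) \<le> vnorm l1 u" using V uc by (simp add: contraction_def)
      ultimately show "\<rho> \<le> vnorm Y (V z')" using sum1 by simp
    qed

    interpret p: L1_operator Y M 1 "\<lambda>f. V (averages f)" by (rule L1_operator_averages[OF V])
    define s where "s = (\<lambda>f. t (\<lambda>x. indicator (- D) x * f x) \<oplus>\<^bsub>Y\<^esub> V (averages (\<lambda>x. indicator D x * f x)))"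
    note s = L1_operator_glue[OF t p.L1_operator_axioms D_sets s_def]
    define c where "c = (of_real (1 / \<rho>) :: 'k)"
    have c: "norm c = 1 / \<rho>" using \<rho> by (simp add: c_def norm_divide)
    define f where "f = (\<lambda>\<omega>. c * spread z \<omega>)"
    note spz = spread[OF zc(1)]
    have spz_norm: "(LINT \<omega>|M. norm (spread z \<omega>)) = \<rho>"
      unfolding spz(2) \<rho>_def by (simp add: z'_def l1_simps)
    have f: "integrable M f" "(LINT x|M. norm (f x)) = 1"
      using spz(1) spz_norm \<rho> c by (simp_all add: f_def norm_mult)
    have "s f = V (averages f)" using f(1) by (intro s(3)) (simp_all add: f_def spread_def)
    also have "averages f = c \<odot>\<^bsub>l1\<^esub> z'"
      unfolding f_def averages_smult averages_spread z'_def ..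
    also have "V \<dots> = c \<odot>\<^bsub>Y\<^esub> V z'" using V z'c by (simp add: contraction_def)
    finally have sf: "vnorm Y (s f) = 1" using Vmem Vz' c \<rho> by (simp add: Y.vnorm_smult)
    have dist: "(LINT x|M. norm (f x - ?h x)) < \<epsilon>"
    proof -
      let ?d = "z \<ominus>\<^bsub>l1\<^esub> x\<^sub>0"
      have d: "?d \<in> carrier l1" using zc x0 by simp
      have spd: "spread ?d \<omega> = spread z \<omega> - spread x\<^sub>0 \<omega>" for \<omega>
        by (simp add: spread_def l1_diff[OF zc(1) x0(1)] left_diff_distrib right_diff_distrib diff_divide_distrib)
      have "(LINT x|M. norm (f x - ?h x)) = (LINT x|M. norm ((c - 1) * spread z x + spread ?d x))"
      proof (rule integral_cong_AE)
        show "AE x in M. norm (f x - ?h x) = norm ((c - 1) * spread z x + spread ?d x)"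
          using hx0 by eventually_elim (simp add: f_def spd algebra_simps)
      qed (use f(1) h_int spz(1) spread(1)[OF d] in \<open>auto intro!: borel_measurable_integrable\<close>)
      also have "\<dots> \<le> (LINT x|M. norm (c - 1) * norm (spread z x) + norm (spread ?d x))"
        using spz(1) spread(1)[OF d]
        by (intro integral_mono) (auto simp: norm_mult[symmetric] norm_triangle_ineq)
      also have "\<dots> = norm (c - 1) * \<rho> + (LINT x|M. norm (spread ?d x))"
        using spz(1) spz_norm spread(1)[OF d] by simp
      also have "norm (c - 1) * \<rho> = 1 - \<rho>"
      proof -
        have "c - 1 = of_real (1 / \<rho> - 1)" by (simp add: c_def)
        then have "norm (c - 1) = 1 / \<rho> - 1" using \<rho> by (simp only: norm_of_real) auto
        then show ?thesis using \<rho> by (simp add: field_simps)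
      qed
      also have "(LINT x|M. norm (spread ?d x)) \<le> vnorm l1 ?d"
        unfolding spread(2)[OF d] by (rule vnorm_charged_le(2)[OF d])
      finally show ?thesis using \<rho> zx0 \<epsilon> by (simp add: \<gamma>_def)
    qed
    have "vnorm Y (s \<phi> \<ominus>\<^bsub>Y\<^esub> t \<phi>) \<le> \<epsilon> * (LINT x|M. norm (\<phi> x))" if \<phi>: "integrable M \<phi>" for \<phi>
    proof -
      let ?\<phi> = "\<lambda>x. indicator D x * \<phi> x"
      let ?n = "LINT x|M. norm (?\<phi> x)"
      note sp = integral_indicator_split[OF D_sets \<phi>]
      note av = averages_l1[OF sp(1)]
      have mem: "V (averages ?\<phi>) \<in> carrier Y" "t (spread (averages ?\<phi>)) \<in> carrier Y" "t ?\<phi> \<in> carrier Y"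
        using p.mem[OF sp(1)] spread(1)[OF av(1)] sp(1) by simp_all
      have "vnorm Y (V (averages ?\<phi>) \<ominus>\<^bsub>Y\<^esub> t (spread (averages ?\<phi>))) \<le> \<gamma> * ?n"
        using VU[OF av(1)] mult_left_mono[OF av(2), of \<gamma>] \<gamma> by linarith
      moreover have "vnorm Y (t (spread (averages ?\<phi>)) \<ominus>\<^bsub>Y\<^esub> t ?\<phi>) \<le> \<gamma> * ?n"
        using spread_averages_close[of v "\<gamma> / 2" ?\<phi>] v close sp(1) by simp
      ultimately have "vnorm Y (s \<phi> \<ominus>\<^bsub>Y\<^esub> t \<phi>) \<le> 2 * \<gamma> * ?n"
        unfolding s(2)[OF \<phi>] using Y.vnorm_diff_triangle[OF mem] by simp
      also have "\<dots> \<le> \<epsilon> * (LINT x|M. norm (\<phi> x))"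
      proof (rule mult_mono)
        show "?n \<le> (LINT x|M. norm (\<phi> x))" unfolding sp(4) by simp
      qed (use \<epsilon> in \<open>auto simp: \<gamma>_def\<close>)
      finally show ?thesis .
    qed
    then show ?thesis
      using s(1) f sf dist by (intro exI[of _ s] exI[of _ f]) auto
  qed
  then show "\<exists>\<eta>>0. \<forall>t h.
      L1_operator Y M 1 t \<and> integrable M h \<and> (\<forall>x. 0 \<le> h x) \<and> (LINT x|M. h x) = 1 \<and>
      vnorm Y (t (\<lambda>x. of_real (h x))) > 1 - \<eta> \<longrightarrow>
      (\<exists>s f. L1_operator Y M 1 s \<and> integrable M f \<and> (LINT x|M. norm (f x)) = 1 \<and> vnorm Y (s f) = 1 \<and>
        (LINT x|M. norm (f x - of_real (h x))) < \<epsilon> \<and>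
        (\<forall>\<phi>. integrable M \<phi> \<longrightarrow> vnorm Y (s \<phi> \<ominus>\<^bsub>Y\<^esub> t \<phi>) \<le> \<epsilon> * (LINT x|M. norm (\<phi> x))))"
    using \<eta>(1) by (intro exI[of _ \<eta>]) simp
qed

section \<open>The Bishop-Phelps-Bollobas property for operators on \<open>L\<^sub>1(\<mu>)\<close>\<close>

theorem corollary2p3:
  fixes \<mu> :: "'a measure" and \<nu> :: "'b measure"
  shows
    "(\<forall>Y :: (real, 'y) nspace.
        banach_space Y \<and> RNP TYPE('a + real) Y \<and> BPBp l1 Y \<longrightarrow> BPBp (Lp 1 \<mu>) Y) \<and>
     (\<forall>Y :: (complex, 'y) nspace.
        banach_space Y \<and> RNP TYPE('a + real) Y \<and> BPBp l1 Y \<longrightarrow> BPBp (Lp 1 \<mu>) Y) \<and>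
     (\<forall>q. 1 < q \<longrightarrow>
        BPBp (Lp 1 \<mu>) (Lp q \<nu> :: (real, ('b \<Rightarrow> real) set) nspace) \<and>
        BPBp (Lp 1 \<mu>) (Lp q \<nu> :: (complex, ('b \<Rightarrow> complex) set) nspace))"
proof (intro conjI allI impI; (elim conjE)?)
  have inj: "inj (Inl :: 'a \<Rightarrow> 'a + real)" by (rule inj_Inl)
  show "BPBp (Lp 1 \<mu>) Y" if "banach_space Y" "RNP TYPE('a + real) Y" "BPBp l1 Y" for Y :: "(real, 'y) nspace"
    using that by (intro BPBp_L1_RNP[OF _ _ inj]) (simp_all add: banach_space_def)
  show "BPBp (Lp 1 \<mu>) Y" if "banach_space Y" "RNP TYPE('a + real) Y" "BPBp l1 Y" for Y :: "(complex, 'y) nspace"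
    using that by (intro BPBp_L1_RNP[OF _ _ inj]) (simp_all add: banach_space_def)
  fix q :: real assume q: "1 < q"
  show "BPBp (Lp 1 \<mu>) (Lp q \<nu> :: (real, ('b \<Rightarrow> real) set) nspace)"
    using q by (intro BPBp_L1_uniformly_convex normed_space_Lp uniformly_convex_Lp) auto
  show "BPBp (Lp 1 \<mu>) (Lp q \<nu> :: (complex, ('b \<Rightarrow> complex) set) nspace)"
    using q by (intro BPBp_L1_uniformly_convex normed_space_Lp uniformly_convex_Lp) auto
qed

end
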